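(* The (Fréchet) differential of the functional $J^h_\delta$ at $(q,a)\in Q^h_{ad}\times A^h_{ad}$ in the direction $(\eta_q,\eta_a)\in V^h_1\times V^h_1$ is given by $${J^h_\delta}'(q,a)(\eta_q,\eta_a)=\int_\Omega\eta_q\left(|\nabla M^h_{g_\delta}(q,a)|^2-|\nabla N^h_{j_\delta}(q,a)|^2\right)dx+\int_\Omega\eta_a\left(|M^h_{g_\delta}(q,a)|^2-|N^h_{j_\delta}(q,a)|^2\right)dx.$$
   Context: $\Omega\subset\mathbb{R}^d$, $d\ge2$, is a bounded connected Lipschitz polygonal domain; $\Gamma\subset\partial\Omega$ is a $(d-1)$-dimensional measurable surface. For a measurable surface $S\subset\partial\Omega$, $H^{1/2}(S)$ is the space of $g\in L^2(S)$ with $\|g\|^2_{L^2(S)}+\int_S\int_S\frac{|g(x)-g(y)|^2}{|x-y|^{d}}\,dx\,dy<\infty$, and $H^{-1/2}(S)$ is its dual; $H^{-1}(\Omega):=H^1(\Omega)^*$. Fixed data: $f\in H^{-1}(\Omega)$, $j_0\in H^{-1/2}(\partial\Omega\setminus\Gamma)$, $\sigma\in L^\infty(\partial\Omega)$ with $\sigma\ge0$ a.e., $j_\delta\in H^{-1/2}(\Gamma)$, $g_\delta\in H^{1/2}(\Gamma)$. For constants $0<\underline q\le\overline q$, $0<\underline a\le\overline a$: $Q:=\{q\in L^\infty(\Omega):\underline q\le q\le\overline q\text{ a.e.}\}$, $A:=\{a\in L^\infty(\Omega):\underline a\le a\le\overline a\text{ a.e.}\}$. $\mathcal{T}^h$ is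 a regular triangulation of $\overline\Omega$ of mesh size $h$ (from a quasi-uniform family) such that each vertex of $\partial\Omega$ is a node. $V^h_1:=\{v\in C(\overline\Omega):v|_T$ is a polynomial of degree $\le1$ for all $T\in\mathcal{T}^h\}$, $V^h_{1,0}:=\{v\in V^h_1: v|_\Gamma=0\}$, $Q^h_{ad}:=Q\cap V^h_1$, $A^h_{ad}:=A\cap V^h_1$. Put $B_{q,a}(u,\phi):=\int_\Omega q\nabla u\cdot\nabla\phi\,dx+\int_\Omega au\phi\,dx+\int_{\partial\Omega}\sigma u\phi\,ds$. $N^h_{j_\delta}(q,a)\in V^h_1$ is the unique solution of $B_{q,a}(N^h_{j_\delta}(q,a),\phi)=\langle f,\phi\rangle+\langle j_\delta,\phi\rangle_{(H^{-1/2}(\Gamma),H^{1/2}(\Gamma))}+\langle j_0,\phi\rangle_{(H^{-1/2}(\partial\Omega\setminus\Gamma),H^{1/2}(\partial\Omega\setminus\Gamma))}$ for all $\phi\in V^h_1$. $M^h_{g_\delta}(q,a)\in V^h_1$ is the unique function with $M^h_{g_\delta}(q,a)|_\Gamma=g_\delta$ and $B_{q,a}(M^h_{g_\delta}(q,a),\phi)=\langle f,\phi\rangle+\langle j_0,\phi\rangle_{(H^{-1/2}(\partial\Omega\setminus\Gamma),H^{1/2}(\partial\Omega\setminus\Gamma))}$ for all $\phi\in V^h_{1,0}$; it is taken for granted that it exists (i.e. $g_\delta$ is the trace on $\Gamma$ of an element of $V^h_1$). With $w^h=N^h_{j_\delta}(q,a)-M^h_{g_\delta}(q,a)$, $J^h_\delta(q,a):=\int_\Omega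 q|\nabla w^h|^2dx+\int_\Omega a(w^h)^2dx+\int_{\partial\Omega}\sigma(w^h)^2ds$. For the purpose of differentiation these maps are defined by the same formulas for $(q,a)$ in an $L^\infty$-neighbourhood of the given point, where $q$ and $a$ remain bounded below by positive constants. *)

theory Defs
  imports "HOL-Analysis.Analysis" "HOL-Probability.Essential_Supremum"
begin

text \<open>Elements of function spaces over a set are represented by total functions on the
  ambient space; all the integrals and conditions below only see the values on that set, and
  functions that agree almost everywhere are not identified.\<close>


section \<open>Surface measure\<close>

text \<open>The \<open>k\<close>-dimensional Hausdorff measure for \<open>k \<ge> 1\<close>, normalised so that it agrees with
  Lebesgue measure on \<open>k\<close>-planes.  (For \<open>k = 0\<close> the empty sets of a cover would count as points;
  only \<open>k = DIM('a) - 1 \<ge> 1\<close> is used.)\<close>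

definition hausdorff_pre :: "nat \<Rightarrow> real \<Rightarrow> 'a::euclidean_space set \<Rightarrow> ennreal" where
  "hausdorff_pre k \<delta> S =
     (INF C \<in> {C :: nat \<Rightarrow> 'a set. S \<subseteq> (\<Union>i. C i) \<and> (\<forall>i. bounded (C i) \<and> diameter (C i) \<le> \<delta>)}.
        \<Sum>i. ennreal (unit_ball_vol (real k) * (diameter (C i) / 2) ^ k))"

definition hausdorff_outer :: "nat \<Rightarrow> 'a::euclidean_space set \<Rightarrow> ennreal" where
  "hausdorff_outer k S = (SUP \<delta> \<in> {0<..}. hausdorff_pre k \<delta> S)"

text \<open>\<open>hausdorff_outer k\<close> is a metric outer measure, hence countably additive on the Borel sets,
  so that \<open>measure_of\<close> does not fall back to the zero measure.\<close>

definition hausdorff_measure :: "nat \<Rightarrow> 'a::euclidean_space measure" where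
  "hausdorff_measure k = measure_of UNIV (sets borel) (hausdorff_outer k)"

definition surf :: "'a::euclidean_space set \<Rightarrow> 'a measure" where
  "surf \<Omega> = completion (restrict_space (hausdorff_measure (DIM('a) - 1)) (frontier \<Omega>))"


section \<open>Lipschitz polygonal domains\<close>

definition lipschitz_domain :: "'a::euclidean_space set \<Rightarrow> bool" where
  "lipschitz_domain \<Omega> \<longleftrightarrow>
     (\<forall>x\<in>frontier \<Omega>. \<exists>e r L \<gamma>. norm e = 1 \<and> r > 0 \<and> L-lipschitz_on {y. y \<bullet> e = 0} \<gamma> \<and>
        \<Omega> \<inter> ball x r = {y \<in> ball x r. y \<bullet> e > (\<gamma> (y - (y \<bullet> e) *\<^sub>R e) :: real)})"

definition lipschitz_polygonal_domain :: "'a::euclidean_space set \<Rightarrow> bool" where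
  "lipschitz_polygonal_domain \<Omega> \<longleftrightarrow>
     \<Omega> \<noteq> {} \<and> open \<Omega> \<and> connected \<Omega> \<and> bounded \<Omega> \<and> lipschitz_domain \<Omega> \<and>
     (\<exists>\<P>. finite \<P> \<and> (\<forall>P\<in>\<P>. polytope P) \<and> closure \<Omega> = \<Union>\<P>)"

text \<open>A point of a polyhedral surface \<open>S\<close> is a vertex iff it lies in the relative interior of no
  face of positive dimension, that is, iff \<open>S\<close> is near this point not invariant under the
  translations along any line.\<close>

definition surface_vertex :: "'a::euclidean_space set \<Rightarrow> 'a \<Rightarrow> bool" where
  "surface_vertex S x \<longleftrightarrow> x \<in> S \<and>
     \<not> (\<exists>e r. e \<noteq> 0 \<and> r > 0 \<and>
          (\<forall>y\<in>ball x r. \<forall>t. y + t *\<^sub>R e \<in> ball x r \<longrightarrow> (y \<in> S \<longleftrightarrow> y + t *\<^sub>R e \<in> S)))"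


section \<open>Triangulations and finite elements\<close>

definition regular_triangulation :: "'a::euclidean_space set \<Rightarrow> real \<Rightarrow> 'a set set \<Rightarrow> bool" where
  "regular_triangulation \<Omega> h \<T> \<longleftrightarrow>
     triangulation \<T> \<and> (\<forall>T\<in>\<T>. int DIM('a) simplex T) \<and> \<Union>\<T> = closure \<Omega> \<and>
     Max (diameter ` \<T>) = h \<and>
     (\<forall>x. surface_vertex (frontier \<Omega>) x \<longrightarrow> (\<exists>T\<in>\<T>. x extreme_point_of T))"

text \<open>A family indexed by the mesh sizes \<open>h \<in> H\<close>.\<close>

definition quasi_uniform_family ::
  "'a::euclidean_space set \<Rightarrow> real set \<Rightarrow> (real \<Rightarrow> 'a set set) \<Rightarrow> bool" where
  "quasi_uniform_family \<Omega> H \<T> \<longleftrightarrow> H \<subseteq> {0<..} \<and>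
     (\<forall>h\<in>H. regular_triangulation \<Omega> h (\<T> h)) \<and>
     (\<exists>\<kappa>>0. \<forall>h\<in>H. \<forall>T\<in>\<T> h. \<exists>x. cball x (\<kappa> * h) \<subseteq> T)"

text \<open>Functions on \<open>closure \<Omega>\<close> are extended by zero, so that distinct elements of the space
  are distinct as total functions and the definite descriptions below make sense.\<close>

definition P1 :: "'a::euclidean_space set \<Rightarrow> 'a set set \<Rightarrow> ('a \<Rightarrow> real) set" where
  "P1 \<Omega> \<T> = {v. continuous_on (closure \<Omega>) v \<and>
     (\<forall>T\<in>\<T>. \<exists>a b. \<forall>x\<in>T. v x = a \<bullet> x + b) \<and> (\<forall>x. x \<notin> closure \<Omega> \<longrightarrow> v x = 0)}"

text \<open>Traces of elements of \<open>P1 \<Omega> \<T>\<close> are restrictions, and equality of traces on \<open>\<Gamma>\<close> means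
  equality almost everywhere with respect to the surface measure.\<close>

definition trace_eq :: "'a::euclidean_space set \<Rightarrow> 'a set \<Rightarrow> ('a \<Rightarrow> real) \<Rightarrow> ('a \<Rightarrow> real) \<Rightarrow> bool" where
  "trace_eq \<Omega> \<Gamma> u g \<longleftrightarrow> (AE x in surf \<Omega>. x \<in> \<Gamma> \<longrightarrow> u x = g x)"

definition P1_0 :: "'a::euclidean_space set \<Rightarrow> 'a set set \<Rightarrow> 'a set \<Rightarrow> ('a \<Rightarrow> real) set" where
  "P1_0 \<Omega> \<T> \<Gamma> = {v \<in> P1 \<Omega> \<T>. trace_eq \<Omega> \<Gamma> v (\<lambda>x. 0)}"


section \<open>Lebesgue and Sobolev spaces\<close>

definition L2 :: "'a measure \<Rightarrow> ('a \<Rightarrow> 'b::euclidean_space) set" where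
  "L2 M = {u \<in> borel_measurable M. integrable M (\<lambda>x. (norm (u x))\<^sup>2)}"

definition Linf :: "'a measure \<Rightarrow> ('a \<Rightarrow> real) set" where
  "Linf M = {u \<in> borel_measurable M. \<exists>C. AE x in M. \<bar>u x\<bar> \<le> C}"

definition Linf_norm :: "'a measure \<Rightarrow> ('a \<Rightarrow> real) \<Rightarrow> real" where
  "Linf_norm M u = enn2real (esssup M (\<lambda>x. ennreal \<bar>u x\<bar>))"

definition box_Linf :: "'a measure \<Rightarrow> real \<Rightarrow> real \<Rightarrow> ('a \<Rightarrow> real) set" where
  "box_Linf M l u = {q \<in> Linf M. AE x in M. l \<le> q x \<and> q x \<le> u}"

text \<open>Weak derivatives are tested against compactly supported functions of class \<open>C\<^sup>1\<close>, as in
  Gilbarg and Trudinger; testing against smooth functions only gives the same notion.\<close>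

definition test_functions :: "'a::euclidean_space set \<Rightarrow> ('a \<Rightarrow> real) set" where
  "test_functions \<Omega> = {\<phi>. (\<forall>x. \<phi> differentiable (at x)) \<and>
     (\<forall>b\<in>Basis. continuous_on UNIV (\<lambda>x. frechet_derivative \<phi> (at x) b)) \<and>
     compact (closure {x. \<phi> x \<noteq> 0}) \<and> closure {x. \<phi> x \<noteq> 0} \<subseteq> \<Omega>}"

definition has_weak_gradient ::
  "'a::euclidean_space set \<Rightarrow> ('a \<Rightarrow> real) \<Rightarrow> ('a \<Rightarrow> 'a) \<Rightarrow> bool" where
  "has_weak_gradient \<Omega> u G \<longleftrightarrow>
     (\<forall>K. compact K \<and> K \<subseteq> \<Omega> \<longrightarrow> integrable (lebesgue_on K) u \<and> integrable (lebesgue_on K) G) \<and>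
     (\<forall>\<phi>\<in>test_functions \<Omega>. \<forall>b\<in>Basis.
        (LINT x|lebesgue_on \<Omega>. u x * frechet_derivative \<phi> (at x) b)
          = - (LINT x|lebesgue_on \<Omega>. (G x \<bullet> b) * \<phi> x))"

text \<open>The weak gradient is unique up to null sets, which integrals do not see.\<close>

definition weak_grad :: "'a::euclidean_space set \<Rightarrow> ('a \<Rightarrow> real) \<Rightarrow> 'a \<Rightarrow> 'a" where
  "weak_grad \<Omega> u = (SOME G. has_weak_gradient \<Omega> u G)"

definition H1 :: "'a::euclidean_space set \<Rightarrow> ('a \<Rightarrow> real) set" where
  "H1 \<Omega> = {u \<in> L2 (lebesgue_on \<Omega>). \<exists>G \<in> L2 (lebesgue_on \<Omega>). has_weak_gradient \<Omega> u G}"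

definition H1_norm :: "'a::euclidean_space set \<Rightarrow> ('a \<Rightarrow> real) \<Rightarrow> real" where
  "H1_norm \<Omega> u = sqrt ((LINT x|lebesgue_on \<Omega>. (u x)\<^sup>2) +
                       (LINT x|lebesgue_on \<Omega>. (norm (weak_grad \<Omega> u x))\<^sup>2))"

text \<open>In the Gagliardo seminorm the exponent \<open>d = (d - 1) + 2 \<cdot> 1/2\<close> belongs to the
  \<open>(d - 1)\<close>-dimensional set \<open>S\<close>.\<close>

definition H12_energy :: "'a::euclidean_space set \<Rightarrow> 'a set \<Rightarrow> ('a \<Rightarrow> real) \<Rightarrow> ennreal" where
  "H12_energy \<Omega> S g =
     (\<integral>\<^sup>+x. ennreal ((g x)\<^sup>2) \<partial>restrict_space (surf \<Omega>) S) +
     (\<integral>\<^sup>+x. (\<integral>\<^sup>+y. ennreal ((g x - g y)\<^sup>2 / norm (x - y) ^ DIM('a)) \<partial>restrict_space (surf \<Omega>) S)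
        \<partial>restrict_space (surf \<Omega>) S)"

definition H12 :: "'a::euclidean_space set \<Rightarrow> 'a set \<Rightarrow> ('a \<Rightarrow> real) set" where
  "H12 \<Omega> S = {g \<in> L2 (restrict_space (surf \<Omega>) S). H12_energy \<Omega> S g < \<infinity>}"

definition H12_norm :: "'a::euclidean_space set \<Rightarrow> 'a set \<Rightarrow> ('a \<Rightarrow> real) \<Rightarrow> real" where
  "H12_norm \<Omega> S g = sqrt (enn2real (H12_energy \<Omega> S g))"

text \<open>Bounded linear functionals on a space \<open>V\<close> of functions with (semi)norm \<open>nrm\<close>.
  Boundedness makes them insensitive to changes on null sets; the duality pairing
  \<open>\<langle>F, u\<rangle>\<close> is the application \<open>F u\<close>.\<close>

definition dual :: "('a \<Rightarrow> real) set \<Rightarrow> (('a \<Rightarrow> real) \<Rightarrow> real) \<Rightarrow> (('a \<Rightarrow> real) \<Rightarrow> real) set" where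
  "dual V nrm = {F.
     (\<forall>u\<in>V. \<forall>v\<in>V. F (\<lambda>x. u x + v x) = F u + F v) \<and>
     (\<forall>c. \<forall>u\<in>V. F (\<lambda>x. c * u x) = c * F u) \<and>
     (\<exists>C. \<forall>u\<in>V. \<bar>F u\<bar> \<le> C * nrm u)}"

definition H_minus1 :: "'a::euclidean_space set \<Rightarrow> (('a \<Rightarrow> real) \<Rightarrow> real) set" where
  "H_minus1 \<Omega> = dual (H1 \<Omega>) (H1_norm \<Omega>)"

definition H_minus12 :: "'a::euclidean_space set \<Rightarrow> 'a set \<Rightarrow> (('a \<Rightarrow> real) \<Rightarrow> real) set" where
  "H_minus12 \<Omega> S = dual (H12 \<Omega> S) (H12_norm \<Omega> S)"


section \<open>The discrete Neumann and mixed problems and the cost functional\<close>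

definition bform :: "'a::euclidean_space set \<Rightarrow> ('a \<Rightarrow> real) \<Rightarrow> ('a \<Rightarrow> real) \<Rightarrow> ('a \<Rightarrow> real) \<Rightarrow>
    ('a \<Rightarrow> real) \<Rightarrow> ('a \<Rightarrow> real) \<Rightarrow> real" where
  "bform \<Omega> \<sigma> q a u \<phi> =
     (LINT x|lebesgue_on \<Omega>. q x * (weak_grad \<Omega> u x \<bullet> weak_grad \<Omega> \<phi> x)) +
     (LINT x|lebesgue_on \<Omega>. a x * u x * \<phi> x) +
     (LINT x|surf \<Omega>. \<sigma> x * u x * \<phi> x)"

definition N_h :: "'a::euclidean_space set \<Rightarrow> 'a set set \<Rightarrow> ('a \<Rightarrow> real) \<Rightarrow>
    (('a \<Rightarrow> real) \<Rightarrow> real) \<Rightarrow> (('a \<Rightarrow> real) \<Rightarrow> real) \<Rightarrow> (('a \<Rightarrow> real) \<Rightarrow> real) \<Rightarrow>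
    ('a \<Rightarrow> real) \<Rightarrow> ('a \<Rightarrow> real) \<Rightarrow> 'a \<Rightarrow> real" where
  "N_h \<Omega> \<T> \<sigma> f j0 j\<delta> q a =
     (THE u. u \<in> P1 \<Omega> \<T> \<and> (\<forall>\<phi>\<in>P1 \<Omega> \<T>. bform \<Omega> \<sigma> q a u \<phi> = f \<phi> + j\<delta> \<phi> + j0 \<phi>))"

definition M_h :: "'a::euclidean_space set \<Rightarrow> 'a set set \<Rightarrow> 'a set \<Rightarrow> ('a \<Rightarrow> real) \<Rightarrow>
    (('a \<Rightarrow> real) \<Rightarrow> real) \<Rightarrow> (('a \<Rightarrow> real) \<Rightarrow> real) \<Rightarrow> ('a \<Rightarrow> real) \<Rightarrow>
    ('a \<Rightarrow> real) \<Rightarrow> ('a \<Rightarrow> real) \<Rightarrow> 'a \<Rightarrow> real" where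
  "M_h \<Omega> \<T> \<Gamma> \<sigma> f j0 g\<delta> q a =
     (THE u. u \<in> P1 \<Omega> \<T> \<and> trace_eq \<Omega> \<Gamma> u g\<delta> \<and>
        (\<forall>\<phi>\<in>P1_0 \<Omega> \<T> \<Gamma>. bform \<Omega> \<sigma> q a u \<phi> = f \<phi> + j0 \<phi>))"

definition J_h :: "'a::euclidean_space set \<Rightarrow> 'a set set \<Rightarrow> 'a set \<Rightarrow> ('a \<Rightarrow> real) \<Rightarrow>
    (('a \<Rightarrow> real) \<Rightarrow> real) \<Rightarrow> (('a \<Rightarrow> real) \<Rightarrow> real) \<Rightarrow> (('a \<Rightarrow> real) \<Rightarrow> real) \<Rightarrow> ('a \<Rightarrow> real) \<Rightarrow>
    ('a \<Rightarrow> real) \<Rightarrow> ('a \<Rightarrow> real) \<Rightarrow> real" where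
  "J_h \<Omega> \<T> \<Gamma> \<sigma> f j0 j\<delta> g\<delta> q a =
     (let w = (\<lambda>x. N_h \<Omega> \<T> \<sigma> f j0 j\<delta> q a x - M_h \<Omega> \<T> \<Gamma> \<sigma> f j0 g\<delta> q a x) in
        (LINT x|lebesgue_on \<Omega>. q x * (norm (weak_grad \<Omega> w x))\<^sup>2) +
        (LINT x|lebesgue_on \<Omega>. a x * (w x)\<^sup>2) +
        (LINT x|surf \<Omega>. \<sigma> x * (w x)\<^sup>2))"

text \<open>Frechet differentiability of a functional on \<open>L\<^sup>\<infinity> \<times> L\<^sup>\<infinity>\<close>.  Only arguments near \<open>(q, a)\<close>
  matter.  The library's \<open>has_derivative\<close> does not apply, because \<open>L\<^sup>\<infinity>\<close> is not a type here.\<close>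

definition has_frechet_differential :: "'a measure \<Rightarrow> (('a \<Rightarrow> real) \<Rightarrow> ('a \<Rightarrow> real) \<Rightarrow> real) \<Rightarrow>
    (('a \<Rightarrow> real) \<Rightarrow> ('a \<Rightarrow> real) \<Rightarrow> real) \<Rightarrow> ('a \<Rightarrow> real) \<Rightarrow> ('a \<Rightarrow> real) \<Rightarrow> bool" where
  "has_frechet_differential M J D q a \<longleftrightarrow>
     (\<forall>u\<in>Linf M. \<forall>v\<in>Linf M. \<forall>u'\<in>Linf M. \<forall>v'\<in>Linf M.
        D (\<lambda>x. u x + u' x) (\<lambda>x. v x + v' x) = D u v + D u' v') \<and>
     (\<forall>c. \<forall>u\<in>Linf M. \<forall>v\<in>Linf M. D (\<lambda>x. c * u x) (\<lambda>x. c * v x) = c * D u v) \<and>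
     (\<exists>C. \<forall>u\<in>Linf M. \<forall>v\<in>Linf M. \<bar>D u v\<bar> \<le> C * (Linf_norm M u + Linf_norm M v)) \<and>
     (\<forall>\<epsilon>>0. \<exists>r>0. \<forall>u\<in>Linf M. \<forall>v\<in>Linf M. Linf_norm M u + Linf_norm M v < r \<longrightarrow>
        \<bar>J (\<lambda>x. q x + u x) (\<lambda>x. a x + v x) - J q a - D u v\<bar>
          \<le> \<epsilon> * (Linf_norm M u + Linf_norm M v))"

end

theory Submission
  imports Defs
begin

text \<open>All discrete problems are uniquely solvable, since the forms are coercive on the
  finite-dimensional space \<open>P1\<close>. If \<open>B\<close>, \<open>B + \<beta>\<close> are the forms of two pairs of coefficients,
  \<open>l\<close> is the Neumann load, \<open>F\<close> the mixed load, and \<open>(N, M)\<close>, \<open>(N', M')\<close> are the solutions, then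
  \<open>J = l(N) + (B(M, M) - 2 F(M)) - 2 j\<delta>(M)\<close>, where the last term depends on the trace \<open>g\<delta>\<close> only, and
  symmetry gives the exact increments \<open>-\<beta>(N', N)\<close> and \<open>\<beta>(M', M)\<close> of the first two terms. Replacing
  \<open>N'\<close>, \<open>M'\<close> by \<open>N\<close>, \<open>M\<close> costs an error quadratic in \<open>\<beta>\<close> by coercivity.

  The loads act linearly on \<open>P1\<close> only because \<open>P1\<close> lies in \<open>H1\<close> and has traces in \<open>H12\<close>. The first
  needs that weak gradients exist and are unique almost everywhere; the second needs that elements of
  \<open>P1\<close> are Lipschitz on the boundary and that the surface measure of a ball of radius \<open>\<rho>\<close> is
  \<open>O(\<rho>^(d - 1))\<close>.\<close>

section \<open>Uniqueness of weak gradients\<close>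

text \<open>\<open>weak_grad\<close> is an arbitrary choice (\<open>SOME\<close>), so even its
  linearity is a theorem and holds only almost everywhere; whatever is needed about it is
  transferred from the explicit cellwise gradient \<open>P1_grad\<close>. Integration by parts for
  \<open>P1_grad\<close> comes from difference quotients and translation invariance, which avoids
  boundary terms on simplices and their cancellation across faces. The exponent d - 1 is what puts
  traces into \<open>H12\<close>: for Lipschitz u the Gagliardo integrand is O(|x - y|^(2 - d)), and
  a dyadic shell of radius \<rho> contributes \<rho>^(2 - d) * \<rho>^(d - 1) = \<rho>, a term of a
  geometric series. Only upper bounds for the surface measure enter. The term j\<delta>(M) is
  constant in (q, a) because \<open>j\<delta>\<close> is bounded by a seminorm that vanishes on
  functions with zero trace on \<Gamma>. No derivative of the solution maps is computed.\<close>

definition C1_fun :: "('a::euclidean_space \<Rightarrow> real) \<Rightarrow> bool" where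
  "C1_fun \<phi> \<longleftrightarrow> (\<forall>x. \<phi> differentiable (at x)) \<and>
     (\<forall>b\<in>Basis. continuous_on UNIV (\<lambda>x. frechet_derivative \<phi> (at x) b))"

lemma C1_funI:
  assumes "\<And>x. (\<phi> has_derivative \<phi>' x) (at x)" and "\<And>b. b \<in> Basis \<Longrightarrow> continuous_on UNIV (\<lambda>x. \<phi>' x b)"
  shows "C1_fun \<phi>"
proof -
  have "frechet_derivative \<phi> (at x) = \<phi>' x" for x
    using frechet_derivative_at[OF assms(1)] by simp
  then show ?thesis
    using assms by (auto simp: C1_fun_def differentiable_def)
qed

lemma C1_fun_has_derivative:
  "C1_fun \<phi> \<Longrightarrow> (\<phi> has_derivative frechet_derivative \<phi> (at x)) (at x)"
  by (simp add: C1_fun_def frechet_derivative_works[symmetric])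

lemma C1_fun_continuous: "C1_fun \<phi> \<Longrightarrow> continuous_on S \<phi>"
  by (meson C1_fun_has_derivative continuous_at_imp_continuous_on has_derivative_continuous)

lemma C1_fun_mult:
  assumes "C1_fun \<phi>" "C1_fun \<psi>"
  shows "C1_fun (\<lambda>x. \<phi> x * \<psi> x)"
proof (rule C1_funI)
  show "((\<lambda>x. \<phi> x * \<psi> x) has_derivative
      (\<lambda>h. \<phi> x * frechet_derivative \<psi> (at x) h + frechet_derivative \<phi> (at x) h * \<psi> x)) (at x)" for x
    using assms by (intro has_derivative_mult C1_fun_has_derivative)
next
  fix b :: 'a assume "b \<in> Basis"
  then show "continuous_on UNIV (\<lambda>x. \<phi> x * frechet_derivative \<psi> (at x) b + frechet_derivative \<phi> (at x) b * \<psi> x)"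
    using assms C1_fun_continuous by (intro continuous_intros) (auto simp: C1_fun_def)
qed

lemma C1_fun_const: "C1_fun (\<lambda>x. c)"
  by (rule C1_funI[where \<phi>' = "\<lambda>x h. 0"]) auto

lemma C1_fun_prod:
  "finite I \<Longrightarrow> (\<And>i. i \<in> I \<Longrightarrow> C1_fun (\<phi> i)) \<Longrightarrow> C1_fun (\<lambda>x. \<Prod>i\<in>I. \<phi> i x)"
  by (induction I rule: finite_induct) (auto simp: C1_fun_const intro: C1_fun_mult)

lemma C1_fun_compose:
  assumes p: "C1_fun p"
    and g: "\<And>x. (g has_real_derivative g' (p x)) (at (p x))" "continuous_on (range p) g'"
  shows "C1_fun (\<lambda>x. g (p x))"
proof (rule C1_funI)
  show "((\<lambda>x. g (p x)) has_derivative (\<lambda>h. frechet_derivative p (at x) h * g' (p x))) (at x)" for x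
    using has_derivative_compose[OF C1_fun_has_derivative[OF p, of x], of g "\<lambda>h. g' (p x) * h"] g(1)[of x]
    by (simp add: has_field_derivative_def mult.commute[of _ "g' (p x)"])
next
  fix b :: 'a assume "b \<in> Basis"
  moreover have "continuous_on UNIV (\<lambda>x. g' (p x))"
    using continuous_on_compose2[OF g(2) C1_fun_continuous[OF p]] by auto
  ultimately show "continuous_on UNIV (\<lambda>x. frechet_derivative p (at x) b * g' (p x))"
    using p by (intro continuous_intros) (auto simp: C1_fun_def)
qed

text \<open>Squaring the positive part removes its kink: at 0 the difference quotient is 0 or h.
  This supplies C1 functions that are positive exactly on an open half-space.\<close>

lemma DERIV_max_square: "((\<lambda>t. (max 0 t)\<^sup>2) has_real_derivative 2 * max 0 t) (at (t::real))"
proof -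
  consider "t > 0" | "t < 0" | "t = 0" by linarith
  then show ?thesis
  proof cases
    case 1
    have "((\<lambda>t. t\<^sup>2) has_real_derivative 2 * max 0 t) (at t)"
      using 1 by (auto intro!: derivative_eq_intros)
    then show ?thesis
      by (rule has_field_derivative_transform_within_open[where S = "{0<..}"]) (use 1 in auto)
  next
    case 2
    have "((\<lambda>t. 0) has_real_derivative 2 * max 0 t) (at t)"
      using 2 by auto
    then show ?thesis
      by (rule has_field_derivative_transform_within_open[where S = "{..<0}"]) (use 2 in auto)
  next
    case 3
    have "((\<lambda>h. (max 0 h)\<^sup>2 / h) \<longlongrightarrow> 0) (at (0::real))"
    proof (rule Lim_null_comparison)
      show "\<forall>\<^sub>F h in at (0::real). norm ((max 0 h)\<^sup>2 / h) \<le> \<bar>h\<bar>"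
        by (rule always_eventually) (auto simp: power2_eq_square max_def)
      show "((\<lambda>h. \<bar>h\<bar>) \<longlongrightarrow> 0) (at (0::real))"
        by (auto intro!: tendsto_eq_intros)
    qed
    then show ?thesis
      using 3 by (simp add: DERIV_def)
  qed
qed

lemma C1_fun_max_square_affine: "C1_fun (\<lambda>x. (max 0 (c * (x \<bullet> b) + d))\<^sup>2)"
proof (rule C1_fun_compose[where g = "\<lambda>t. (max 0 t)\<^sup>2" and g' = "\<lambda>t. 2 * max 0 t"])
  show "C1_fun (\<lambda>x. c * (x \<bullet> b) + d)"
    by (rule C1_funI[where \<phi>' = "\<lambda>x h. c * (h \<bullet> b)"]) (auto intro!: derivative_eq_intros)
qed (auto intro: DERIV_max_square intro!: continuous_intros)

text \<open>A C1 function \<open>p\<close> that is positive exactly on the open box takes the place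
  of a mollifier: \<open>1 - 1 / (1 + n p)\<close> is 0 where \<open>p\<close> is, and tends to 1
  elsewhere.\<close>

lemma box_approximation:
  fixes l u :: "'a::euclidean_space"
  obtains \<psi> :: "nat \<Rightarrow> 'a \<Rightarrow> real"
  where "\<And>n. C1_fun (\<psi> n)" "\<And>n x. 0 \<le> \<psi> n x \<and> \<psi> n x \<le> 1" "\<And>n x. x \<notin> box l u \<Longrightarrow> \<psi> n x = 0"
    "\<And>x. (\<lambda>n. \<psi> n x) \<longlonglongrightarrow> indicator (box l u) x"
proof
  \<comment> \<open>One factor for each face of the box; \<open>1 *\<close> and \<open>- 1 *\<close>
    match the affine shape in \<open>C1_fun_max_square_affine\<close>.\<close>
  define p :: "'a \<Rightarrow> real" where
    "p = (\<lambda>x. \<Prod>i\<in>Basis. (max 0 (1 * (x \<bullet> i) + - (l \<bullet> i)))\<^sup>2 * (max 0 (- 1 * (x \<bullet> i) + u \<bullet> i))\<^sup>2)"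
  have p: "C1_fun p"
    unfolding p_def by (intro C1_fun_prod C1_fun_mult C1_fun_max_square_affine) auto
  have p0: "p x \<ge> 0" for x
    unfolding p_def by (intro prod_nonneg) auto
  have p_box: "p x \<noteq> 0 \<longleftrightarrow> x \<in> box l u" for x
    by (auto simp: p_def mem_box max_def)
  define \<psi> :: "nat \<Rightarrow> 'a \<Rightarrow> real" where "\<psi> = (\<lambda>n x. 1 - 1 / (1 + real n * p x))"
  have pos: "1 + real n * p x > 0" for n x
    using p0[of x] by (simp add: add_pos_nonneg)
  show "C1_fun (\<psi> n)" for n
    unfolding \<psi>_def
  proof (rule C1_fun_compose[OF p, where g' = "\<lambda>t. real n / (1 + real n * t)\<^sup>2"])
    show "((\<lambda>t. 1 - 1 / (1 + real n * t)) has_real_derivative real n / (1 + real n * p x)\<^sup>2) (at (p x))" for x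
      using pos[of n x] by (auto intro!: derivative_eq_intros simp: power2_eq_square)
    show "continuous_on (range p) (\<lambda>t. real n / (1 + real n * t)\<^sup>2)"
      using pos[of n] by (intro continuous_intros) (auto simp: less_imp_neq[symmetric])
  qed
  show "0 \<le> \<psi> n x \<and> \<psi> n x \<le> 1" for n x
    using pos[of n x] p0[of x] by (auto simp: \<psi>_def)
  show "\<psi> n x = 0" if "x \<notin> box l u" for n x
    using that p_box[of x] by (auto simp: \<psi>_def)
  show "(\<lambda>n. \<psi> n x) \<longlonglongrightarrow> indicator (box l u) x" for x
  proof (cases "x \<in> box l u")
    case True
    then have "p x > 0" using p0[of x] p_box[of x] by auto
    then have "filterlim (\<lambda>n. 1 + p x * real n) at_top sequentially"
      by (intro filterlim_tendsto_add_at_top[OF tendsto_const] filterlim_tendsto_pos_mult_at_top[OF tendsto_const])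
        (auto simp: filterlim_real_sequentially)
    then have "(\<lambda>n. 1 / (1 + p x * real n)) \<longlonglongrightarrow> 0"
      by (intro tendsto_divide_0[OF tendsto_const]) (auto intro: filterlim_at_top_imp_at_infinity)
    from tendsto_diff[OF tendsto_const[of 1] this] show ?thesis
      using True by (simp add: \<psi>_def mult.commute)
  qed (use p_box[of x] in \<open>auto simp: \<psi>_def\<close>)
qed

section \<open>The fundamental lemma of the calculus of variations\<close>

lemma borel_measurable_lebesgue_continuous:
  fixes f :: "'a::euclidean_space \<Rightarrow> real"
  assumes "continuous_on UNIV f"
  shows "f \<in> borel_measurable lebesgue"
  using borel_measurable_continuous_onI[OF assms] by (intro measurable_completion) simp

text \<open>\<open>g\<close> is only known to be integrable on \<open>K\<close>; cutting it off
  outside \<open>K\<close> does not change the product, and \<phi> is bounded on the compact set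
  \<open>K\<close>.\<close>

lemma integrable_mult_support:
  fixes g :: "'a::euclidean_space \<Rightarrow> real"
  assumes g: "integrable (lebesgue_on K) g" and K: "compact K" "K \<subseteq> \<Omega>" and \<Omega>: "\<Omega> \<in> sets lebesgue"
    and \<phi>: "continuous_on UNIV \<phi>" "\<And>x. x \<notin> K \<Longrightarrow> \<phi> x = 0"
  shows "integrable (lebesgue_on \<Omega>) (\<lambda>x. g x * \<phi> x)"
proof -
  have Ks: "K \<in> sets lebesgue" using K by (simp add: lmeasurable_compact fmeasurableD)
  have "bounded (\<phi> ` K)"
    using continuous_on_subset[OF \<phi>(1)] K(1) by (intro compact_imp_bounded compact_continuous_image) auto
  then obtain C where C: "\<And>x. x \<in> K \<Longrightarrow> norm (\<phi> x) \<le> C" unfolding bounded_iff by auto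
  have "integrable lebesgue (\<lambda>x. indicator K x *\<^sub>R g x)"
    using g integrable_restrict_space[of K lebesgue g] Ks by auto
  then have "integrable lebesgue (\<lambda>x. C * (indicator K x *\<^sub>R g x))"
    by simp
  moreover have "(\<lambda>x. (indicator K x *\<^sub>R g x) * \<phi> x) \<in> borel_measurable lebesgue"
    by (intro borel_measurable_times borel_measurable_lebesgue_continuous \<phi> borel_measurable_integrable)
      (rule \<open>integrable lebesgue (\<lambda>x. indicator K x *\<^sub>R g x)\<close>)
  moreover have "norm ((indicator K x *\<^sub>R g x) * \<phi> x) \<le> norm (C * (indicator K x *\<^sub>R g x))" for x
  proof (cases "x \<in> K")
    case True
    then have "\<bar>\<phi> x\<bar> \<le> \<bar>C\<bar>" using C[of x] by simp
    then have "\<bar>\<phi> x\<bar> * \<bar>g x\<bar> \<le> \<bar>C\<bar> * \<bar>g x\<bar>" by (intro mult_right_mono) auto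
    then show ?thesis using True by (simp add: abs_mult mult.commute)
  qed simp
  ultimately have "integrable lebesgue (\<lambda>x. (indicator K x *\<^sub>R g x) * \<phi> x)"
    by (rule Bochner_Integration.integrable_bound[OF _ _ AE_I2])
  also have "(\<lambda>x. (indicator K x *\<^sub>R g x) * \<phi> x) = (\<lambda>x. indicator \<Omega> x *\<^sub>R (g x * \<phi> x))"
    using \<phi>(2) K(2) by (auto simp: fun_eq_iff indicator_def)
  finally show ?thesis
    using \<Omega> by (simp add: integrable_restrict_space)
qed

text \<open>The indicator of a box is no test function, but it is a bounded limit of the functions
  from \<open>box_approximation\<close>, whose supports stay in the closed box; dominated
  convergence passes the hypothesis to the limit.\<close>

lemma fundamental_lemma_box:
  fixes g :: "'a::euclidean_space \<Rightarrow> real"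
  assumes \<Omega>: "open \<Omega>" and g: "\<And>K. compact K \<Longrightarrow> K \<subseteq> \<Omega> \<Longrightarrow> integrable (lebesgue_on K) g"
    and zero: "\<And>\<phi>. \<phi> \<in> test_functions \<Omega> \<Longrightarrow> (LINT x|lebesgue_on \<Omega>. g x * \<phi> x) = 0"
    and sub: "cbox l u \<subseteq> \<Omega>"
  shows "integral (cbox l u) g = 0"
proof -
  obtain \<psi> where \<psi>: "\<And>n. C1_fun (\<psi> n)" "\<And>n x. 0 \<le> \<psi> n x \<and> \<psi> n x \<le> 1"
    "\<And>n x. x \<notin> box l u \<Longrightarrow> \<psi> n x = 0" "\<And>x. (\<lambda>n. \<psi> n x) \<longlonglongrightarrow> indicator (box l u) x"
    using box_approximation[of l u] by blast
  let ?h = "\<lambda>x. indicator (cbox l u) x *\<^sub>R g x"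
  have int: "integrable (lebesgue_on (cbox l u)) g" using g sub by auto
  then have h: "integrable lebesgue ?h"
    using integrable_restrict_space[of "cbox l u" lebesgue g] by auto
  then have hm: "?h \<in> borel_measurable lebesgue" by (rule borel_measurable_integrable)
  have "(indicator (box l u) :: 'a \<Rightarrow> real) \<in> borel_measurable lebesgue"
    by (intro borel_measurable_indicator) auto
  with hm have bh: "(\<lambda>x. indicator (box l u) x * ?h x) \<in> borel_measurable lebesgue"
    by (intro borel_measurable_times)
  have \<psi>_meas: "\<psi> n \<in> borel_measurable lebesgue" for n
    by (rule borel_measurable_lebesgue_continuous[OF C1_fun_continuous[OF \<psi>(1)]])
  have test: "\<psi> n \<in> test_functions \<Omega>" for n
  proof -
    have "closure {x. \<psi> n x \<noteq> 0} \<subseteq> cbox l u"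
      using \<psi>(3)[of _ n] box_subset_cbox[of l u] by (intro closure_minimal) auto
    then show ?thesis
      using \<psi>(1)[of n] sub unfolding test_functions_def C1_fun_def
      by (auto simp: compact_closure intro!: bounded_subset[OF bounded_cbox order.trans[OF closure_subset]])
  qed
  have eq: "(LINT x|lebesgue. \<psi> n x * ?h x) = 0" for n
  proof -
    have "(LINT x|lebesgue_on \<Omega>. g x * \<psi> n x) = (LINT x|lebesgue. indicator \<Omega> x *\<^sub>R (g x * \<psi> n x))"
      using \<Omega> by (intro integral_restrict_space) auto
    also have "\<dots> = (LINT x|lebesgue. \<psi> n x * ?h x)"
      using \<psi>(3)[of _ n] sub box_subset_cbox[of l u]
      by (intro Bochner_Integration.integral_cong) (auto simp: indicator_def)
    finally show ?thesis using zero[OF test] by simp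
  qed
  have "(\<lambda>n. LINT x|lebesgue. \<psi> n x * ?h x) \<longlonglongrightarrow> (LINT x|lebesgue. indicator (box l u) x * ?h x)"
  proof (rule integral_dominated_convergence[where w = "\<lambda>x. norm (?h x)"])
    show "(\<lambda>x. indicator (box l u) x * ?h x) \<in> borel_measurable lebesgue"
      by (rule bh)
    show "(\<lambda>x. \<psi> n x * ?h x) \<in> borel_measurable lebesgue" for n
      by (intro borel_measurable_times \<psi>_meas hm)
    show "integrable lebesgue (\<lambda>x. norm (?h x))" using h by (rule integrable_norm)
    show "AE x in lebesgue. (\<lambda>n. \<psi> n x * ?h x) \<longlonglongrightarrow> indicator (box l u) x * ?h x"
      by (intro AE_I2 tendsto_mult tendsto_const \<psi>(4))
    show "AE x in lebesgue. norm (\<psi> n x * ?h x) \<le> norm (?h x)" for n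
      
    proof (intro AE_I2)
      fix x
      have "\<bar>\<psi> n x\<bar> * \<bar>?h x\<bar> \<le> 1 * \<bar>?h x\<bar>"
        using \<psi>(2)[of n x] by (intro mult_right_mono) auto
      then show "norm (\<psi> n x * ?h x) \<le> norm (?h x)" by (simp only: real_norm_def abs_mult mult_1)
    qed
  qed
  then have "(LINT x|lebesgue. indicator (box l u) x * ?h x) = 0"
    unfolding eq by (rule LIMSEQ_unique[OF _ tendsto_const])
  \<comment> \<open>The limit sees only the open box; the faces are null.\<close>
  moreover have "AE x in lebesgue. x \<notin> cbox l u - box l u"
    using negligible_frontier_interval[of l u] unfolding negligible_iff_null_sets by (rule AE_not_in)
  then have "(LINT x|lebesgue. indicator (box l u) x * ?h x) = (LINT x|lebesgue. ?h x)"
  proof (intro integral_cong_AE bh hm, elim eventually_mono)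
    show "indicator (box l u) x * ?h x = ?h x" if "x \<notin> cbox l u - box l u" for x
      using that by (cases "x \<in> box l u") auto
  qed
  ultimately have "(LINT x|lebesgue_on (cbox l u). g x) = 0"
    using integral_restrict_space[of "cbox l u" lebesgue g] by simp
  then show ?thesis
    using lebesgue_integral_eq_integral[OF int] by simp
qed

text \<open>Averages over cubes shrinking to their lower corner recover \<open>g\<close> almost
  everywhere (Lebesgue differentiation), and all of them vanish by
  \<open>fundamental_lemma_box\<close>. Countably many closed boxes exhaust the open set.\<close>

lemma fundamental_lemma:
  fixes g :: "'a::euclidean_space \<Rightarrow> real"
  assumes \<Omega>: "open \<Omega>" and g: "\<And>K. compact K \<Longrightarrow> K \<subseteq> \<Omega> \<Longrightarrow> integrable (lebesgue_on K) g"
    and zero: "\<And>\<phi>. \<phi> \<in> test_functions \<Omega> \<Longrightarrow> (LINT x|lebesgue_on \<Omega>. g x * \<phi> x) = 0"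
  shows "AE x in lebesgue_on \<Omega>. g x = 0"
proof -
  have neg: "negligible {x \<in> box l u. g x \<noteq> 0}" if sub: "cbox l u \<subseteq> \<Omega>" for l u
  proof -
    \<comment> \<open>The differentiation theorem wants integrability on every box of the whole
      space, hence the extension by zero.\<close>
    let ?h = "\<lambda>x. if x \<in> cbox l u then g x else 0"
    have "integrable (lebesgue_on (cbox l u)) g" using g sub by auto
    then have "g integrable_on cbox l u" by (simp add: integrable_on_lebesgue_on)
    then have "?h integrable_on UNIV" by (simp add: integrable_restrict_UNIV)
    then have "?h integrable_on cbox a b" for a b
      by (rule integrable_on_subcbox) auto
    from integrable_ccontinuous_explicit[OF this] obtain N where N: "negligible N"
      "\<And>x e. \<lbrakk>x \<notin> N; 0 < e\<rbrakk> \<Longrightarrow> \<exists>d>0. \<forall>h. 0 < h \<and> h < d \<longrightarrow>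
         norm (integral (cbox x (x + h *\<^sub>R One)) ?h /\<^sub>R h ^ DIM('a) - ?h x) < e" by blast
    have "g x = 0" if x: "x \<in> box l u" "x \<notin> N" for x
    proof (rule ccontr)
      assume "g x \<noteq> 0"
      have "?h x = g x" using x box_subset_cbox by auto
      obtain d where d: "d > 0" "\<And>h. 0 < h \<Longrightarrow> h < d \<Longrightarrow>
         norm (integral (cbox x (x + h *\<^sub>R One)) ?h /\<^sub>R h ^ DIM('a) - ?h x) < \<bar>g x\<bar>"
        using N(2)[OF x(2), of "\<bar>g x\<bar>"] \<open>g x \<noteq> 0\<close> by auto
      have "((\<lambda>h. x + h *\<^sub>R One) \<longlongrightarrow> x + 0 *\<^sub>R One) (at_right 0)"
        by (intro tendsto_intros)
      then have "\<forall>\<^sub>F h in at_right 0. x + h *\<^sub>R One \<in> box l u"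
        using x by (intro topological_tendstoD[of _ _ _ "box l u"]) auto
      then obtain e where e: "e > 0" "\<And>h. 0 < h \<Longrightarrow> h < e \<Longrightarrow> x + h *\<^sub>R One \<in> box l u"
        by (auto simp: eventually_at_right_field)
      define h where "h = min d e / 2"
      have h: "0 < h" "h < d" "h < e" using d e by (auto simp: h_def)
      have inn: "cbox x (x + h *\<^sub>R One) \<subseteq> cbox l u"
        using x e(2)[OF h(1,3)] box_subset_cbox[of l u]
        by (intro subset_box_imp) (auto simp: mem_box intro: less_imp_le)
      have "integral (cbox x (x + h *\<^sub>R One)) ?h = integral (cbox x (x + h *\<^sub>R One)) g"
        using inn by (intro Henstock_Kurzweil_Integration.integral_cong) auto
      also have "\<dots> = 0"
        using inn sub by (intro fundamental_lemma_box[OF \<Omega> g zero]) auto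
      finally show False using d(2)[OF h(1,2)] \<open>?h x = g x\<close> by simp
    qed
    then show ?thesis by (intro negligible_subset[OF N(1)]) auto
  qed
  obtain \<D> where \<D>: "countable \<D>" "\<D> \<subseteq> Pow \<Omega>" "\<And>X. X \<in> \<D> \<Longrightarrow> \<exists>a b. X = cbox a b" "\<Union>\<D> = \<Omega>"
    by (rule open_countable_Union_open_cbox[OF \<Omega>]) blast
  have "negligible {x \<in> X. g x \<noteq> 0}" if XD: "X \<in> \<D>" for X
  proof -
    from \<D>(3)[OF XD] obtain a b where X: "X = cbox a b" by blast
    then have sub: "cbox a b \<subseteq> \<Omega>" using \<D>(2) XD by auto
    have "negligible ({x \<in> box a b. g x \<noteq> 0} \<union> (cbox a b - box a b))"
      by (intro negligible_Un neg[OF sub] negligible_frontier_interval)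
    then show ?thesis by (rule negligible_subset) (auto simp: X)
  qed
  then have "negligible (\<Union>X\<in>\<D>. {x \<in> X. g x \<noteq> 0})"
    using \<D>(1) by (intro negligible_countable_Union) auto
  moreover have "(\<Union>X\<in>\<D>. {x \<in> X. g x \<noteq> 0}) = {x \<in> \<Omega>. g x \<noteq> 0}" using \<D>(4) by auto
  ultimately have "negligible {x \<in> \<Omega>. g x \<noteq> 0}" by simp
  then have "AE x in lebesgue. x \<notin> {x \<in> \<Omega>. g x \<noteq> 0}"
    unfolding negligible_iff_null_sets by (rule AE_not_in)
  then show ?thesis
    using \<Omega> by (auto simp: AE_restrict_space_iff elim!: eventually_mono)
qed

lemma test_functions_C1_fun: "\<phi> \<in> test_functions \<Omega> \<Longrightarrow> C1_fun \<phi>"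
  by (auto simp: test_functions_def C1_fun_def)

text \<open>Each component of the difference annihilates all test functions. This gives access to
  \<open>weak_grad\<close>, which is fixed by choice only: it agrees almost everywhere with any
  explicit weak gradient.\<close>

lemma has_weak_gradient_unique:
  fixes \<Omega> :: "'a::euclidean_space set"
  assumes \<Omega>: "open \<Omega>" and G: "has_weak_gradient \<Omega> u G" and G': "has_weak_gradient \<Omega> u G'"
  shows "AE x in lebesgue_on \<Omega>. G x = G' x"
proof -
  have "AE x in lebesgue_on \<Omega>. (G x - G' x) \<bullet> b = 0" if b: "b \<in> Basis" for b
  proof (rule fundamental_lemma[OF \<Omega>])
    fix K assume "compact K" "K \<subseteq> \<Omega>"
    then have "integrable (lebesgue_on K) G" "integrable (lebesgue_on K) G'"
      using G G' by (auto simp: has_weak_gradient_def)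
    then show "integrable (lebesgue_on K) (\<lambda>x. (G x - G' x) \<bullet> b)" by auto
  next
    fix \<phi> assume \<phi>: "\<phi> \<in> test_functions \<Omega>"
    define K where "K = closure {x. \<phi> x \<noteq> 0}"
    have K: "compact K" "K \<subseteq> \<Omega>" "\<And>x. x \<notin> K \<Longrightarrow> \<phi> x = 0"
      using \<phi> closure_subset[of "{x. \<phi> x \<noteq> 0}"] by (auto simp: test_functions_def K_def)
    have int: "integrable (lebesgue_on \<Omega>) (\<lambda>x. (F x \<bullet> b) * \<phi> x)" if "has_weak_gradient \<Omega> u F" for F
    proof (rule integrable_mult_support[OF _ K(1,2)])
      have "integrable (lebesgue_on K) F" using that K by (auto simp: has_weak_gradient_def)
      then show "integrable (lebesgue_on K) (\<lambda>x. F x \<bullet> b)" by auto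
      show "continuous_on UNIV \<phi>" using C1_fun_continuous test_functions_C1_fun \<phi> by blast
    qed (use K \<Omega> in auto)
    have "(LINT x|lebesgue_on \<Omega>. (G x - G' x) \<bullet> b * \<phi> x)
       = (LINT x|lebesgue_on \<Omega>. (G x \<bullet> b) * \<phi> x) - (LINT x|lebesgue_on \<Omega>. (G' x \<bullet> b) * \<phi> x)"
      by (subst Bochner_Integration.integral_diff[symmetric])
        (use int G G' in \<open>auto simp: inner_diff_left left_diff_distrib\<close>)
    also have "\<dots> = 0" using G G' \<phi> b by (force simp: has_weak_gradient_def)
    finally show "(LINT x|lebesgue_on \<Omega>. (G x - G' x) \<bullet> b * \<phi> x) = 0" .
  qed
  then have "AE x in lebesgue_on \<Omega>. \<forall>b\<in>Basis. (G x - G' x) \<bullet> b = 0"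
    by (intro AE_finite_allI) auto
  then show ?thesis
    by (auto elim!: eventually_mono simp: euclidean_eq_iff[where 'a='a] inner_diff_left)
qed

section \<open>Weak gradients of finite element functions\<close>

locale mesh =
  fixes \<Omega> :: "'a::euclidean_space set" and \<T> :: "'a set set"
  assumes open_dom: "open \<Omega>" and bounded_dom: "bounded \<Omega>" and finite_mesh: "finite \<T>"
    and Union_mesh: "\<Union>\<T> = closure \<Omega>" and simplices: "\<And>T. T \<in> \<T> \<Longrightarrow> int DIM('a) simplex T"
begin

lemma mesh_convex: "T \<in> \<T> \<Longrightarrow> convex T"
  using simplices convex_simplex by blast

lemma mesh_closed: "T \<in> \<T> \<Longrightarrow> closed T"
  using simplices simplex_imp_polytope polytope_imp_closed by blast

lemma compact_closure_dom: "compact (closure \<Omega>)"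
  using bounded_dom by (simp add: compact_closure)

lemma P1_linear_combination:
  assumes u: "u \<in> P1 \<Omega> \<T>" and v: "v \<in> P1 \<Omega> \<T>"
  shows "(\<lambda>x. c * u x + d * v x) \<in> P1 \<Omega> \<T>"
proof -
  have "\<exists>a b. \<forall>x\<in>T. c * u x + d * v x = a \<bullet> x + b" if T: "T \<in> \<T>" for T
  proof -
    obtain a b where 1: "\<forall>x\<in>T. u x = a \<bullet> x + b" using u T unfolding P1_def by blast
    obtain a' b' where 2: "\<forall>x\<in>T. v x = a' \<bullet> x + b'" using v T unfolding P1_def by blast
    have "\<forall>x\<in>T. c * u x + d * v x = (c *\<^sub>R a + d *\<^sub>R a') \<bullet> x + (c * b + d * b')"
      using 1 2 by (auto simp: algebra_simps inner_add_left)
    then show ?thesis by blast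
  qed
  then show ?thesis
    using u v by (auto simp: P1_def intro!: continuous_intros)
qed

lemma P1_outside: "u \<in> P1 \<Omega> \<T> \<Longrightarrow> x \<notin> closure \<Omega> \<Longrightarrow> u x = 0"
  by (simp add: P1_def)

lemma P1_bounded:
  assumes "u \<in> P1 \<Omega> \<T>"
  obtains C where "C \<ge> 0" "\<And>x. \<bar>u x\<bar> \<le> C"
proof -
  have "bounded (u ` closure \<Omega>)"
    using assms compact_closure_dom
    by (auto simp: P1_def intro!: compact_imp_bounded compact_continuous_image)
  then obtain C where C: "\<forall>x\<in>closure \<Omega>. \<bar>u x\<bar> \<le> C" by (auto simp: bounded_iff)
  show thesis
  proof
    show "\<bar>u x\<bar> \<le> \<bar>C\<bar>" for x
      using C P1_outside[OF assms, of x] by (cases "x \<in> closure \<Omega>") fastforce+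
  qed auto
qed

lemma P1_borel:
  assumes "u \<in> P1 \<Omega> \<T>"
  shows "u \<in> borel_measurable borel"
proof -
  have "(\<lambda>x. indicator (closure \<Omega>) x *\<^sub>R u x) \<in> borel_measurable borel"
    using assms by (intro borel_measurable_continuous_on_indicator) (auto simp: P1_def)
  also have "(\<lambda>x. indicator (closure \<Omega>) x *\<^sub>R u x) = u"
    using P1_outside[OF assms] by (auto simp: fun_eq_iff indicator_def)
  finally show ?thesis .
qed

text \<open>\<Omega> need not be convex, hence the restriction to segments in the closed domain. The
  mesh pulls back to finitely many closed pieces of the parameter interval, on each of which
  \<open>u\<close> is affine with a controlled slope, and Lipschitz bounds on such pieces glue. The
  last clause serves \<open>P1_grad_bounded\<close>.\<close>

lemma P1_lipschitz_segment:
  assumes u: "u \<in> P1 \<Omega> \<T>"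
  obtains L where "L \<ge> 0" "\<And>x y. closed_segment x y \<subseteq> closure \<Omega> \<Longrightarrow> \<bar>u x - u y\<bar> \<le> L * norm (x - y)"
    "\<And>T. T \<in> \<T> \<Longrightarrow> \<exists>a b. (\<forall>x\<in>T. u x = a \<bullet> x + b) \<and> norm a \<le> L"
proof -
  obtain a b where ab: "\<And>T x. T \<in> \<T> \<Longrightarrow> x \<in> T \<Longrightarrow> u x = a T \<bullet> x + b T"
    using u unfolding P1_def by (simp add: Bex_def) metis
  \<comment> \<open>A sum dominates every cell gradient and, unlike a maximum, needs no nonempty
    mesh.\<close>
  define L where "L = (\<Sum>T\<in>\<T>. norm (a T))"
  have aL: "norm (a T) \<le> L" if "T \<in> \<T>" for T
    unfolding L_def using that finite_mesh by (intro member_le_sum) auto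
  have "\<bar>u x - u y\<bar> \<le> L * norm (x - y)" if seg: "closed_segment x y \<subseteq> closure \<Omega>" for x y
  proof -
    define p where "p = (\<lambda>t::real. x + t *\<^sub>R (y - x))"
    have "(L * norm (x - y))-lipschitz_on {0..1} (\<lambda>t. u (p t))"
    proof (rule lipschitz_on_closed_Union[where I = \<T> and U = "\<lambda>T. p -` T"])
      fix T assume T: "T \<in> \<T>"
      show "closed (p -` T)"
        using mesh_closed[OF T] unfolding p_def by (intro closed_vimage) (auto intro!: continuous_intros)
      show "(L * norm (x - y))-lipschitz_on (p -` T) (\<lambda>t. u (p t))"
      proof (rule lipschitz_onI)
        fix s t assume st: "s \<in> p -` T" "t \<in> p -` T"
        then have "u (p s) - u (p t) = (s - t) * (a T \<bullet> (y - x))"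
          using ab[OF T, of "p s"] ab[OF T, of "p t"] by (simp add: p_def inner_add_right left_diff_distrib)
        moreover have "\<bar>a T \<bullet> (y - x)\<bar> \<le> L * norm (x - y)"
          using Cauchy_Schwarz_ineq2[of "a T" "y - x"] mult_right_mono[OF aL[OF T], of "norm (x - y)"]
          by (simp add: norm_minus_commute)
        ultimately show "dist (u (p s)) (u (p t)) \<le> L * norm (x - y) * dist s t"
          by (simp add: dist_norm abs_mult mult_left_mono mult.commute)
      qed (simp add: L_def sum_nonneg)
    next
      show "{0..1} \<subseteq> (\<Union>T\<in>\<T>. p -` T)"
      proof
        fix t :: real assume "t \<in> {0..1}"
        then have "p t \<in> closed_segment x y"
            unfolding p_def in_segment by (intro exI[of _ t]) (auto simp: algebra_simps)
        then show "t \<in> (\<Union>T\<in>\<T>. p -` T)" using seg Union_mesh by blast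
      qed
    qed (use finite_mesh in \<open>auto simp: L_def sum_nonneg\<close>)
    from lipschitz_onD[OF this, of 0 1] show ?thesis by (simp add: p_def dist_norm)
  qed
  then show thesis
    using that[of L] ab aL by (metis L_def norm_ge_zero sum_nonneg)
qed

definition mesh_interior :: "'a set" where "mesh_interior = (\<Union>T\<in>\<T>. interior T)"

text \<open>\<open>frechet_derivative\<close> is an arbitrary choice where \<open>u\<close> is not
  differentiable; the indicator puts 0 on the skeleton, so that the result is Borel and bounded. The
  sum is the Riesz vector of the derivative.\<close>

definition P1_grad :: "('a \<Rightarrow> real) \<Rightarrow> 'a \<Rightarrow> 'a" where
  "P1_grad u x = indicator mesh_interior x *\<^sub>R (\<Sum>i\<in>Basis. frechet_derivative u (at x) i *\<^sub>R i)"

text \<open>Cells are convex, and frontiers of convex sets are null.\<close>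

lemma negligible_mesh_skeleton: "negligible (closure \<Omega> - mesh_interior)"
proof -
  have "negligible (\<Union>T\<in>\<T>. frontier T)"
    using finite_mesh by (intro negligible_Union) (auto intro: negligible_convex_frontier mesh_convex)
  moreover have "closure \<Omega> - mesh_interior \<subseteq> (\<Union>T\<in>\<T>. frontier T)"
    using closure_subset by (fastforce simp: mesh_interior_def frontier_def Union_mesh[symmetric])
  ultimately show ?thesis by (rule negligible_subset)
qed

lemma P1_grad_eq:
  assumes T: "T \<in> \<T>" and u: "\<And>x. x \<in> T \<Longrightarrow> u x = a \<bullet> x + b" and x: "x \<in> interior T"
  shows "P1_grad u x = a"
proof -
  have "((\<lambda>x. a \<bullet> x + b) has_derivative (\<lambda>h. a \<bullet> h)) (at x)"
    by (auto intro!: derivative_eq_intros)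
  then have "(u has_derivative (\<lambda>h. a \<bullet> h)) (at x)"
    by (rule has_derivative_transform_within_open[where s = "interior T"])
      (use x u interior_subset[of T] in auto)
  then have "frechet_derivative u (at x) = (\<lambda>h. a \<bullet> h)"
    using frechet_derivative_at by metis
  moreover have "x \<in> mesh_interior" using T x by (auto simp: mesh_interior_def)
  ultimately show ?thesis by (simp add: P1_grad_def euclidean_representation)
qed

lemma P1_grad_bounded:
  assumes "u \<in> P1 \<Omega> \<T>"
  obtains C where "\<And>x. norm (P1_grad u x) \<le> C"
proof -
  obtain L where L: "L \<ge> 0" "\<And>T. T \<in> \<T> \<Longrightarrow> \<exists>a b. (\<forall>x\<in>T. u x = a \<bullet> x + b) \<and> norm a \<le> L"
    using P1_lipschitz_segment[OF assms] by metis
  have "norm (P1_grad u x) \<le> L" for x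
  proof (cases "x \<in> mesh_interior")
    case True
    then obtain T where "T \<in> \<T>" "x \<in> interior T" by (auto simp: mesh_interior_def)
    then show ?thesis using L(2) P1_grad_eq[of T u] by metis
  qed (use L(1) in \<open>auto simp: P1_grad_def\<close>)
  then show thesis using that by blast
qed

text \<open>The gradient is locally constant on the open set \<open>mesh_interior\<close> and 0
  elsewhere.\<close>

lemma P1_grad_borel:
  assumes u: "u \<in> P1 \<Omega> \<T>"
  shows "P1_grad u \<in> borel_measurable borel"
proof -
  have op: "open mesh_interior" by (auto simp: mesh_interior_def)
  have "continuous (at x) (P1_grad u)" if x: "x \<in> mesh_interior" for x
  proof -
    obtain T where T: "T \<in> \<T>" "x \<in> interior T" using x by (auto simp: mesh_interior_def)
    obtain a b where ab: "\<And>y. y \<in> T \<Longrightarrow> u y = a \<bullet> y + b" using u T by (fastforce simp: P1_def)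
    have "isCont (\<lambda>y. a) x" by auto
    moreover have "\<forall>\<^sub>F y in nhds x. P1_grad u y = a"
      using T P1_grad_eq[OF T(1) ab] by (auto simp: eventually_nhds)
    ultimately show ?thesis by (subst isCont_cong)
  qed
  then have "continuous_on mesh_interior (P1_grad u)"
    by (simp add: continuous_at_imp_continuous_on)
  then have "(\<lambda>x. indicator mesh_interior x *\<^sub>R P1_grad u x) \<in> borel_measurable borel"
    using op by (intro borel_measurable_continuous_on_indicator) auto
  also have "(\<lambda>x. indicator mesh_interior x *\<^sub>R P1_grad u x) = P1_grad u"
    by (auto simp: P1_grad_def fun_eq_iff indicator_def)
  finally show ?thesis .
qed

end

section \<open>Integration by parts through difference quotients\<close>

lemma integrable_lborel_bounded_support:
  fixes f :: "'a::euclidean_space \<Rightarrow> 'b::euclidean_space"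
  assumes "f \<in> borel_measurable borel" "\<And>x. norm (f x) \<le> C" "bounded K" "\<And>x. x \<notin> K \<Longrightarrow> f x = 0"
  shows "integrable lborel f"
proof (rule Bochner_Integration.integrable_bound)
  show "integrable lborel (\<lambda>x. C * indicator (closure K) x)"
    using assms(3) emeasure_bounded_finite[of "closure K"]
    by (intro integrable_mult_right integrable_real_indicator) auto
  show "AE x in lborel. norm (f x) \<le> norm (C * indicator (closure K) x)"
    using assms closure_subset[of K] by (intro AE_I2) (auto simp: indicator_def intro: order.trans[OF _ abs_ge_self])
qed (use assms in auto)

lemma integral_lebesgue_on_eq_lborel:
  fixes f :: "'a::euclidean_space \<Rightarrow> real"
  assumes "f \<in> borel_measurable borel" "S \<in> sets lebesgue" "\<And>x. x \<notin> S \<Longrightarrow> f x = 0"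
  shows "(LINT x|lebesgue_on S. f x) = (LINT x|lborel. f x)"
proof -
  have "(LINT x|lebesgue_on S. f x) = (LINT x|lebesgue. indicator S x *\<^sub>R f x)"
    using assms by (intro integral_restrict_space) auto
  also have "(\<lambda>x. indicator S x *\<^sub>R f x) = f"
    using assms(3) by (auto simp: fun_eq_iff indicator_def)
  also have "(LINT x|lebesgue. f x) = (LINT x|lborel. f x)"
    using assms by (intro integral_completion) auto
  finally show ?thesis .
qed

lemma integral_lborel_translate:
  fixes f :: "'a::euclidean_space \<Rightarrow> real"
  assumes "f \<in> borel_measurable borel"
  shows "(LINT x|lborel. f (c + x)) = (LINT x|lborel. f x)"
  using integral_distr[of "(+) c" lborel borel f] assms by (simp add: lborel_distr_plus)

lemma frechet_derivative_eq_0_outside_support: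
  assumes "x \<notin> closure {x. \<phi> x \<noteq> 0}"
  shows "frechet_derivative \<phi> (at x) = (\<lambda>h. 0)"
proof -
  have "((\<lambda>x. 0) has_derivative (\<lambda>h. 0)) (at x)" by simp
  then have "(\<phi> has_derivative (\<lambda>h. 0)) (at x)"
    by (rule has_derivative_transform_within_open[where s = "- closure {x. \<phi> x \<noteq> 0}"])
      (use assms closure_subset[of "{x. \<phi> x \<noteq> 0}"] in auto)
  then show ?thesis by (metis frechet_derivative_at)
qed

lemma C1_fun_line_derivative:
  assumes "C1_fun \<phi>"
  shows "((\<lambda>t. \<phi> (x + t *\<^sub>R b)) has_real_derivative frechet_derivative \<phi> (at (x + t *\<^sub>R b)) b) (at t)"
proof -
  let ?D = "frechet_derivative \<phi> (at (x + t *\<^sub>R b))"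
  have D: "(\<phi> has_derivative ?D) (at (x + t *\<^sub>R b))" using assms by (rule C1_fun_has_derivative)
  have "((\<lambda>t. x + t *\<^sub>R b) has_derivative (\<lambda>h. h *\<^sub>R b)) (at t)"
    by (auto intro!: derivative_eq_intros)
  from has_derivative_compose[OF this D]
  have "((\<lambda>t. \<phi> (x + t *\<^sub>R b)) has_derivative (\<lambda>h. ?D (h *\<^sub>R b))) (at t)" .
  moreover have "(\<lambda>h. ?D (h *\<^sub>R b)) = (*) (?D b)"
    using linear_scale[OF has_derivative_linear[OF D]] by (simp add: fun_eq_iff mult.commute)
  ultimately show ?thesis by (simp add: has_field_derivative_def)
qed

context mesh
begin

text \<open>The derivative of \<phi> is replaced by a difference quotient, translation invariance
  moves the quotient onto \<open>u\<close>, and both sides pass to the limit by dominated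
  convergence.\<close>

lemma P1_integration_by_parts:
  assumes u: "u \<in> P1 \<Omega> \<T>" and \<phi>: "\<phi> \<in> test_functions \<Omega>" and b: "b \<in> Basis"
  shows "(LINT x|lebesgue_on \<Omega>. u x * frechet_derivative \<phi> (at x) b)
       = - (LINT x|lebesgue_on \<Omega>. (P1_grad u x \<bullet> b) * \<phi> x)"
proof -
  let ?D = "\<lambda>x. frechet_derivative \<phi> (at x) b"
  define K where "K = closure {x. \<phi> x \<noteq> 0}"
  have K: "compact K" "K \<subseteq> \<Omega>" "\<And>x. x \<notin> K \<Longrightarrow> \<phi> x = 0" "\<And>x. x \<notin> K \<Longrightarrow> ?D x = 0"
    using \<phi> closure_subset[of "{x. \<phi> x \<noteq> 0}"]
    by (auto simp: test_functions_def K_def frechet_derivative_eq_0_outside_support)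
  have C1: "C1_fun \<phi>" using \<phi> by (rule test_functions_C1_fun)
  have cont: "continuous_on UNIV \<phi>" "continuous_on UNIV ?D"
    using C1 b C1_fun_continuous by (auto simp: C1_fun_def)
  have [measurable]: "\<phi> \<in> borel_measurable borel" "?D \<in> borel_measurable borel"
    "u \<in> borel_measurable borel" "P1_grad u \<in> borel_measurable borel"
    using cont borel_measurable_continuous_onI P1_borel[OF u] P1_grad_borel[OF u] by auto
  obtain Cu where Cu: "\<And>x. \<bar>u x\<bar> \<le> Cu" "Cu \<ge> 0" using P1_bounded[OF u] by metis
  have ex_bd: "\<exists>C. \<forall>x. \<bar>f x\<bar> \<le> C" if "continuous_on UNIV f" "\<And>x. x \<notin> K \<Longrightarrow> f x = 0" for f :: "'a \<Rightarrow> real"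
  proof -
    have "bounded (f ` K)"
      using that(1) K(1) continuous_on_subset by (intro compact_imp_bounded compact_continuous_image) blast+
    then obtain C where "\<forall>x\<in>K. \<bar>f x\<bar> \<le> C" by (auto simp: bounded_iff)
    then have "\<bar>f x\<bar> \<le> \<bar>C\<bar>" for x using that(2)[of x] by (cases "x \<in> K") fastforce+
    then show ?thesis by blast
  qed
  obtain C\<phi> where C\<phi>: "\<And>x. \<bar>\<phi> x\<bar> \<le> C\<phi>" using ex_bd[OF cont(1) K(3)] by blast
  obtain CD where CD: "\<And>x. \<bar>?D x\<bar> \<le> CD" using ex_bd[OF cont(2) K(4)] by blast
  have \<phi>_lip: "\<bar>\<phi> (x + s *\<^sub>R b) - \<phi> x\<bar> \<le> CD * s" if s: "s > 0" for x s
  proof -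
    obtain z where "\<phi> (x + s *\<^sub>R b) - \<phi> (x + 0 *\<^sub>R b) = (s - 0) * ?D (x + z *\<^sub>R b)"
      using MVT2[OF s C1_fun_line_derivative[OF C1, of x b]] by blast
    then show ?thesis using CD[of "x + z *\<^sub>R b"] s by (simp add: abs_mult mult.commute mult_left_mono)
  qed
  obtain L where L: "L \<ge> 0" "\<And>x y. closed_segment x y \<subseteq> closure \<Omega> \<Longrightarrow> \<bar>u x - u y\<bar> \<le> L * norm (x - y)"
    using P1_lipschitz_segment[OF u] by metis
  \<comment> \<open>The margin \<open>e\<close> keeps the segment from a point of \<open>K\<close>
    to its translate inside \<Omega>, where the segment Lipschitz bound for \<open>u\<close>
    applies.\<close>
  obtain e where e: "e > 0" "(\<Union>x\<in>K. ball x e) \<subseteq> \<Omega>"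
    using compact_subset_open_imp_ball_epsilon_subset[OF K(1) open_dom K(2)] by metis
  \<comment> \<open>The offset 2 makes even \<open>s 0\<close> strictly smaller than
    \<open>e\<close>.\<close>
  define s where "s n = e / real (n + 2)" for n
  have s: "s n > 0" "s n < e" for n using e by (auto simp: s_def field_simps add_pos_nonneg)
  have "LIM n sequentially. real (n + 2) :> at_top"
    by (intro filterlim_compose[OF filterlim_real_sequentially] filterlim_add_const_nat_at_top)
  then have s0: "s \<longlonglongrightarrow> 0"
    unfolding s_def by (intro tendsto_divide_0[OF tendsto_const] filterlim_at_top_imp_at_infinity)
  have K_bdd: "bounded K" using K(1) by (rule compact_imp_bounded)

  have lim1: "(\<lambda>n. LINT x|lborel. u x * ((\<phi> (x + s n *\<^sub>R b) - \<phi> x) / s n)) \<longlonglongrightarrow> (LINT x|lborel. u x * ?D x)"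
  proof (rule integral_dominated_convergence[where w = "\<lambda>x. Cu * CD * indicator (closure \<Omega>) x"])
    show "integrable lborel (\<lambda>x. Cu * CD * indicator (closure \<Omega>) x :: real)"
      using bounded_dom emeasure_bounded_finite[of "closure \<Omega>"]
      by (intro integrable_mult_right integrable_real_indicator) auto
    show "AE x in lborel. (\<lambda>n. u x * ((\<phi> (x + s n *\<^sub>R b) - \<phi> x) / s n)) \<longlonglongrightarrow> u x * ?D x"
    proof (intro AE_I2 tendsto_mult tendsto_const)
      fix x
      have "((\<lambda>h. (\<phi> (x + h *\<^sub>R b) - \<phi> x) / h) \<longlongrightarrow> ?D x) (at 0)"
        using C1_fun_line_derivative[OF C1, of x b 0] by (simp add: DERIV_def)
      moreover have "filterlim s (at 0) sequentially"
        using s0 s(1) by (auto simp: filterlim_at less_imp_neq[symmetric])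
      ultimately show "(\<lambda>n. (\<phi> (x + s n *\<^sub>R b) - \<phi> x) / s n) \<longlonglongrightarrow> ?D x"
        by (rule filterlim_compose)
    qed
    show "AE x in lborel. norm (u x * ((\<phi> (x + s n *\<^sub>R b) - \<phi> x) / s n)) \<le> Cu * CD * indicator (closure \<Omega>) x" for n
    proof (intro AE_I2)
      fix x
      have "\<bar>(\<phi> (x + s n *\<^sub>R b) - \<phi> x) / s n\<bar> \<le> CD"
        using \<phi>_lip[OF s(1), of x n] s(1)[of n] by (simp add: field_simps)
      then have "\<bar>u x * ((\<phi> (x + s n *\<^sub>R b) - \<phi> x) / s n)\<bar> \<le> Cu * CD"
        unfolding abs_mult using Cu by (intro mult_mono) auto
      then show "norm (u x * ((\<phi> (x + s n *\<^sub>R b) - \<phi> x) / s n)) \<le> Cu * CD * indicator (closure \<Omega>) x"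
        using P1_outside[OF u, of x] by (auto simp: indicator_def)
    qed
  qed measurable
  \<comment> \<open>Translation turns the shift of \<phi> into the opposite shift of
    \<open>u\<close>: a discrete integration by parts.\<close>
  have eq: "(LINT x|lborel. u x * ((\<phi> (x + s n *\<^sub>R b) - \<phi> x) / s n))
      = (LINT x|lborel. (u (x - s n *\<^sub>R b) - u x) / s n * \<phi> x)" for n
  proof -
    have bd: "\<bar>u y * \<phi> z\<bar> \<le> Cu * C\<phi>" for y z
      unfolding abs_mult using Cu C\<phi> by (intro mult_mono) auto
    have i1: "integrable lborel (\<lambda>x. u x * \<phi> (x + s n *\<^sub>R b))"
      using bd bounded_dom P1_outside[OF u]
      by (intro integrable_lborel_bounded_support[where C = "Cu * C\<phi>" and K = "closure \<Omega>"]) auto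
    have i2: "integrable lborel (\<lambda>x. u x * \<phi> x)"
      using bd bounded_dom P1_outside[OF u]
      by (intro integrable_lborel_bounded_support[where C = "Cu * C\<phi>" and K = "closure \<Omega>"]) auto
    have i3: "integrable lborel (\<lambda>x. u (x - s n *\<^sub>R b) * \<phi> x)"
      using bd K K_bdd by (intro integrable_lborel_bounded_support[where C = "Cu * C\<phi>" and K = K]) auto
    have tr: "(LINT x|lborel. u (x - s n *\<^sub>R b) * \<phi> x) = (LINT x|lborel. u x * \<phi> (x + s n *\<^sub>R b))"
      using integral_lborel_translate[of "\<lambda>x. u (x - s n *\<^sub>R b) * \<phi> x" "s n *\<^sub>R b"]
      by (simp add: add.commute)
    have "(LINT x|lborel. u x * ((\<phi> (x + s n *\<^sub>R b) - \<phi> x) / s n))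
        = (LINT x|lborel. (u x * \<phi> (x + s n *\<^sub>R b) - u x * \<phi> x) / s n)"
      by (simp add: right_diff_distrib)
    also have "\<dots> = (LINT x|lborel. (u (x - s n *\<^sub>R b) * \<phi> x - u x * \<phi> x) / s n)"
      using i1 i2 i3 tr by simp
    also have "\<dots> = (LINT x|lborel. (u (x - s n *\<^sub>R b) - u x) / s n * \<phi> x)"
      by (simp add: left_diff_distrib)
    finally show ?thesis .
  qed
  \<comment> \<open>The quotients of \<open>u\<close> converge only off the mesh skeleton, a null
    set; in the interior of a cell they are eventually equal to the exact slope.\<close>
  have lim2: "(\<lambda>n. LINT x|lborel. (u (x - s n *\<^sub>R b) - u x) / s n * \<phi> x) \<longlonglongrightarrow> (LINT x|lborel. - (P1_grad u x \<bullet> b) * \<phi> x)"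
  proof (rule integral_dominated_convergence[where w = "\<lambda>x. L * \<bar>\<phi> x\<bar>"])
    show "integrable lborel (\<lambda>x. L * \<bar>\<phi> x\<bar>)"
      using C\<phi> L(1) K K_bdd
      by (intro integrable_lborel_bounded_support[where C = "L * C\<phi>" and K = K]) (auto simp: abs_mult intro: mult_left_mono)
    show "AE x in lborel. norm ((u (x - s n *\<^sub>R b) - u x) / s n * \<phi> x) \<le> L * \<bar>\<phi> x\<bar>" for n
    proof (intro AE_I2)
      fix x
      show "norm ((u (x - s n *\<^sub>R b) - u x) / s n * \<phi> x) \<le> L * \<bar>\<phi> x\<bar>"
      proof (cases "x \<in> K")
        case True
        have "closed_segment (x - s n *\<^sub>R b) x \<subseteq> ball x e"
          using s[of n] b e(1) by (intro closed_segment_subset) (auto simp: dist_norm)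
        then have "\<bar>u (x - s n *\<^sub>R b) - u x\<bar> \<le> L * norm (x - s n *\<^sub>R b - x)"
          using True e(2) closure_subset[of \<Omega>] by (intro L(2)) blast
        then have "\<bar>(u (x - s n *\<^sub>R b) - u x) / s n\<bar> \<le> L"
          using s(1)[of n] b by (simp add: field_simps)
        then show ?thesis by (simp only: real_norm_def abs_mult mult_right_mono abs_ge_zero)
      qed (use K in auto)
    qed
    have "AE x in lebesgue. x \<notin> closure \<Omega> - mesh_interior"
      using negligible_mesh_skeleton unfolding negligible_iff_null_sets by (rule AE_not_in)
    then have "AE x in lborel. x \<notin> closure \<Omega> - mesh_interior"
      by (simp add: AE_completion_iff)
    then show "AE x in lborel. (\<lambda>n. (u (x - s n *\<^sub>R b) - u x) / s n * \<phi> x) \<longlonglongrightarrow> - (P1_grad u x \<bullet> b) * \<phi> x"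
    proof (rule eventually_mono)
      fix x assume x: "x \<notin> closure \<Omega> - mesh_interior"
      show "(\<lambda>n. (u (x - s n *\<^sub>R b) - u x) / s n * \<phi> x) \<longlonglongrightarrow> - (P1_grad u x \<bullet> b) * \<phi> x"
      proof (cases "x \<in> K")
        case True
        then have "x \<in> mesh_interior" using x K(2) closure_subset[of \<Omega>] by auto
        then obtain T where T: "T \<in> \<T>" "x \<in> interior T" by (auto simp: mesh_interior_def)
        obtain a c where ac: "\<And>y. y \<in> T \<Longrightarrow> u y = a \<bullet> y + c" using u T by (fastforce simp: P1_def)
        have "(\<lambda>n. x - s n *\<^sub>R b) \<longlonglongrightarrow> x - 0 *\<^sub>R b" by (intro tendsto_intros s0)
        then have "\<forall>\<^sub>F n in sequentially. x - s n *\<^sub>R b \<in> interior T"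
          using T by (intro topological_tendstoD) auto
        then have "\<forall>\<^sub>F n in sequentially. (u (x - s n *\<^sub>R b) - u x) / s n * \<phi> x = - (P1_grad u x \<bullet> b) * \<phi> x"
        proof (rule eventually_mono)
          fix n assume xs: "x - s n *\<^sub>R b \<in> interior T"
          then have "u (x - s n *\<^sub>R b) - u x = - s n * (a \<bullet> b)"
            using ac[OF subsetD[OF interior_subset T(2)]] ac[OF subsetD[OF interior_subset xs]]
            by (simp add: inner_diff_right)
          then show "(u (x - s n *\<^sub>R b) - u x) / s n * \<phi> x = - (P1_grad u x \<bullet> b) * \<phi> x"
            using P1_grad_eq[OF T(1) ac T(2)] s(1)[of n] by simp
        qed
        then show ?thesis by (rule tendsto_eventually)
      qed (use K in auto)
    qed
  qed measurable
  have "(LINT x|lborel. u x * ?D x) = (LINT x|lborel. - (P1_grad u x \<bullet> b) * \<phi> x)"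
    by (rule LIMSEQ_unique[OF lim1[unfolded eq] lim2])
  moreover have "(LINT x|lebesgue_on \<Omega>. u x * ?D x) = (LINT x|lborel. u x * ?D x)"
    using K open_dom by (intro integral_lebesgue_on_eq_lborel) auto
  moreover have "(LINT x|lebesgue_on \<Omega>. (P1_grad u x \<bullet> b) * \<phi> x) = (LINT x|lborel. (P1_grad u x \<bullet> b) * \<phi> x)"
    using K open_dom by (intro integral_lebesgue_on_eq_lborel) auto
  ultimately show ?thesis by simp
qed

end

section \<open>Surface measure of Lipschitz graphs\<close>

lemma norm_orthogonal_part_le:
  assumes "norm e = 1"
  shows "norm (v - (v \<bullet> e) *\<^sub>R e) \<le> norm v"
proof -
  have ee: "e \<bullet> e = 1" using assms by (simp add: norm_eq_1)
  have "(v - (v \<bullet> e) *\<^sub>R e) \<bullet> (v - (v \<bullet> e) *\<^sub>R e) = v \<bullet> v - (v \<bullet> e)\<^sup>2"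
    by (simp add: inner_diff_left inner_diff_right ee inner_commute power2_eq_square)
  then show ?thesis by (simp add: norm_le)
qed

text \<open>Translating a \<open>\<delta>\<close>-separated subset of a Lipschitz graph along the graph direction about \<open>\<rho>/\<delta>\<close>
  times keeps all points separated; comparing volumes then gains one power of \<open>\<delta>\<close>.\<close>

lemma lipschitz_graph_packing:
  fixes S :: "'a::euclidean_space set"
  assumes e: "norm e = 1" and L: "L \<ge> 0"
    and cone: "\<And>p p'. p \<in> S \<Longrightarrow> p' \<in> S \<Longrightarrow>
      \<bar>(p - p') \<bullet> e\<bar> \<le> L * norm ((p - p') - ((p - p') \<bullet> e) *\<^sub>R e)"
    and S: "S \<subseteq> cball x \<rho>" and \<delta>: "0 < \<delta>" "\<delta> \<le> \<rho>"
    and F: "finite F" "F \<subseteq> S" "\<And>p p'. p \<in> F \<Longrightarrow> p' \<in> F \<Longrightarrow> p \<noteq> p' \<Longrightarrow> \<delta> \<le> dist p p'"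
  shows "real (card F) * \<delta> ^ (DIM('a) - 1) \<le> (4 * L + 8) ^ DIM('a) * \<rho> ^ (DIM('a) - 1)"
proof -
  have ee: "e \<bullet> e = 1" using e by (simp add: norm_eq_1)
  \<comment> \<open>The number of layers: at least \<rho>/\<delta>, to gain that factor, and at most
    twice as many, so that the stack has height O(\<rho>).\<close>
  define N where "N = nat \<lceil>\<rho> / \<delta>\<rceil>"
  have \<rho>\<delta>: "\<rho> / \<delta> \<ge> 1" using \<delta> by simp
  then have N: "real N \<ge> \<rho> / \<delta>" "real N \<le> 2 * (\<rho> / \<delta>)" by (auto simp: N_def) linarith
  \<comment> \<open>If points of different layers are closer than \<delta> orthogonally to
    \<open>e\<close>, their unshifted heights differ by at most L \<delta>; the spacing (L + 1)
    \<delta> leaves at least \<delta>.\<close>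
  define t where "t = (\<lambda>k::nat. real k * ((L + 1) * \<delta>))"
  define c where "c = (\<lambda>(p, k). p + t k *\<^sub>R e)"
  have sep: "\<delta> \<le> dist (c (p, k)) (c (p', l))" if "p \<in> F" "p' \<in> F" "(p, k) \<noteq> (p', l)" for p p' k l
  proof (cases "k = l")
    case True
    then show ?thesis using that F(3) by (auto simp: c_def)
  next
    case False
    let ?v = "p - p'" and ?D = "(p - p') + (t k - t l) *\<^sub>R e"
    have D: "dist (c (p, k)) (c (p', l)) = norm ?D"
      by (simp add: c_def dist_norm algebra_simps)
    have "?D - (?D \<bullet> e) *\<^sub>R e = ?v - (?v \<bullet> e) *\<^sub>R e"
      by (simp add: inner_add_left ee algebra_simps)
    then have perp: "norm (?v - (?v \<bullet> e) *\<^sub>R e) \<le> norm ?D"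
      using norm_orthogonal_part_le[OF e, of ?D] by metis
    have "\<bar>real k - real l\<bar> \<ge> 1" using False by linarith
    then have "\<bar>t k - t l\<bar> \<ge> (L + 1) * \<delta>"
      using L \<delta> by (simp add: t_def left_diff_distrib[symmetric] abs_mult)
    moreover have "\<bar>?D \<bullet> e\<bar> \<le> norm ?D"
      using Cauchy_Schwarz_ineq2[of ?D e] e by simp
    moreover have "?D \<bullet> e = ?v \<bullet> e + (t k - t l)"
      by (simp add: inner_add_left ee)
    moreover have "\<bar>?v \<bullet> e\<bar> \<le> L * norm (?v - (?v \<bullet> e) *\<^sub>R e)"
      using that F(2) by (intro cone) auto
    ultimately have vert: "(L + 1) * \<delta> - L * norm (?v - (?v \<bullet> e) *\<^sub>R e) \<le> norm ?D"
      by linarith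
    show ?thesis
    proof (cases "norm (?v - (?v \<bullet> e) *\<^sub>R e) \<ge> \<delta>")
      case True
      then show ?thesis using perp D by simp
    next
      case False
      then have "L * norm (?v - (?v \<bullet> e) *\<^sub>R e) \<le> L * \<delta>" using L by (intro mult_left_mono) auto
      then show ?thesis using vert D by (simp add: algebra_simps)
    qed
  qed
  let ?I = "F \<times> {..<N}"
  let ?B = "\<lambda>i. ball (c i) (\<delta> / 2)"
  let ?d = "DIM('a)" and ?V = "measure lborel (ball (0::'a) 1)"
  \<comment> \<open>Radius \<rho> for \<open>F\<close>, at most 2 (L + 1) \<rho> for the shifts, and
    \<delta>/2 for the balls.\<close>
  define R where "R = (2 * L + 4) * \<rho>"
  have V: "?V > 0" by (rule content_ball_pos) simp
  have disj: "disjoint_family_on ?B ?I"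
    unfolding disjoint_family_on_def
  proof (intro ballI impI)
    fix i j assume ij: "i \<in> ?I" "j \<in> ?I" "i \<noteq> j"
    then have "\<delta> \<le> dist (c i) (c j)" using sep[of "fst i" "fst j" "snd i" "snd j"] by auto
    then show "?B i \<inter> ?B j = {}" by (intro disjoint_ballI) auto
  qed
  have sub: "(\<Union>i\<in>?I. ?B i) \<subseteq> ball x R"
  proof
    fix y assume "y \<in> (\<Union>i\<in>?I. ?B i)"
    then obtain p k where pk: "p \<in> F" "k < N" "dist (p + t k *\<^sub>R e) y < \<delta> / 2" by (auto simp: c_def)
    have "real k + 1 \<le> real N" using pk(2) by linarith
    then have "real k \<le> 2 * (\<rho> / \<delta>)" using N(2) by linarith
    then have "real k * \<delta> \<le> 2 * \<rho>" using \<delta> by (simp add: field_simps)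
    then have "(L + 1) * (real k * \<delta>) \<le> (L + 1) * (2 * \<rho>)" using L by (intro mult_left_mono) auto
    then have "t k \<le> 2 * (L + 1) * \<rho>" by (simp add: t_def mult_ac)
    moreover have "t k \<ge> 0" using L \<delta> by (simp add: t_def)
    ultimately have "dist p (p + t k *\<^sub>R e) \<le> 2 * (L + 1) * \<rho>" using e by (simp add: dist_norm)
    moreover have "dist x p \<le> \<rho>" using pk S F(2) by auto
    ultimately have "dist x y < \<rho> + 2 * (L + 1) * \<rho> + \<delta> / 2"
      using pk(3) dist_triangle[of x y p] dist_triangle[of p y "p + t k *\<^sub>R e"] by linarith
    also have "\<dots> \<le> R" using \<delta> by (simp add: R_def algebra_simps)
    finally show "y \<in> ball x R" by simp
  qed
  have R: "R > 0" using L \<delta> by (auto simp: R_def intro!: mult_pos_pos)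
  have "real (card ?I) * ((\<delta> / 2) ^ ?d * ?V) = (\<Sum>i\<in>?I. measure lborel (?B i))"
    using \<delta> by (simp add: content_ball_conv_unit_ball[of "\<delta> / 2"])
  also have "\<dots> = measure lborel (\<Union>i\<in>?I. ?B i)"
    using F(1) disj emeasure_lborel_ball_finite
    by (intro measure_finite_Union[symmetric]) (auto simp: less_top)
  also have "\<dots> \<le> measure lborel (ball x R)"
    using sub emeasure_lborel_ball_finite[of x R] by (intro measure_mono_fmeasurable) (auto simp: fmeasurable_def intro!: borel_open)
  also have "\<dots> = R ^ ?d * ?V"
    using R by (simp add: content_ball_conv_unit_ball[of R])
  finally have "real (card F) * real N * (\<delta> / 2) ^ ?d \<le> R ^ ?d"
    using V by (simp add: card_cartesian_product mult.assoc[symmetric])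
  \<comment> \<open>Here the layers pay off: the factor \<rho>/\<delta> turns \<delta>^d into \<rho>
    \<delta>^(d - 1).\<close>
  moreover have "real (card F) * (\<rho> / \<delta>) * (\<delta> / 2) ^ ?d \<le> real (card F) * real N * (\<delta> / 2) ^ ?d"
    using N(1) \<delta> by (intro mult_right_mono mult_left_mono) auto
  ultimately have "real (card F) * (\<rho> / \<delta>) * (\<delta> / 2) ^ ?d \<le> R ^ ?d" by simp
  then have "2 ^ ?d * (real (card F) * (\<rho> / \<delta>) * (\<delta> / 2) ^ ?d) \<le> 2 ^ ?d * R ^ ?d"
    by (intro mult_left_mono) auto
  also have "2 ^ ?d * (real (card F) * (\<rho> / \<delta>) * (\<delta> / 2) ^ ?d) = real (card F) * (\<rho> / \<delta>) * \<delta> ^ ?d"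
    by (simp add: power_divide)
  finally have "real (card F) * (\<rho> / \<delta>) * \<delta> ^ ?d \<le> 2 ^ ?d * R ^ ?d" .
  also have "2 ^ ?d * R ^ ?d = (4 * L + 8) ^ ?d * \<rho> ^ ?d"
    by (simp add: R_def power_mult_distrib[symmetric] algebra_simps)
  finally have main: "real (card F) * (\<rho> / \<delta>) * \<delta> ^ ?d \<le> (4 * L + 8) ^ ?d * \<rho> ^ ?d" .
  have pow: "z ^ ?d = z * z ^ (?d - 1)" for z :: real
    using DIM_positive[where 'a='a] by (metis power_minus_mult mult.commute)
  have "\<rho> * (real (card F) * \<delta> ^ (?d - 1)) \<le> \<rho> * ((4 * L + 8) ^ ?d * \<rho> ^ (?d - 1))"
    using main \<delta> unfolding pow[of \<delta>] pow[of \<rho>] by (simp add: mult_ac)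
  then show ?thesis using \<delta> by simp
qed

text \<open>A \<delta>-separated subset of maximal cardinality is a net, since a point outside all
  its balls could be added. The packing bound makes a maximum exist and counts the balls.\<close>

lemma lipschitz_graph_net:
  fixes S :: "'a::euclidean_space set"
  assumes e: "norm e = 1" and L: "L \<ge> 0"
    and cone: "\<And>p p'. p \<in> S \<Longrightarrow> p' \<in> S \<Longrightarrow>
      \<bar>(p - p') \<bullet> e\<bar> \<le> L * norm ((p - p') - ((p - p') \<bullet> e) *\<^sub>R e)"
    and S: "S \<subseteq> cball x \<rho>" and \<delta>: "0 < \<delta>" "\<delta> \<le> \<rho>"
  obtains F where "finite F" "S \<subseteq> (\<Union>p\<in>F. cball p \<delta>)"
    "real (card F) * \<delta> ^ (DIM('a) - 1) \<le> (4 * L + 8) ^ DIM('a) * \<rho> ^ (DIM('a) - 1)"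
proof -
  define C where "C = (4 * L + 8) ^ DIM('a) * \<rho> ^ (DIM('a) - 1)"
  define P where "P n \<longleftrightarrow> (\<exists>F. finite F \<and> F \<subseteq> S \<and> (\<forall>p\<in>F. \<forall>p'\<in>F. p \<noteq> p' \<longrightarrow> \<delta> \<le> dist p p') \<and> card F = n)" for n
  have bound: "real (card F) * \<delta> ^ (DIM('a) - 1) \<le> C"
    if "finite F" "F \<subseteq> S" "\<forall>p\<in>F. \<forall>p'\<in>F. p \<noteq> p' \<longrightarrow> \<delta> \<le> dist p p'" for F
    unfolding C_def by (rule lipschitz_graph_packing[OF e L cone S \<delta>]) (use that in auto)
  have "n \<le> nat \<lceil>C / \<delta> ^ (DIM('a) - 1)\<rceil>" if "P n" for n
  proof -
    have "real n * \<delta> ^ (DIM('a) - 1) \<le> C" using that bound by (auto simp: P_def)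
    then have "real n \<le> C / \<delta> ^ (DIM('a) - 1)" using \<delta> by (simp add: field_simps)
    then show ?thesis by linarith
  qed
  moreover have "P 0" unfolding P_def by (rule exI[of _ "{}"]) auto
  ultimately obtain n where n: "P n" "\<And>m. P m \<Longrightarrow> m \<le> n"
    using ex_has_greatest_nat[of P 0 "\<lambda>n. n" "Suc (nat \<lceil>C / \<delta> ^ (DIM('a) - 1)\<rceil>)"]
    by (metis less_Suc_eq_le)
  then obtain F where F: "finite F" "F \<subseteq> S" "\<forall>p\<in>F. \<forall>p'\<in>F. p \<noteq> p' \<longrightarrow> \<delta> \<le> dist p p'" "card F = n"
    by (auto simp: P_def)
  have "S \<subseteq> (\<Union>p\<in>F. cball p \<delta>)"
  proof
    fix y assume y: "y \<in> S"
    show "y \<in> (\<Union>p\<in>F. cball p \<delta>)"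
    proof (rule ccontr)
      assume no: "y \<notin> (\<Union>p\<in>F. cball p \<delta>)"
      then have far: "\<forall>p\<in>F. \<delta> < dist p y" by auto
      then have "y \<notin> F" using \<delta> by force
      have "P (card (insert y F))"
        unfolding P_def using F y far
        by (intro exI[of _ "insert y F"]) (auto simp: dist_commute less_imp_le)
      then show False using n(2)[of "card (insert y F)"] F \<open>y \<notin> F\<close> by simp
    qed
  qed
  then show thesis using that[OF F(1)] bound[OF F(1-3)] by (simp add: C_def)
qed

text \<open>The definition wants a sequence of sets, so the finite cover is padded with empty sets;
  their terms are multiples of 0^k, which is 0 only for \<open>k \<ge> 1\<close>.\<close>

lemma hausdorff_pre_le_net:
  assumes k: "k \<ge> 1" and F: "finite F" "S \<subseteq> (\<Union>p\<in>F. cball p \<delta>)" and \<delta>: "0 < \<delta>" "2 * \<delta> \<le> \<delta>'"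
  shows "hausdorff_pre k \<delta>' S \<le> ennreal (unit_ball_vol (real k) * (real (card F) * \<delta> ^ k))"
proof -
  obtain h where h: "bij_betw h {0..<card F} F" using ex_bij_betw_nat_finite[OF F(1)] by blast
  define C where "C = (\<lambda>i. if i < card F then cball (h i) \<delta> else {})"
  have "S \<subseteq> (\<Union>i. C i)"
  proof
    fix y assume "y \<in> S"
    then obtain p where "p \<in> F" "y \<in> cball p \<delta>" using F by auto
    moreover from this obtain i where "i < card F" "h i = p"
      using bij_betw_imp_surj_on[OF h] by (metis atLeastLessThan_iff imageE)
    ultimately have "y \<in> C i" by (simp add: C_def)
    then show "y \<in> (\<Union>i. C i)" by blast
  qed
  moreover have "bounded (C i) \<and> diameter (C i) \<le> \<delta>'" for i
    using \<delta> by (simp add: C_def diameter_cball)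
  ultimately have "hausdorff_pre k \<delta>' S \<le> (\<Sum>i. ennreal (unit_ball_vol (real k) * (diameter (C i) / 2) ^ k))"
    unfolding hausdorff_pre_def by (intro INF_lower) auto
  also have "\<dots> = (\<Sum>i<card F. ennreal (unit_ball_vol (real k) * (diameter (C i) / 2) ^ k))"
    using k by (intro suminf_finite) (auto simp: C_def power_0_left)
  also have "\<dots> = (\<Sum>i<card F. ennreal (unit_ball_vol (real k) * \<delta> ^ k))"
    using \<delta> by (intro sum.cong) (auto simp: C_def diameter_cball)
  also have "\<dots> = ennreal (unit_ball_vol (real k) * (real (card F) * \<delta> ^ k))"
    using \<delta> by (subst sum_ennreal) (auto simp: mult_ac)
  finally show ?thesis .
qed

text \<open>The number of balls in a net times \<delta>^(d - 1) is bounded independently of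
  \<delta>, so the bound survives the supremum over the fineness of the covers.\<close>

lemma hausdorff_outer_lipschitz_graph:
  fixes S :: "'a::euclidean_space set"
  assumes dim: "DIM('a) \<ge> 2" and e: "norm e = 1" and L: "L \<ge> 0"
    and cone: "\<And>p p'. p \<in> S \<Longrightarrow> p' \<in> S \<Longrightarrow>
      \<bar>(p - p') \<bullet> e\<bar> \<le> L * norm ((p - p') - ((p - p') \<bullet> e) *\<^sub>R e)"
    and S: "S \<subseteq> cball x \<rho>" and \<rho>: "\<rho> > 0"
  shows "hausdorff_outer (DIM('a) - 1) S \<le>
    ennreal (unit_ball_vol (real (DIM('a) - 1)) * (4 * L + 8) ^ DIM('a) * \<rho> ^ (DIM('a) - 1))"
  unfolding hausdorff_outer_def
proof (rule SUP_least)
  fix \<delta>' :: real assume "\<delta>' \<in> {0<..}"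
  \<comment> \<open>\<delta>'/2 because a ball has twice its radius as diameter, \<rho> because the
    packing bound requires \<delta> \<le> \<rho>.\<close>
  define \<delta> where "\<delta> = min (\<delta>' / 2) \<rho>"
  have \<delta>: "0 < \<delta>" "\<delta> \<le> \<rho>" "2 * \<delta> \<le> \<delta>'" using \<open>\<delta>' \<in> _\<close> \<rho> by (auto simp: \<delta>_def)
  obtain F where F: "finite F" "S \<subseteq> (\<Union>p\<in>F. cball p \<delta>)"
    "real (card F) * \<delta> ^ (DIM('a) - 1) \<le> (4 * L + 8) ^ DIM('a) * \<rho> ^ (DIM('a) - 1)"
    using lipschitz_graph_net[OF e L cone S \<delta>(1,2)] by blast
  have "hausdorff_pre (DIM('a) - 1) \<delta>' S \<le> ennreal (unit_ball_vol (real (DIM('a) - 1)) * (real (card F) * \<delta> ^ (DIM('a) - 1)))"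
    by (rule hausdorff_pre_le_net[OF _ F(1,2) \<delta>(1,3)]) (use dim in auto)
  also have "\<dots> \<le> ennreal (unit_ball_vol (real (DIM('a) - 1)) * ((4 * L + 8) ^ DIM('a) * \<rho> ^ (DIM('a) - 1)))"
    using F(3) by (intro ennreal_leI mult_left_mono) auto
  finally show "hausdorff_pre (DIM('a) - 1) \<delta>' S \<le>
      ennreal (unit_ball_vol (real (DIM('a) - 1)) * (4 * L + 8) ^ DIM('a) * \<rho> ^ (DIM('a) - 1))"
    by (simp add: mult.assoc)
qed

text \<open>\<open>measure_of\<close> yields either the given set function or 0, so this inequality
  holds without a proof of countable additivity.\<close>

lemma emeasure_hausdorff_measure_le: "emeasure (hausdorff_measure k) A \<le> hausdorff_outer k A"
  by (simp add: hausdorff_measure_def emeasure_measure_of_conv)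

lemma sets_hausdorff_measure [simp]:
  "sets (hausdorff_measure k :: 'a::euclidean_space measure) = sets borel"
  using sets.sigma_sets_eq[of "borel :: 'a measure"] by (simp add: hausdorff_measure_def)

lemma space_hausdorff_measure [simp]: "space (hausdorff_measure k) = UNIV"
  by (simp add: hausdorff_measure_def)

lemma space_surf [simp]: "space (surf \<Omega>) = frontier \<Omega>"
  by (simp add: surf_def space_restrict_space)

lemma
  assumes "A \<in> sets borel" "A \<subseteq> frontier \<Omega>"
  shows sets_surfI: "A \<in> sets (surf \<Omega>)"
    and emeasure_surf: "emeasure (surf \<Omega>) A = emeasure (hausdorff_measure (DIM('a) - 1)) (A :: 'a::euclidean_space set)"
proof -
  have *: "A \<in> sets (restrict_space (hausdorff_measure (DIM('a) - 1)) (frontier \<Omega>))"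
    using assms by (auto simp: sets_restrict_space_iff)
  then show "A \<in> sets (surf \<Omega>)" by (auto simp: surf_def)
  show "emeasure (surf \<Omega>) A = emeasure (hausdorff_measure (DIM('a) - 1)) A"
    using * assms by (simp add: surf_def emeasure_restrict_space)
qed

section \<open>The boundary of a Lipschitz domain\<close>

text \<open>Above the graph, \<open>p\<close> would lie in the open set \<Omega>; below it,
  \<open>p\<close> would have a neighbourhood missing \<Omega>. A frontier point allows
  neither.\<close>

lemma lipschitz_chart_frontier:
  fixes \<Omega> :: "'a::euclidean_space set"
  assumes \<Omega>: "open \<Omega>" and e: "norm e = 1" and \<gamma>: "L-lipschitz_on {y. y \<bullet> e = 0} \<gamma>"
    and chart: "\<Omega> \<inter> ball z r = {y \<in> ball z r. y \<bullet> e > \<gamma> (y - (y \<bullet> e) *\<^sub>R e)}"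
    and p: "p \<in> frontier \<Omega> \<inter> ball z r"
  shows "p \<bullet> e = \<gamma> (p - (p \<bullet> e) *\<^sub>R e)"
proof -
  have ee: "e \<bullet> e = 1" using e by (simp add: norm_eq_1)
  define G where "G = (\<lambda>y. y \<bullet> e - \<gamma> (y - (y \<bullet> e) *\<^sub>R e))"
  have "continuous_on UNIV (\<lambda>y. \<gamma> (y - (y \<bullet> e) *\<^sub>R e))"
    by (rule continuous_on_compose2[OF lipschitz_on_continuous_on[OF \<gamma>]])
      (auto intro!: continuous_intros simp: inner_diff_left ee)
  then have contG: "continuous_on UNIV G"
    unfolding G_def by (intro continuous_intros)
  have "p \<notin> \<Omega>" using \<Omega> p by (auto simp: frontier_def interior_open)
  then have "\<not> G p > 0" using chart p by (auto simp: G_def)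
  moreover have "\<not> G p < 0"
  proof
    assume "G p < 0"
    have "open (ball z r \<inter> {y. G y < 0})"
      using contG by (intro open_Int open_Collect_less) auto
    moreover have "p \<in> ball z r \<inter> {y. G y < 0}" using p \<open>G p < 0\<close> by auto
    moreover have "p \<in> closure \<Omega>" using p by (auto simp: frontier_def)
    ultimately have "\<Omega> \<inter> (ball z r \<inter> {y. G y < 0}) \<noteq> {}"
      unfolding closure_iff_nhds_not_empty by blast
    then obtain x where x: "x \<in> \<Omega> \<inter> ball z r" "G x < 0" by blast
    then have "x \<bullet> e > \<gamma> (x - (x \<bullet> e) *\<^sub>R e)" unfolding chart by simp
    then show False using x(2) by (simp add: G_def)
  qed
  ultimately show ?thesis by (simp add: G_def)
qed

text \<open>The last clause joins two boundary points inside the closed domain, by going up from each of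
  them in the chart direction.\<close>

definition frontier_chart :: "'a::euclidean_space set \<Rightarrow> 'a \<Rightarrow> real \<Rightarrow> 'a \<Rightarrow> real \<Rightarrow> bool" where
  "frontier_chart \<Omega> z r e K \<longleftrightarrow> r > 0 \<and> norm e = 1 \<and> K \<ge> 0 \<and>
    (\<forall>p\<in>frontier \<Omega> \<inter> ball z r. \<forall>p'\<in>frontier \<Omega> \<inter> ball z r.
      \<bar>(p - p') \<bullet> e\<bar> \<le> K * norm ((p - p') - ((p - p') \<bullet> e) *\<^sub>R e)) \<and>
    (\<forall>p\<in>frontier \<Omega> \<inter> ball z r. \<forall>p'\<in>frontier \<Omega> \<inter> ball z r. \<exists>x x'.
      norm (p - x) \<le> K * norm (p - p') \<and> norm (x - x') \<le> K * norm (p - p') \<and>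
      norm (x' - p') \<le> K * norm (p - p') \<and> closed_segment p x \<subseteq> closure \<Omega> \<and>
      closed_segment x x' \<subseteq> closure \<Omega> \<and> closed_segment x' p' \<subseteq> closure \<Omega>)"

text \<open>Boundary points lie on the graph, which gives the cone condition. For the path, both
  points are lifted along \<open>e\<close> so far that the graph stays below the segment joining the
  lifts.\<close>

lemma lipschitz_domain_frontier_chart:
  fixes \<Omega> :: "'a::euclidean_space set"
  assumes \<Omega>: "open \<Omega>" "lipschitz_domain \<Omega>" and z: "z \<in> frontier \<Omega>"
  shows "\<exists>r e K. frontier_chart \<Omega> z r e K"
proof -
  obtain e r L and \<gamma> :: "'a \<Rightarrow> real" where e: "norm e = 1" and r: "r > 0"
    and \<gamma>: "L-lipschitz_on {y. y \<bullet> e = 0} \<gamma>"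
    and chart: "\<Omega> \<inter> ball z r = {y \<in> ball z r. y \<bullet> e > \<gamma> (y - (y \<bullet> e) *\<^sub>R e)}"
    using \<Omega>(2) z unfolding lipschitz_domain_def by blast
  have ee: "e \<bullet> e = 1" using e by (simp add: norm_eq_1)
  have L: "L \<ge> 0" using \<gamma> lipschitz_on_nonneg by blast
  define P where "P = (\<lambda>v. v - (v \<bullet> e) *\<^sub>R e)"
  have P_diff: "P v - P w = P (v - w)" for v w by (simp add: P_def inner_diff_left algebra_simps)
  have P_le: "norm (P v) \<le> norm v" for v
    using norm_orthogonal_part_le[OF e, of v] by (simp add: P_def)
  have \<gamma>_le: "\<bar>\<gamma> (P v) - \<gamma> (P w)\<bar> \<le> L * norm (P (v - w))" for v w
  proof -
    have "P v \<bullet> e = 0" for v by (simp add: P_def inner_diff_left ee)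
    then show ?thesis
      using lipschitz_onD[OF \<gamma>, of "P v" "P w"] by (simp add: P_diff dist_norm)
  qed
  have graph: "p \<bullet> e = \<gamma> (P p)" if "p \<in> frontier \<Omega>" "p \<in> ball z r" for p
    using lipschitz_chart_frontier[OF \<Omega>(1) e \<gamma> chart, of p] that by (simp add: P_def)
  have inside: "y \<in> \<Omega>" if "y \<in> ball z r" "y \<bullet> e > \<gamma> (P y)" for y
    using chart that by (auto simp: P_def)
  \<comment> \<open>The path stays in the chart ball: \<open>p\<close> is within s of
    \<open>z\<close>, moving towards \<open>p'\<close> adds at most 2 s and the lift at most 2 (L +
    2) s, in total (2 L + 7) s.\<close>
  define s where "s = r / (2 * L + 7)"
  have s: "s > 0" "s * (2 * L + 7) = r" using r L by (auto simp: s_def)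
  have "s * 1 \<le> s * (2 * L + 7)" using L s(1) by (intro mult_left_mono) auto
  then have sr: "s \<le> r" using s(2) by simp
  have cone: "\<bar>(p - p') \<bullet> e\<bar> \<le> (L + 2) * norm (P (p - p'))"
    if "p \<in> frontier \<Omega> \<inter> ball z s" "p' \<in> frontier \<Omega> \<inter> ball z s" for p p'
  proof -
    have "\<bar>(p - p') \<bullet> e\<bar> \<le> L * norm (P (p - p'))"
      using graph[of p] graph[of p'] \<gamma>_le[of p p'] that sr by (auto simp: inner_diff_left)
    also have "\<dots> \<le> (L + 2) * norm (P (p - p'))" by (intro mult_right_mono) auto
    finally show ?thesis .
  qed
  have path: "\<exists>x x'. norm (p - x) \<le> (L + 2) * norm (p - p') \<and> norm (x - x') \<le> (L + 2) * norm (p - p') \<and> norm (x' - p') \<le> (L + 2) * norm (p - p') \<and>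
      closed_segment p x \<subseteq> closure \<Omega> \<and> closed_segment x x' \<subseteq> closure \<Omega> \<and> closed_segment x' p' \<subseteq> closure \<Omega>"
    if p: "p \<in> frontier \<Omega> \<inter> ball z s" and p': "p' \<in> frontier \<Omega> \<inter> ball z s" for p p'
  proof -
    \<comment> \<open>Along the top segment the graph rises by at most L |p - p'| and the height
      drops by at most |p - p'|; the factor L + 2 leaves a surplus of |p - p'|.\<close>
    define t where "t = (L + 2) * norm (p - p')"
    have t: "t \<ge> 0" using L by (simp add: t_def)
    have pp: "norm (p - p') < 2 * s"
      using p p' dist_triangle[of p p' z] by (auto simp: dist_norm norm_minus_commute)
    have t_less: "t \<le> (L + 2) * (2 * s)" unfolding t_def using pp L by (intro mult_left_mono) auto
    have P_up: "P (v + c *\<^sub>R e) = P v" for v c by (simp add: P_def inner_add_left ee algebra_simps)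
    have up: "y + \<tau> *\<^sub>R e \<in> closure \<Omega>" if y: "y \<in> frontier \<Omega> \<inter> ball z s" and \<tau>: "0 \<le> \<tau>" "\<tau> \<le> t" for y \<tau>
    proof (cases "\<tau> = 0")
      case True
      then show ?thesis using y by (auto simp: frontier_def)
    next
      case False
      have "dist z (y + \<tau> *\<^sub>R e) \<le> dist z y + \<tau>"
        using dist_triangle[of z "y + \<tau> *\<^sub>R e" y] \<tau> e by (simp add: dist_norm)
      also have "\<dots> < s + (L + 2) * (2 * s)" using y \<tau> t_less by auto
      also have "\<dots> \<le> r" using s by (simp add: algebra_simps)
      finally have "y + \<tau> *\<^sub>R e \<in> \<Omega>"
        using graph[of y] y sr False \<tau> by (intro inside) (auto simp: P_up inner_add_left ee)
      then show ?thesis using closure_subset by blast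
    qed
    have seg: "closed_segment y (y + t *\<^sub>R e) \<subseteq> closure \<Omega>" if y: "y \<in> frontier \<Omega> \<inter> ball z s" for y
    proof
      fix w assume "w \<in> closed_segment y (y + t *\<^sub>R e)"
      then obtain u where u: "0 \<le> u" "u \<le> 1" "w = (1 - u) *\<^sub>R y + u *\<^sub>R (y + t *\<^sub>R e)" by (auto simp: in_segment)
      then have "w = y + (u * t) *\<^sub>R e" by (simp add: algebra_simps)
      moreover have "u * t \<le> t" using u t by (simp add: mult_left_le_one_le)
      ultimately show "w \<in> closure \<Omega>" using up[OF y, of "u * t"] u t by simp
    qed
    have top: "closed_segment (p + t *\<^sub>R e) (p' + t *\<^sub>R e) \<subseteq> closure \<Omega>"
    \<comment> \<open>For equal points there is no strict surplus, but the segment degenerates to a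
      point already treated.\<close>
    proof (cases "p = p'")
      case True
      then show ?thesis using seg[OF p] by auto
    next
      case False
      show ?thesis
      proof
        fix w assume "w \<in> closed_segment (p + t *\<^sub>R e) (p' + t *\<^sub>R e)"
        then obtain u where u: "0 \<le> u" "u \<le> 1" "w = (1 - u) *\<^sub>R (p + t *\<^sub>R e) + u *\<^sub>R (p' + t *\<^sub>R e)"
          by (auto simp: in_segment)
        define v where "v = u *\<^sub>R (p' - p)"
        have w: "w = (p + v) + t *\<^sub>R e" using u(3) by (simp add: v_def algebra_simps)
        have v: "norm v \<le> norm (p - p')" using u by (simp add: v_def norm_minus_commute mult_left_le_one_le)
        have "\<bar>\<gamma> (P (p + v)) - \<gamma> (P p)\<bar> \<le> L * norm (P v)" using \<gamma>_le[of "p + v" p] by simp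
        also have "\<dots> \<le> L * norm (p - p')" using L P_le[of v] v by (intro mult_left_mono) auto
        finally have "\<gamma> (P (p + v)) \<le> p \<bullet> e + L * norm (p - p')" using graph[of p] p sr by auto
        moreover have "\<bar>v \<bullet> e\<bar> \<le> norm (p - p')" using Cauchy_Schwarz_ineq2[of v e] e v by simp
        moreover have "t = L * norm (p - p') + 2 * norm (p - p')" by (simp add: t_def algebra_simps)
        moreover have "norm (p - p') > 0" using False by simp
        ultimately have "\<gamma> (P (p + v)) < p \<bullet> e + v \<bullet> e + t" by linarith
        then have "w \<bullet> e > \<gamma> (P w)" by (simp add: w P_up inner_add_left ee)
        moreover have "w \<in> ball z r"
        proof -
          have "w - p = v + t *\<^sub>R e" by (simp add: w)
          then have "dist p w \<le> norm v + t"
            using norm_triangle_ineq[of v "t *\<^sub>R e"] t e by (simp add: dist_norm norm_minus_commute[of p])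
          then have "dist z w \<le> dist z p + norm v + t"
            using dist_triangle[of z w p] by linarith
          also have "\<dots> < s + 2 * s + (L + 2) * (2 * s)" using p v pp t_less by auto
          also have "\<dots> = r" using s(2) by (simp add: algebra_simps)
          finally show ?thesis by simp
        qed
        ultimately show "w \<in> closure \<Omega>" using inside closure_subset by blast
      qed
    qed
    have "norm (p - p') \<le> (L + 2) * norm (p - p')" using L by (simp add: mult_le_cancel_right1)
    then show ?thesis
      using seg[OF p] seg[OF p'] top t e
      by (intro exI[of _ "p + t *\<^sub>R e"] exI[of _ "p' + t *\<^sub>R e"])
        (auto simp: t_def closed_segment_commute)
  qed
  have "frontier_chart \<Omega> z s e (L + 2)"
    unfolding frontier_chart_def using s(1) e L cone[unfolded P_def] path by auto
  then show ?thesis by blast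
qed

section \<open>Surface measure and Lipschitz bounds on the whole boundary\<close>

locale lipschitz_mesh = mesh +
  assumes lipschitz_dom: "lipschitz_domain \<Omega>" and dim: "DIM('a) \<ge> 2"
begin

lemma compact_frontier_dom: "compact (frontier \<Omega>)"
  using bounded_dom compact_frontier_bounded by blast

lemma frontier_charts:
  obtains Z r e K where "finite Z" "frontier \<Omega> \<subseteq> (\<Union>z\<in>Z. ball z (r z))"
    "\<And>z. z \<in> Z \<Longrightarrow> frontier_chart \<Omega> z (r z) (e z) (K z)"
proof -
  obtain r e K where chart: "\<And>z. z \<in> frontier \<Omega> \<Longrightarrow> frontier_chart \<Omega> z (r z) (e z) (K z)"
    using lipschitz_domain_frontier_chart[OF open_dom lipschitz_dom] by metis
  then have "r z > 0" if "z \<in> frontier \<Omega>" for z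
    using that by (auto simp: frontier_chart_def)
  then have "frontier \<Omega> \<subseteq> (\<Union>z\<in>frontier \<Omega>. ball z (r z))" by force
  then obtain Z where "Z \<subseteq> frontier \<Omega>" "finite Z" "frontier \<Omega> \<subseteq> (\<Union>z\<in>Z. ball z (r z))"
    using compactE_image[OF compact_frontier_dom, of "frontier \<Omega>" "\<lambda>z. ball z (r z)"] by auto
  then show thesis using that chart by (meson subsetD)
qed

text \<open>Finitely many charts cover the compact boundary, and their bounds add up. The graph
  bound has no smallness condition on \<rho>, so all radii and centres are covered at once.\<close>

lemma surf_ball_bound:
  obtains C where "C \<ge> 0" "\<And>x \<rho>. \<rho> > 0 \<Longrightarrow> emeasure (surf \<Omega>) (frontier \<Omega> \<inter> cball x \<rho>) \<le> ennreal (C * \<rho> ^ (DIM('a) - 1))"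
proof -
  obtain Z r e K where Z: "finite Z" "frontier \<Omega> \<subseteq> (\<Union>z\<in>Z. ball z (r z))"
    and chart: "\<And>z. z \<in> Z \<Longrightarrow> frontier_chart \<Omega> z (r z) (e z) (K z)"
    using frontier_charts by blast
  have e: "norm (e z) = 1" and K: "K z \<ge> 0" if "z \<in> Z" for z
    using chart[OF that] by (auto simp: frontier_chart_def)
  let ?k = "DIM('a) - 1"
  let ?\<mu> = "hausdorff_measure ?k :: 'a measure"
  define c where "c z = unit_ball_vol (real ?k) * (4 * K z + 8) ^ DIM('a)" for z
  have c: "c z \<ge> 0" if "z \<in> Z" for z using K[OF that] by (simp add: c_def)
  show thesis
  proof
    show "(\<Sum>z\<in>Z. c z) \<ge> 0" using c by (rule sum_nonneg)
    fix x :: 'a and \<rho> :: real assume \<rho>: "\<rho> > 0"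
    let ?S = "\<lambda>z. frontier \<Omega> \<inter> ball z (r z) \<inter> cball x \<rho>"
    have "emeasure (surf \<Omega>) (frontier \<Omega> \<inter> cball x \<rho>) = emeasure ?\<mu> (frontier \<Omega> \<inter> cball x \<rho>)"
      by (intro emeasure_surf) auto
    also have "\<dots> \<le> emeasure ?\<mu> (\<Union>z\<in>Z. ?S z)"
      using Z(1,2) by (intro emeasure_mono sets.finite_UN) (auto intro!: sets.Int)
    also have "\<dots> \<le> (\<Sum>z\<in>Z. emeasure ?\<mu> (?S z))"
      using Z(1) by (intro emeasure_subadditive_finite) auto
    also have "\<dots> \<le> (\<Sum>z\<in>Z. ennreal (c z * \<rho> ^ ?k))"
    proof (intro sum_mono)
      fix z assume z: "z \<in> Z"
      have "emeasure ?\<mu> (?S z) \<le> hausdorff_outer ?k (?S z)" by (rule emeasure_hausdorff_measure_le)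
      also have "\<dots> \<le> ennreal (c z * \<rho> ^ ?k)"
        unfolding c_def using chart[OF z]
        by (intro hausdorff_outer_lipschitz_graph[OF dim e[OF z] K[OF z] _ _ \<rho>]) (auto simp: frontier_chart_def)
      finally show "emeasure ?\<mu> (?S z) \<le> ennreal (c z * \<rho> ^ ?k)" .
    qed
    also have "\<dots> = ennreal ((\<Sum>z\<in>Z. c z) * \<rho> ^ ?k)"
      using c \<rho> by (subst sum_ennreal) (auto simp: sum_distrib_right)
    finally show "emeasure (surf \<Omega>) (frontier \<Omega> \<inter> cball x \<rho>) \<le> ennreal ((\<Sum>z\<in>Z. c z) * \<rho> ^ ?k)" .
  qed
qed

lemma finite_measure_surf: "finite_measure (surf \<Omega>)"
proof
  obtain C where C: "C \<ge> 0" "\<And>x \<rho>. \<rho> > 0 \<Longrightarrow> emeasure (surf \<Omega>) (frontier \<Omega> \<inter> cball x \<rho>) \<le> ennreal (C * \<rho> ^ (DIM('a) - 1))"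
    using surf_ball_bound by metis
  obtain \<rho> where \<rho>: "\<rho> > 0" "frontier \<Omega> \<subseteq> cball 0 \<rho>"
    using compact_imp_bounded[OF compact_frontier_dom] bounded_subset_ballD[of "frontier \<Omega>" 0] ball_subset_cball by blast
  then have "frontier \<Omega> \<inter> cball 0 \<rho> = frontier \<Omega>" by auto
  then show "emeasure (surf \<Omega>) (space (surf \<Omega>)) \<noteq> \<infinity>"
    using C(2)[OF \<rho>(1), of 0] by (auto simp: top_unique)
qed

text \<open>The segment between two boundary points may leave the closed domain. Close pairs share a
  chart, by a Lebesgue number, and are joined by its three-piece path; for distant pairs the bound
  of \<open>u\<close> suffices.\<close>

lemma P1_lipschitz_frontier:
  assumes u: "u \<in> P1 \<Omega> \<T>"
  obtains C where "C \<ge> 0" "\<And>x y. x \<in> frontier \<Omega> \<Longrightarrow> y \<in> frontier \<Omega> \<Longrightarrow> \<bar>u x - u y\<bar> \<le> C * norm (x - y)"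
proof -
  obtain Z r e K where Z: "finite Z" "frontier \<Omega> \<subseteq> (\<Union>z\<in>Z. ball z (r z))"
    and chart: "\<And>z. z \<in> Z \<Longrightarrow> frontier_chart \<Omega> z (r z) (e z) (K z)"
    using frontier_charts by blast
  have K: "K z \<ge> 0" if "z \<in> Z" for z
    using chart[OF that] by (auto simp: frontier_chart_def)
  obtain L where L: "L \<ge> 0" "\<And>x y. closed_segment x y \<subseteq> closure \<Omega> \<Longrightarrow> \<bar>u x - u y\<bar> \<le> L * norm (x - y)"
    using P1_lipschitz_segment[OF u] by metis
  obtain B where B: "B \<ge> 0" "\<And>x. \<bar>u x\<bar> \<le> B" using P1_bounded[OF u] by metis
  define K' where "K' = (\<Sum>z\<in>Z. K z)"
  have K': "K z \<le> K'" if "z \<in> Z" for z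
    unfolding K'_def using that Z(1) K by (intro member_le_sum) auto
  have K'0: "K' \<ge> 0" unfolding K'_def using K by (rule sum_nonneg)
  obtain \<delta> where \<delta>: "\<delta> > 0" "\<And>x y. x \<in> frontier \<Omega> \<Longrightarrow> y \<in> frontier \<Omega> \<Longrightarrow> norm (x - y) < \<delta> \<Longrightarrow> \<exists>z\<in>Z. {x, y} \<subseteq> ball z (r z)"
  proof (cases "Z = {}")
    case True
    then show thesis using that[of 1] Z(2) by auto
  next
    case False
    then have "(\<lambda>z. ball z (r z)) ` Z \<noteq> {}" by blast
    then obtain \<delta> where \<delta>: "0 < \<delta>" "\<And>T. \<lbrakk>T \<subseteq> frontier \<Omega>; diameter T < \<delta>\<rbrakk> \<Longrightarrow> \<exists>B \<in> (\<lambda>z. ball z (r z)) ` Z. T \<subseteq> B"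
      by (rule Lebesgue_number_lemma[OF compact_frontier_dom _ Z(2)]) auto
    have diam: "diameter {x, y} = norm (x - y)" for x y :: 'a
      by (rule antisym)
        (auto intro!: diameter_le diameter_bounded_bound[of "{x, y}" x y, unfolded dist_norm] simp: norm_minus_commute)
    show thesis
    proof (rule that[OF \<delta>(1)])
      fix x y assume "x \<in> frontier \<Omega>" "y \<in> frontier \<Omega>" "norm (x - y) < \<delta>"
      then show "\<exists>z\<in>Z. {x, y} \<subseteq> ball z (r z)" using \<delta>(2)[of "{x, y}"] diam[of x y] by auto
    qed
  qed
  \<comment> \<open>Three path pieces of length at most \<open>K' * norm (x - y)\<close>, or an
    oscillation 2 B over a distance of at least \<delta>.\<close>
  define C where "C = max (3 * L * K') (2 * B / \<delta>)"
  show thesis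
  proof
    show "C \<ge> 0" using L(1) K'0 by (simp add: C_def le_max_iff_disj)
    fix x y assume xy: "x \<in> frontier \<Omega>" "y \<in> frontier \<Omega>"
    show "\<bar>u x - u y\<bar> \<le> C * norm (x - y)"
    proof (cases "norm (x - y) < \<delta>")
      case True
      then obtain z where z: "z \<in> Z" "{x, y} \<subseteq> ball z (r z)" using \<delta>(2)[OF xy] by blast
      then obtain a b where ab: "norm (x - a) \<le> K z * norm (x - y)" "norm (a - b) \<le> K z * norm (x - y)" "norm (b - y) \<le> K z * norm (x - y)"
        "closed_segment x a \<subseteq> closure \<Omega>" "closed_segment a b \<subseteq> closure \<Omega>" "closed_segment b y \<subseteq> closure \<Omega>"
        using chart[OF z(1)] z(2) xy unfolding frontier_chart_def by blast
      have "K z * norm (x - y) \<le> K' * norm (x - y)" using K'[OF z(1)] by (intro mult_right_mono) auto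
      then have "L * norm (x - a) \<le> L * (K' * norm (x - y))" "L * norm (a - b) \<le> L * (K' * norm (x - y))"
        "L * norm (b - y) \<le> L * (K' * norm (x - y))"
        using ab(1-3) L(1) by (auto intro!: mult_left_mono)
      then have "\<bar>u x - u y\<bar> \<le> 3 * L * K' * norm (x - y)"
        using L(2)[OF ab(4)] L(2)[OF ab(5)] L(2)[OF ab(6)] by linarith
      also have "\<dots> \<le> C * norm (x - y)" unfolding C_def by (intro mult_right_mono) auto
      finally show ?thesis .
    next
      case False
      have "\<bar>u x - u y\<bar> \<le> 2 * B" using B(2)[of x] B(2)[of y] by linarith
      also have "2 * B = 2 * B / \<delta> * \<delta>" using \<delta>(1) by simp
      also have "\<dots> \<le> 2 * B / \<delta> * norm (x - y)" using False B(1) \<delta>(1) by (intro mult_left_mono) auto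
      also have "\<dots> \<le> C * norm (x - y)" unfolding C_def by (intro mult_right_mono) auto
      finally show ?thesis .
    qed
  qed
qed

end

section \<open>Finite element functions as test functions\<close>

lemma Linf_AE_norm:
  assumes "u \<in> Linf M"
  shows "AE x in M. \<bar>u x\<bar> \<le> Linf_norm M u"
proof -
  obtain C where C: "AE x in M. \<bar>u x\<bar> \<le> C" and [measurable]: "u \<in> borel_measurable M"
    using assms by (auto simp: Linf_def)
  have "AE x in M. ennreal \<bar>u x\<bar> \<le> ennreal C"
    using C by (auto elim!: eventually_mono intro: ennreal_leI)
  then have "esssup M (\<lambda>x. ennreal \<bar>u x\<bar>) \<le> ennreal C" by (intro esssup_I) auto
  \<comment> \<open>\<open>enn2real\<close> maps infinity to 0, so the essential supremum must be
    finite before it is converted.\<close>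
  then have fin: "esssup M (\<lambda>x. ennreal \<bar>u x\<bar>) < top" using ennreal_less_top[of C] by (simp add: le_less_trans)
  have "AE x in M. ennreal \<bar>u x\<bar> \<le> esssup M (\<lambda>x. ennreal \<bar>u x\<bar>)" by (rule esssup_AE)
  then show ?thesis
  proof (rule eventually_mono)
    fix x assume "ennreal \<bar>u x\<bar> \<le> esssup M (\<lambda>x. ennreal \<bar>u x\<bar>)"
    then have "enn2real (ennreal \<bar>u x\<bar>) \<le> Linf_norm M u"
      unfolding Linf_norm_def using fin by (intro enn2real_mono)
    then show "\<bar>u x\<bar> \<le> Linf_norm M u" by simp
  qed
qed

lemma Linf_norm_nonneg: "Linf_norm M u \<ge> 0"
  by (simp add: Linf_norm_def)

lemma LinfI: "u \<in> borel_measurable M \<Longrightarrow> AE x in M. \<bar>u x\<bar> \<le> C \<Longrightarrow> u \<in> Linf M"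
  by (auto simp: Linf_def)

lemma Linf_linear_combination:
  assumes "u \<in> Linf M" "v \<in> Linf M"
  shows "(\<lambda>x. c * u x + d * v x) \<in> Linf M"
proof -
  obtain A B where A: "AE x in M. \<bar>u x\<bar> \<le> A" and B: "AE x in M. \<bar>v x\<bar> \<le> B"
    using assms by (auto simp: Linf_def)
  have "AE x in M. \<bar>c * u x + d * v x\<bar> \<le> \<bar>c\<bar> * A + \<bar>d\<bar> * B"
    using A B
  proof eventually_elim
    case (elim x)
    have "\<bar>c * u x + d * v x\<bar> \<le> \<bar>c\<bar> * \<bar>u x\<bar> + \<bar>d\<bar> * \<bar>v x\<bar>"
      by (metis abs_mult abs_triangle_ineq)
    also have "\<dots> \<le> \<bar>c\<bar> * A + \<bar>d\<bar> * B" using elim by (intro add_mono mult_left_mono) auto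
    finally show ?case .
  qed
  moreover have "(\<lambda>x. c * u x + d * v x) \<in> borel_measurable M" using assms by (auto simp: Linf_def)
  ultimately show ?thesis by (intro LinfI)
qed

lemma Linf_add: "u \<in> Linf M \<Longrightarrow> v \<in> Linf M \<Longrightarrow> (\<lambda>x. u x + v x) \<in> Linf M"
  using Linf_linear_combination[of u M v 1 1] by simp

lemma Linf_mult:
  assumes "u \<in> Linf M" "v \<in> Linf M"
  shows "(\<lambda>x. u x * v x) \<in> Linf M"
proof -
  obtain A B where A: "AE x in M. \<bar>u x\<bar> \<le> A" and B: "AE x in M. \<bar>v x\<bar> \<le> B"
    using assms by (auto simp: Linf_def)
  have "AE x in M. \<bar>u x * v x\<bar> \<le> \<bar>A\<bar> * \<bar>B\<bar>"
    using A B by eventually_elim (auto simp: abs_mult intro!: mult_mono)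
  moreover have "(\<lambda>x. u x * v x) \<in> borel_measurable M" using assms by (auto simp: Linf_def)
  ultimately show ?thesis by (intro LinfI)
qed

lemma Linf_integrable: "finite_measure M \<Longrightarrow> u \<in> Linf M \<Longrightarrow> integrable M u"
  using finite_measure.integrable_const_bound[of M u] by (auto simp: Linf_def)

lemma borel_measurable_surf:
  fixes f :: "'a::euclidean_space \<Rightarrow> real"
  assumes "f \<in> borel_measurable borel"
  shows "f \<in> borel_measurable (surf \<Omega>)"
proof -
  have "f \<in> borel_measurable (hausdorff_measure (DIM('a) - 1) :: 'a measure)"
    using assms by (subst measurable_cong_sets[OF sets_hausdorff_measure refl])
  then show ?thesis
    unfolding surf_def by (intro measurable_completion measurable_restrict_space1)
qed

text \<open>\<open>dual\<close> states additivity and homogeneity separately, so the scaled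
  functions must themselves lie in \<open>V\<close>.\<close>

lemma dual_linear_combination:
  assumes "F \<in> dual V nrm" "u \<in> V" "v \<in> V" "(\<lambda>x. c * u x) \<in> V" "(\<lambda>x. d * v x) \<in> V"
  shows "F (\<lambda>x. c * u x + d * v x) = c * F u + d * F v"
  using assms by (simp add: dual_def)

text \<open>A space of functions that is separated by finitely many point evaluations is finite-dimensional;
  the induction on these points replaces the one on the dimension.\<close>

lemma riesz_finitely_separated:
  fixes V :: "('a \<Rightarrow> real) set" and B :: "('a \<Rightarrow> real) \<Rightarrow> ('a \<Rightarrow> real) \<Rightarrow> real"
  assumes "finite X"
    and "(\<lambda>x. 0) \<in> V"
    and "\<And>u v c d. u \<in> V \<Longrightarrow> v \<in> V \<Longrightarrow> (\<lambda>x. c * u x + d * v x) \<in> V"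
    and "\<And>u. u \<in> V \<Longrightarrow> (\<And>x. x \<in> X \<Longrightarrow> u x = 0) \<Longrightarrow> u = (\<lambda>x. 0)"
    and "\<And>u v w c d. u \<in> V \<Longrightarrow> v \<in> V \<Longrightarrow> w \<in> V \<Longrightarrow> B (\<lambda>x. c * u x + d * v x) w = c * B u w + d * B v w"
    and "\<And>u v. u \<in> V \<Longrightarrow> v \<in> V \<Longrightarrow> B u v = B v u"
    and "\<And>u. u \<in> V \<Longrightarrow> u \<noteq> (\<lambda>x. 0) \<Longrightarrow> B u u > 0"
    and "\<And>u v c d. u \<in> V \<Longrightarrow> v \<in> V \<Longrightarrow> F (\<lambda>x. c * u x + d * v x) = c * F u + d * F v"
  shows "\<exists>u\<in>V. \<forall>\<phi>\<in>V. B u \<phi> = F \<phi>"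
  using assms
proof (induction X arbitrary: V F rule: finite_induct)
  case empty
  have V: "v = (\<lambda>x. 0)" if "v \<in> V" for v using empty.prems(3)[OF that] by auto
  have "B (\<lambda>x. 0) (\<lambda>x. 0) = 0"
    using empty.prems(4)[of "\<lambda>x. 0" "\<lambda>x. 0" "\<lambda>x. 0" 0 0] empty.prems(1) by simp
  moreover have "F (\<lambda>x. 0) = 0"
    using empty.prems(7)[of "\<lambda>x. 0" "\<lambda>x. 0" 0 0] empty.prems(1) by simp
  ultimately have "B (\<lambda>x. 0) \<phi> = F \<phi>" if "\<phi> \<in> V" for \<phi>
    unfolding V[OF that] by simp
  then show ?case using empty.prems(1) by blast
next
  case (insert x X)
  note sub = insert.prems(2) and bil = insert.prems(4) and sym = insert.prems(5)
    and pos = insert.prems(6) and lin = insert.prems(7)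
  \<comment> \<open>Dropping the point \<open>x\<close> costs at most one dimension.\<close>
  define V' where "V' = {u \<in> V. u x = 0}"
  have IH: "\<exists>u\<in>V'. \<forall>\<phi>\<in>V'. B u \<phi> = G \<phi>"
    if G: "\<And>u v c d. u \<in> V \<Longrightarrow> v \<in> V \<Longrightarrow> G (\<lambda>x. c * u x + d * v x) = c * G u + d * G v" for G
  proof (rule insert.IH)
    have VV: "v \<in> V" if "v \<in> V'" for v using that by (simp add: V'_def)
    show "(\<lambda>x. 0) \<in> V'" using insert.prems(1) by (simp add: V'_def)
    show "(\<lambda>x. c * u x + d * v x) \<in> V'" if "u \<in> V'" "v \<in> V'" for u v c d
      using that sub[of u v c d] by (simp add: V'_def)
    show "u = (\<lambda>x. 0)" if "u \<in> V'" "\<And>y. y \<in> X \<Longrightarrow> u y = 0" for u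
      using that by (intro insert.prems(3)) (auto simp: V'_def)
    show "B (\<lambda>x. c * u x + d * v x) w = c * B u w + d * B v w" if "u \<in> V'" "v \<in> V'" "w \<in> V'" for u v w c d
      using that by (intro bil VV)
    show "B u v = B v u" if "u \<in> V'" "v \<in> V'" for u v
      using that by (intro sym VV)
    show "B u u > 0" if "u \<in> V'" "u \<noteq> (\<lambda>x. 0)" for u
      using that by (intro pos VV)
    show "G (\<lambda>x. c * u x + d * v x) = c * G u + d * G v" if "u \<in> V'" "v \<in> V'" for u v c d
      using that by (intro G VV)
  qed
  show ?case
  proof (cases "V' = V")
    case True
    have "\<exists>u\<in>V'. \<forall>\<phi>\<in>V'. B u \<phi> = F \<phi>" by (rule IH) (rule lin)
    then show ?thesis unfolding True .
  next
    case False
    then obtain b where b: "b \<in> V" "b x \<noteq> 0" by (auto simp: V'_def)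
    \<comment> \<open>The induction hypothesis with the load \<open>B b\<close> gives the orthogonal
      projection \<open>p\<close> of \<open>b\<close> onto \<open>V'\<close>;
      \<open>b' = b - p\<close> then spans the complement.\<close>
    have "\<exists>u\<in>V'. \<forall>\<phi>\<in>V'. B u \<phi> = B b \<phi>"
    proof (rule IH)
      fix u v c d assume uv: "u \<in> V" "v \<in> V"
      then show "B b (\<lambda>x. c * u x + d * v x) = c * B b u + d * B b v"
        using sym[OF b(1), of "\<lambda>x. c * u x + d * v x"] sub bil[OF uv b(1)] sym[OF b(1)] by simp
    qed
    then obtain p where p: "p \<in> V'" "\<And>\<phi>. \<phi> \<in> V' \<Longrightarrow> B p \<phi> = B b \<phi>" by blast
    obtain u0 where u0: "u0 \<in> V'" "\<And>\<phi>. \<phi> \<in> V' \<Longrightarrow> B u0 \<phi> = F \<phi>" using IH[of F] lin by blast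
    have VV: "v \<in> V" if "v \<in> V'" for v using that by (simp add: V'_def)
    define b' where "b' = (\<lambda>x. 1 * b x + - 1 * p x)"
    have b': "b' \<in> V" unfolding b'_def using b p VV by (intro sub) auto
    have "b' x \<noteq> 0" using b p by (simp add: b'_def V'_def)
    then have pos': "B b' b' > 0" using b' by (intro pos) auto
    have orth: "B b' \<phi> = 0" if "\<phi> \<in> V'" for \<phi>
      unfolding b'_def using bil[of b p \<phi> 1 "- 1"] b p VV that by simp
    \<comment> \<open>Forced by testing with \<open>b'\<close>, which is orthogonal to
      \<open>u0\<close>.\<close>
    define k where "k = F b' / B b' b'"
    define u where "u = (\<lambda>x. 1 * u0 x + k * b' x)"
    have u: "u \<in> V" unfolding u_def using u0 VV b' by (intro sub) auto
    have Bu: "B u \<phi> = B u0 \<phi> + k * B b' \<phi>" if "\<phi> \<in> V" for \<phi>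
      unfolding u_def using bil[of u0 b' \<phi> 1 k] u0 VV b' that by simp
    have "B u \<phi> = F \<phi>" if \<phi>: "\<phi> \<in> V" for \<phi>
    proof -
      \<comment> \<open>Chosen so that \<open>\<phi> - t b'\<close> vanishes at \<open>x\<close> and
        hence lies in \<open>V'\<close>.\<close>
      define t where "t = \<phi> x / b' x"
      define \<psi> where "\<psi> = (\<lambda>x. 1 * \<phi> x + - t * b' x)"
      have "\<psi> \<in> V" unfolding \<psi>_def using \<phi> b' by (intro sub)
      moreover have "\<psi> x = 0" using \<open>b' x \<noteq> 0\<close> by (simp add: \<psi>_def t_def)
      ultimately have \<psi>: "\<psi> \<in> V'" by (simp add: V'_def)
      have \<phi>_eq: "\<phi> = (\<lambda>x. 1 * \<psi> x + t * b' x)" by (simp add: \<psi>_def)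
      have "B u \<phi> = B \<phi> u" using sym u \<phi> by simp
      also have "\<dots> = B \<psi> u + t * B b' u"
        by (subst \<phi>_eq) (use bil[of \<psi> b' u 1 t] \<open>\<psi> \<in> V\<close> b' u in simp)
      also have "\<dots> = B u \<psi> + t * B u b'" using sym u \<open>\<psi> \<in> V\<close> b' by simp
      also have "B u \<psi> = F \<psi>" using Bu[OF \<open>\<psi> \<in> V\<close>] orth[OF \<psi>] u0(2)[OF \<psi>] by simp
      also have "B u b' = F b'"
        using Bu[OF b'] orth[OF u0(1)] sym[OF b' VV[OF u0(1)]] pos' by (simp add: k_def)
      also have "F \<psi> + t * F b' = F (\<lambda>x. 1 * \<psi> x + t * b' x)"
        using lin[of \<psi> b' 1 t] \<open>\<psi> \<in> V\<close> b' by simp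
      also have "\<dots> = F \<phi>" by (rule arg_cong[OF \<phi>_eq[symmetric]])
      finally show ?thesis .
    qed
    then show ?thesis using u by blast
  qed
qed

section \<open>Finite element functions in \<open>H1\<close> and their weak gradients\<close>

context mesh
begin

text \<open>An affine function that vanishes at the vertices of a simplex vanishes on their convex
  hull. These points feed \<open>riesz_finitely_separated\<close>.\<close>

lemma mesh_nodes:
  obtains X where "finite X" "\<And>u. u \<in> P1 \<Omega> \<T> \<Longrightarrow> (\<And>x. x \<in> X \<Longrightarrow> u x = 0) \<Longrightarrow> u = (\<lambda>x. 0)"
proof -
  have "\<exists>C. finite C \<and> T = convex hull C" if "T \<in> \<T>" for T
    using simplices[OF that] by (auto simp: simplex)
  then obtain C where C: "\<And>T. T \<in> \<T> \<Longrightarrow> finite (C T) \<and> T = convex hull (C T)" by metis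
  show thesis
  proof
    show "finite (\<Union>T\<in>\<T>. C T)" using C finite_mesh by auto
    fix u assume u: "u \<in> P1 \<Omega> \<T>" and zero: "\<And>x. x \<in> (\<Union>T\<in>\<T>. C T) \<Longrightarrow> u x = 0"
    have "u x = 0" for x
    proof (cases "x \<in> closure \<Omega>")
      case True
      then obtain T where T: "T \<in> \<T>" "x \<in> T" using Union_mesh by blast
      then obtain a b where ab: "\<And>y. y \<in> T \<Longrightarrow> u y = a \<bullet> y + b" using u unfolding P1_def by blast
      have hull: "T = convex hull (C T)" using C T by blast
      have "C T \<subseteq> {y. a \<bullet> y = - b}"
      proof
        fix y assume y: "y \<in> C T"
        then have "y \<in> T" using hull hull_inc by metis
        then have "a \<bullet> y + b = 0" using ab[of y] zero[of y] y T by auto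
        then show "y \<in> {y. a \<bullet> y = - b}" by simp
      qed
      then have "T \<subseteq> {y. a \<bullet> y = - b}"
        using hull hull_minimal[of "C T" _ convex] convex_hyperplane by metis
      then show ?thesis using ab T by auto
    qed (use P1_outside[OF u] in auto)
    then show "u = (\<lambda>x. 0)" by auto
  qed
qed

lemma zero_in_P1: "(\<lambda>x. 0) \<in> P1 \<Omega> \<T>"
  by (auto simp: P1_def intro!: exI[of _ 0])

lemma dom_sets [simp]: "\<Omega> \<in> sets lebesgue"
  using open_dom by auto

lemma finite_measure_dom: "finite_measure (lebesgue_on \<Omega>)"
  using bounded_dom open_dom by (intro finite_measure_lebesgue_on lmeasurable_open)

lemma borel_measurable_dom:
  fixes f :: "'a \<Rightarrow> 'b::euclidean_space"
  shows "f \<in> borel_measurable borel \<Longrightarrow> f \<in> borel_measurable (lebesgue_on \<Omega>)"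
  by (intro measurable_restrict_space1 measurable_completion) simp

lemma P1_Linf: "u \<in> P1 \<Omega> \<T> \<Longrightarrow> u \<in> Linf (lebesgue_on \<Omega>)"
  by (rule P1_bounded) (auto intro: LinfI borel_measurable_dom P1_borel)

lemma P1_Linf_surf: "u \<in> P1 \<Omega> \<T> \<Longrightarrow> u \<in> Linf (surf \<Omega>)"
  by (rule P1_bounded) (auto intro: LinfI borel_measurable_surf P1_borel)

lemma P1_has_weak_gradient:
  assumes u: "u \<in> P1 \<Omega> \<T>"
  shows "has_weak_gradient \<Omega> u (P1_grad u)"
  unfolding has_weak_gradient_def
proof (intro conjI allI impI ballI P1_integration_by_parts[OF u])
  fix K assume "compact K \<and> K \<subseteq> \<Omega>"
  then interpret K: finite_measure "lebesgue_on K"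
    by (intro finite_measure_lebesgue_on lmeasurable_compact) auto
  have m: "f \<in> borel_measurable (lebesgue_on K)" if "f \<in> borel_measurable borel" for f :: "'a \<Rightarrow> 'b::euclidean_space"
    using that by (intro measurable_restrict_space1 measurable_completion) simp
  obtain C where C: "\<And>x. \<bar>u x\<bar> \<le> C" using P1_bounded[OF u] by metis
  obtain C' where C': "\<And>x. norm (P1_grad u x) \<le> C'" using P1_grad_bounded[OF u] by metis
  show "integrable (lebesgue_on K) u"
    using C by (intro K.integrable_const_bound[where B = C] m P1_borel u) auto
  show "integrable (lebesgue_on K) (P1_grad u)"
    using C' by (intro K.integrable_const_bound[where B = C'] m P1_grad_borel u) auto
qed

lemma P1_H1:
  assumes u: "u \<in> P1 \<Omega> \<T>"
  shows "u \<in> H1 \<Omega>"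
proof -
  obtain C where C: "\<And>x. \<bar>u x\<bar> \<le> C" using P1_bounded[OF u] by metis
  obtain C' where C': "\<And>x. norm (P1_grad u x) \<le> C'" using P1_grad_bounded[OF u] by metis
  interpret finite_measure "lebesgue_on \<Omega>" by (rule finite_measure_dom)
  have m[measurable]: "u \<in> borel_measurable (lebesgue_on \<Omega>)" "P1_grad u \<in> borel_measurable (lebesgue_on \<Omega>)"
    using u by (auto intro: borel_measurable_dom P1_borel P1_grad_borel)
  have "(u x)\<^sup>2 \<le> C\<^sup>2" for x using power_mono[OF C abs_ge_zero, of x 2] by simp
  then have "integrable (lebesgue_on \<Omega>) (\<lambda>x. (norm (u x))\<^sup>2)"
    by (intro integrable_const_bound[where B = "C\<^sup>2"]) auto
  moreover have "(norm (P1_grad u x))\<^sup>2 \<le> C'\<^sup>2" for x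
    by (rule power_mono[OF C' norm_ge_zero])
  then have "integrable (lebesgue_on \<Omega>) (\<lambda>x. (norm (P1_grad u x))\<^sup>2)"
    by (intro integrable_const_bound[where B = "C'\<^sup>2"]) auto
  ultimately have "u \<in> L2 (lebesgue_on \<Omega>)" "P1_grad u \<in> L2 (lebesgue_on \<Omega>)"
    by (simp_all add: L2_def m)
  then show ?thesis
    using P1_has_weak_gradient[OF u] unfolding H1_def by blast
qed

lemma weak_grad_P1:
  assumes u: "u \<in> P1 \<Omega> \<T>"
  shows "AE x in lebesgue_on \<Omega>. weak_grad \<Omega> u x = P1_grad u x"
proof (rule has_weak_gradient_unique[OF open_dom _ P1_has_weak_gradient[OF u]])
  show "has_weak_gradient \<Omega> u (weak_grad \<Omega> u)"
    unfolding weak_grad_def using P1_has_weak_gradient[OF u] by (rule someI[of "has_weak_gradient \<Omega> u"])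
qed

text \<open>Measurability is inherited from \<open>P1_grad\<close> through equality almost
  everywhere, because Lebesgue measure is complete; the extension by zero discards the values off
  \<Omega>.\<close>

lemma weak_grad_P1_measurable:
  assumes u: "u \<in> P1 \<Omega> \<T>"
  shows "weak_grad \<Omega> u \<in> borel_measurable (lebesgue_on \<Omega>)"
proof -
  have "(\<lambda>x. if x \<in> \<Omega> then P1_grad u x else 0) \<in> borel_measurable lebesgue"
    using borel_measurable_dom[OF P1_grad_borel[OF u]] by (simp add: borel_measurable_if)
  moreover have "AE x in lebesgue. x \<in> \<Omega> \<longrightarrow> weak_grad \<Omega> u x = P1_grad u x"
    using weak_grad_P1[OF u] by (simp add: AE_restrict_space_iff)
  then have "AE x in lebesgue. (if x \<in> \<Omega> then P1_grad u x else 0) = (if x \<in> \<Omega> then weak_grad \<Omega> u x else 0)"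
    by (rule eventually_mono) auto
  ultimately have "(\<lambda>x. if x \<in> \<Omega> then weak_grad \<Omega> u x else 0) \<in> borel_measurable lebesgue"
    by (rule borel_measurable_AE)
  then show ?thesis by (simp add: borel_measurable_if)
qed

lemma weak_grad_inner_Linf:
  assumes u: "u \<in> P1 \<Omega> \<T>" and v: "v \<in> P1 \<Omega> \<T>"
  shows "(\<lambda>x. weak_grad \<Omega> u x \<bullet> weak_grad \<Omega> v x) \<in> Linf (lebesgue_on \<Omega>)"
proof -
  obtain C where C: "\<And>x. norm (P1_grad u x) \<le> C" using P1_grad_bounded[OF u] by metis
  obtain D where D: "\<And>x. norm (P1_grad v x) \<le> D" using P1_grad_bounded[OF v] by metis
  have "AE x in lebesgue_on \<Omega>. \<bar>weak_grad \<Omega> u x \<bullet> weak_grad \<Omega> v x\<bar> \<le> C * D"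
    using weak_grad_P1[OF u] weak_grad_P1[OF v]
  proof eventually_elim
    case (elim x)
    have "\<bar>P1_grad u x \<bullet> P1_grad v x\<bar> \<le> norm (P1_grad u x) * norm (P1_grad v x)"
      by (rule Cauchy_Schwarz_ineq2)
    also have "\<dots> \<le> C * D" using C[of x] D[of x] by (intro mult_mono) (auto intro: order.trans[OF norm_ge_zero])
    finally show ?case using elim by simp
  qed
  then show ?thesis using weak_grad_P1_measurable u v by (intro LinfI) auto
qed

lemma P1_grad_linear_combination:
  assumes u: "u \<in> P1 \<Omega> \<T>" and v: "v \<in> P1 \<Omega> \<T>"
  shows "P1_grad (\<lambda>x. c * u x + d * v x) x = c *\<^sub>R P1_grad u x + d *\<^sub>R P1_grad v x"
proof (cases "x \<in> mesh_interior")
  case True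
  then obtain T where T: "T \<in> \<T>" "x \<in> interior T" by (auto simp: mesh_interior_def)
  obtain a b where 1: "\<And>x. x \<in> T \<Longrightarrow> u x = a \<bullet> x + b" using u T unfolding P1_def by blast
  obtain a' b' where 2: "\<And>x. x \<in> T \<Longrightarrow> v x = a' \<bullet> x + b'" using v T unfolding P1_def by blast
  have "c * u x + d * v x = (c *\<^sub>R a + d *\<^sub>R a') \<bullet> x + (c * b + d * b')" if "x \<in> T" for x
    using 1 2 that by (simp add: algebra_simps inner_add_left)
  from P1_grad_eq[OF T(1) this T(2)] P1_grad_eq[OF T(1) 1 T(2)] P1_grad_eq[OF T(1) 2 T(2)]
  show ?thesis by simp
qed (simp add: P1_grad_def)

lemma weak_grad_linear_combination:
  assumes u: "u \<in> P1 \<Omega> \<T>" and v: "v \<in> P1 \<Omega> \<T>"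
  shows "AE x in lebesgue_on \<Omega>. weak_grad \<Omega> (\<lambda>x. c * u x + d * v x) x = c *\<^sub>R weak_grad \<Omega> u x + d *\<^sub>R weak_grad \<Omega> v x"
  using weak_grad_P1[OF u] weak_grad_P1[OF v] weak_grad_P1[OF P1_linear_combination[OF u v, of c d]]
  by eventually_elim (simp add: P1_grad_linear_combination[OF u v])

end

section \<open>Traces of finite element functions in \<open>H12\<close>\<close>

context lipschitz_mesh
begin

text \<open>On the shell between the radii \<open>\<rho> k / 2\<close> and \<open>\<rho> k\<close>
  the integrand is at most \<open>c k\<close>, of order \<rho>^(2 - d), and the ball has surface
  measure of order \<rho>^(d - 1), so the contributions decay geometrically. Uniformity in
  \<open>x\<close> serves the outer integral.\<close>

lemma P1_gagliardo_bound:
  assumes u: "u \<in> P1 \<Omega> \<T>"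
  obtains B where "\<And>x. x \<in> frontier \<Omega> \<Longrightarrow>
    (\<integral>\<^sup>+y. ennreal ((u x - u y)\<^sup>2 / norm (x - y) ^ DIM('a)) \<partial>surf \<Omega>) \<le> ennreal B"
proof -
  obtain C where C: "C \<ge> 0" "\<And>x y. x \<in> frontier \<Omega> \<Longrightarrow> y \<in> frontier \<Omega> \<Longrightarrow> \<bar>u x - u y\<bar> \<le> C * norm (x - y)"
    using P1_lipschitz_frontier[OF u] by metis
  obtain A where A: "A \<ge> 0" "\<And>x \<rho>. \<rho> > 0 \<Longrightarrow> emeasure (surf \<Omega>) (frontier \<Omega> \<inter> cball x \<rho>) \<le> ennreal (A * \<rho> ^ (DIM('a) - 1))"
    using surf_ball_bound by metis
  obtain R0 where R0: "R0 > 0" "frontier \<Omega> \<subseteq> ball 0 R0"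
    using compact_imp_bounded[OF compact_frontier_dom] bounded_subset_ballD[of "frontier \<Omega>" 0] by blast
  \<comment> \<open>Larger than every distance on the boundary, so that the least \<open>k\<close>
    with \<open>\<rho> k < n\<close> is not 0.\<close>
  define R where "R = 2 * R0"
  have R: "R > 0" "\<And>x y. x \<in> frontier \<Omega> \<Longrightarrow> y \<in> frontier \<Omega> \<Longrightarrow> norm (x - y) < R"
  proof -
    show "R > 0" using R0 by (simp add: R_def)
    fix x y assume "x \<in> frontier \<Omega>" "y \<in> frontier \<Omega>"
    then have "norm x < R0" "norm y < R0" using R0 by auto
    then show "norm (x - y) < R" using norm_triangle_ineq4[of x y] by (simp add: R_def)
  qed
  define \<rho> where "\<rho> k = R * (1/2) ^ k" for k :: nat
  have \<rho>: "\<rho> k > 0" for k using R by (simp add: \<rho>_def)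
  let ?d = "DIM('a)"
  \<comment> \<open>The numerator is estimated at the outer radius, the denominator at the inner
    radius \<open>\<rho> k / 2\<close>; hence the factor 2^d.\<close>
  define c where "c k = C\<^sup>2 * 2 ^ ?d * (\<rho> k)\<^sup>2 / \<rho> k ^ ?d" for k
  have c: "c k \<ge> 0" for k using \<rho>[of k] by (simp add: c_def)
  show thesis
  proof
    fix x assume x: "x \<in> frontier \<Omega>"
    let ?A = "\<lambda>k. frontier \<Omega> \<inter> cball x (\<rho> k)"
    have meas: "?A k \<in> sets (surf \<Omega>)" for k by (intro sets_surfI) auto
    have le: "ennreal ((u x - u y)\<^sup>2 / norm (x - y) ^ ?d) \<le> (\<Sum>k. ennreal (c k) * indicator (?A k) y)"
      if y: "y \<in> space (surf \<Omega>)" for y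
    proof (cases "x = y")
      case False
      have yf: "y \<in> frontier \<Omega>" using y by simp
      define n where "n = norm (x - y)"
      have n: "n > 0" "n < R" using False R(2)[OF x yf] by (auto simp: n_def)
      have "(\<lambda>k. R * (1/2) ^ k) \<longlonglongrightarrow> R * 0" by (intro tendsto_intros) (auto intro: LIMSEQ_realpow_zero)
      then have "\<rho> \<longlonglongrightarrow> 0" by (simp add: \<rho>_def[abs_def])
      then have ex: "\<exists>k. \<rho> k < n"
        using order_tendstoD(2)[of \<rho> 0 sequentially n] n by (auto simp: eventually_sequentially)
      define m where "m = (LEAST k. \<rho> k < n)"
      have m: "\<rho> m < n" unfolding m_def using ex by (rule LeastI_ex)
      have "m \<noteq> 0" using m n by (auto simp: \<rho>_def intro: ccontr)
      then obtain k where k: "m = Suc k" using not0_implies_Suc by blast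
      have "\<not> \<rho> k < n" using not_less_Least[of k "\<lambda>k. \<rho> k < n"] k by (simp add: m_def[symmetric])
      then have nk: "n \<le> \<rho> k" by simp
      have half: "\<rho> k / 2 < n" using m k by (simp add: \<rho>_def)
      have "(u x - u y)\<^sup>2 \<le> (C * n)\<^sup>2"
        using C(2)[OF x yf] by (simp add: n_def abs_le_square_iff[symmetric] C(1))
      also have "\<dots> \<le> (C * \<rho> k)\<^sup>2"
        using C(1) n(1) nk by (intro power_mono mult_left_mono) auto
      finally have "(u x - u y)\<^sup>2 / n ^ ?d \<le> (C * \<rho> k)\<^sup>2 / (\<rho> k / 2) ^ ?d"
        using half \<rho>[of k] by (intro frac_le) (auto intro: power_mono)
      also have "\<dots> = c k" by (simp add: c_def power_divide power_mult_distrib)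
      finally have "ennreal ((u x - u y)\<^sup>2 / n ^ ?d) \<le> ennreal (c k)" by (rule ennreal_leI)
      also have "\<dots> = ennreal (c k) * indicator (?A k) y"
        using yf nk by (simp add: dist_norm n_def)
      also have "\<dots> \<le> (\<Sum>k. ennreal (c k) * indicator (?A k) y)"
      proof -
        have "g k \<le> suminf g" for g :: "nat \<Rightarrow> ennreal"
          using sum_le_suminf[of g "{k}"] by simp
        then show ?thesis .
      qed
      finally show ?thesis by (simp add: n_def)
    qed simp
    have "(\<integral>\<^sup>+y. ennreal ((u x - u y)\<^sup>2 / norm (x - y) ^ ?d) \<partial>surf \<Omega>)
        \<le> (\<integral>\<^sup>+y. (\<Sum>k. ennreal (c k) * indicator (?A k) y) \<partial>surf \<Omega>)"
      using le by (rule nn_integral_mono)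
    also have "\<dots> = (\<Sum>k. \<integral>\<^sup>+y. ennreal (c k) * indicator (?A k) y \<partial>surf \<Omega>)"
      using meas by (intro nn_integral_suminf) auto
    also have "\<dots> = (\<Sum>k. ennreal (c k) * emeasure (surf \<Omega>) (?A k))"
      using meas by (simp add: nn_integral_cmult_indicator)
    also have "\<dots> \<le> (\<Sum>k. ennreal (C\<^sup>2 * 2 ^ ?d * A * \<rho> k))"
    proof (intro suminf_le)
      fix k
      have "\<rho> k ^ ?d = \<rho> k * \<rho> k ^ (?d - 1)"
        using DIM_positive[where 'a='a] by (metis power_minus_mult mult.commute)
      then have eq: "c k * (A * \<rho> k ^ (?d - 1)) = C\<^sup>2 * 2 ^ ?d * A * \<rho> k"
        using \<rho>[of k] by (simp add: c_def power2_eq_square field_simps)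
      have "ennreal (c k) * emeasure (surf \<Omega>) (?A k) \<le> ennreal (c k) * ennreal (A * \<rho> k ^ (?d - 1))"
        by (intro mult_left_mono A \<rho>) auto
      also have "\<dots> = ennreal (C\<^sup>2 * 2 ^ ?d * A * \<rho> k)"
        using c[of k] A(1) \<rho>[of k] unfolding eq[symmetric]
        by (intro ennreal_mult[symmetric] mult_nonneg_nonneg) auto
      finally show "ennreal (c k) * emeasure (surf \<Omega>) (?A k) \<le> ennreal (C\<^sup>2 * 2 ^ ?d * A * \<rho> k)" .
    qed auto
    also have "\<dots> = ennreal (\<Sum>k. C\<^sup>2 * 2 ^ ?d * A * \<rho> k)"
      using A(1) \<rho> by (intro suminf_ennreal2) (auto simp: \<rho>_def less_imp_le intro!: summable_mult mult_nonneg_nonneg)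
    finally show "(\<integral>\<^sup>+y. ennreal ((u x - u y)\<^sup>2 / norm (x - y) ^ ?d) \<partial>surf \<Omega>) \<le> ennreal (\<Sum>k. C\<^sup>2 * 2 ^ ?d * A * \<rho> k)" .
  qed
qed

text \<open>Restriction to \<open>S\<close> only decreases the inner integral, whose uniform bound
  is then integrated over a finite measure.\<close>

lemma P1_H12:
  assumes u: "u \<in> P1 \<Omega> \<T>" and S: "S \<in> sets (surf \<Omega>)"
  shows "u \<in> H12 \<Omega> S"
proof -
  let ?M = "restrict_space (surf \<Omega>) S"
  have Ssub: "S \<subseteq> frontier \<Omega>" using sets.sets_into_space[OF S] by simp
  have Sint: "S \<inter> space (surf \<Omega>) \<in> sets (surf \<Omega>)"
    using S sets.sets_into_space[OF S] by (simp add: Int_absorb2)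
  interpret finite_measure ?M by (rule finite_measure_restrict_space[OF finite_measure_surf S])
  have [measurable]: "u \<in> borel_measurable ?M"
    by (intro measurable_restrict_space1 borel_measurable_surf P1_borel u)
  obtain C where C: "\<And>x. \<bar>u x\<bar> \<le> C" using P1_bounded[OF u] by metis
  have "(u x)\<^sup>2 \<le> C\<^sup>2" for x using power_mono[OF C abs_ge_zero, of x 2] by simp
  then have int: "integrable ?M (\<lambda>x. (u x)\<^sup>2)"
    by (intro integrable_const_bound[where B = "C\<^sup>2"]) auto
  obtain B where B: "\<And>x. x \<in> frontier \<Omega> \<Longrightarrow>
      (\<integral>\<^sup>+y. ennreal ((u x - u y)\<^sup>2 / norm (x - y) ^ DIM('a)) \<partial>surf \<Omega>) \<le> ennreal B"
    using P1_gagliardo_bound[OF u] by metis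
  have "(\<integral>\<^sup>+x. (\<integral>\<^sup>+y. ennreal ((u x - u y)\<^sup>2 / norm (x - y) ^ DIM('a)) \<partial>?M) \<partial>?M) \<le> (\<integral>\<^sup>+x. ennreal B \<partial>?M)"
  proof (rule nn_integral_mono)
    fix x assume "x \<in> space ?M"
    then have x: "x \<in> frontier \<Omega>" by (auto simp: space_restrict_space)
    have "(\<integral>\<^sup>+y. ennreal ((u x - u y)\<^sup>2 / norm (x - y) ^ DIM('a)) \<partial>?M)
        \<le> (\<integral>\<^sup>+y. ennreal ((u x - u y)\<^sup>2 / norm (x - y) ^ DIM('a)) \<partial>surf \<Omega>)"
      unfolding nn_integral_restrict_space[OF Sint] by (intro nn_integral_mono) (auto simp: indicator_def)
    then show "(\<integral>\<^sup>+y. ennreal ((u x - u y)\<^sup>2 / norm (x - y) ^ DIM('a)) \<partial>?M) \<le> ennreal B"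
      using B[OF x] by (rule order.trans)
  qed
  also have "\<dots> < \<infinity>"
    by (simp add: ennreal_mult_eq_top_iff less_top[symmetric])
  finally have "H12_energy \<Omega> S u < \<infinity>"
    using nn_integral_eq_integral[OF int] by (simp add: H12_energy_def)
  then show ?thesis
    using int by (auto simp: H12_def L2_def)
qed

text \<open>This makes every functional bounded by \<open>H12_norm\<close> vanish on elements of
  \<open>H12\<close> with zero trace.\<close>

lemma H12_norm_trace_zero:
  assumes S: "S \<in> sets (surf \<Omega>)" and zero: "trace_eq \<Omega> S u (\<lambda>x. 0)"
  shows "H12_norm \<Omega> S u = 0"
proof -
  let ?M = "restrict_space (surf \<Omega>) S"
  have Sint: "S \<inter> space (surf \<Omega>) \<in> sets (surf \<Omega>)"
    using S sets.sets_into_space[OF S] by (simp add: Int_absorb2)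
  have AE: "AE x in ?M. u x = 0"
    using zero unfolding trace_eq_def AE_restrict_space_iff[OF Sint] .
  have "(\<integral>\<^sup>+x. ennreal ((u x)\<^sup>2) \<partial>?M) = (\<integral>\<^sup>+x. 0 \<partial>?M)"
    using AE by (intro nn_integral_cong_AE) (auto elim: eventually_mono)
  moreover have "(\<integral>\<^sup>+x. (\<integral>\<^sup>+y. ennreal ((u x - u y)\<^sup>2 / norm (x - y) ^ DIM('a)) \<partial>?M) \<partial>?M) = (\<integral>\<^sup>+x. 0 \<partial>?M)"
  proof (rule nn_integral_cong_AE, use AE in eventually_elim)
    fix x assume x: "u x = 0"
    have "(\<integral>\<^sup>+y. ennreal ((u x - u y)\<^sup>2 / norm (x - y) ^ DIM('a)) \<partial>?M) = (\<integral>\<^sup>+y. 0 \<partial>?M)"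
      using AE by (intro nn_integral_cong_AE) (auto elim!: eventually_mono simp: x)
    then show "(\<integral>\<^sup>+y. ennreal ((u x - u y)\<^sup>2 / norm (x - y) ^ DIM('a)) \<partial>?M) = 0" by simp
  qed
  ultimately show ?thesis by (simp add: H12_norm_def H12_energy_def)
qed

end

section \<open>The discrete problems and their dependence on the coefficients\<close>

lemma Linf_integral_linear_combination:
  assumes "finite_measure M" "u \<in> Linf M" "v \<in> Linf M"
  shows "(LINT x|M. c * u x + d * v x) = c * (LINT x|M. u x) + d * (LINT x|M. v x)"
  using Linf_integrable[OF assms(1,2)] Linf_integrable[OF assms(1,3)] by simp

text \<open>Young's inequality with a free weight \<open>s\<close> stands in for Cauchy-Schwarz on
  integrals: the pointwise bound integrates term by term, and the weight can be chosen
  afterwards.\<close>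

lemma integral_product_bound:
  fixes p \<xi> \<zeta> :: "'a \<Rightarrow> real"
  assumes M: "finite_measure M" and u: "u \<in> Linf M" and p: "p \<in> Linf M"
    and \<xi>: "\<xi> \<in> Linf M" and \<zeta>: "\<zeta> \<in> Linf M" and s: "s > 0"
    and le: "\<And>x. \<bar>p x\<bar> \<le> (s * \<xi> x + \<zeta> x / s) / 2"
  shows "\<bar>LINT x|M. u x * p x\<bar> \<le> Linf_norm M u / 2 * (s * (LINT x|M. \<xi> x) + (LINT x|M. \<zeta> x) / s)"
proof -
  have rhs: "(\<lambda>x. s * \<xi> x + 1 / s * \<zeta> x) \<in> Linf M" by (intro Linf_linear_combination \<xi> \<zeta>)
  have "\<bar>LINT x|M. u x * p x\<bar> \<le> (LINT x|M. \<bar>u x * p x\<bar>)" by (rule integral_abs_bound)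
  also have "\<dots> \<le> (LINT x|M. Linf_norm M u / 2 * (s * \<xi> x + 1 / s * \<zeta> x))"
  proof (rule integral_mono_AE)
    show "integrable M (\<lambda>x. \<bar>u x * p x\<bar>)"
      using Linf_integrable[OF M Linf_mult[OF u p]] by (rule integrable_abs)
    show "integrable M (\<lambda>x. Linf_norm M u / 2 * (s * \<xi> x + 1 / s * \<zeta> x))"
      using Linf_integrable[OF M rhs] by (rule integrable_mult_right)
    show "AE x in M. \<bar>u x * p x\<bar> \<le> Linf_norm M u / 2 * (s * \<xi> x + 1 / s * \<zeta> x)"
      using Linf_AE_norm[OF u]
    proof (rule eventually_mono)
      fix x assume "\<bar>u x\<bar> \<le> Linf_norm M u"
      then have "\<bar>u x\<bar> * \<bar>p x\<bar> \<le> Linf_norm M u * ((s * \<xi> x + \<zeta> x / s) / 2)"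
        using le[of x] by (intro mult_mono) (auto simp: Linf_norm_nonneg)
      then show "\<bar>u x * p x\<bar> \<le> Linf_norm M u / 2 * (s * \<xi> x + 1 / s * \<zeta> x)" by (simp add: abs_mult)
    qed
  qed
  also have "\<dots> = Linf_norm M u / 2 * (s * (LINT x|M. \<xi> x) + 1 / s * (LINT x|M. \<zeta> x))"
    using Linf_integral_linear_combination[OF M \<xi> \<zeta>, of s "1 / s"] by simp
  finally show ?thesis by simp
qed

lemma weighted_young:
  fixes a b s :: real
  assumes "s > 0"
  shows "a * b \<le> (s * a\<^sup>2 + b\<^sup>2 / s) / 2"
proof -
  have "0 \<le> (s * a - b)\<^sup>2 / s" using assms by simp
  also have "(s * a - b)\<^sup>2 / s = s * a\<^sup>2 + b\<^sup>2 / s - 2 * (a * b)"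
    using assms by (simp add: power2_eq_square field_simps)
  finally show ?thesis by simp
qed

text \<open>The weight \<open>s = c / \<eta>\<close> makes the first term c n / 2, at most b / 2,
  which is absorbed on the left. For \<eta> = 0 any weight already gives b \<le> 0.\<close>

lemma young_absorption:
  fixes b c \<eta> m n :: real
  assumes "\<eta> \<ge> 0" "c > 0" "n \<ge> 0" and coercive: "c * n \<le> b"
    and le: "\<And>s. s > 0 \<Longrightarrow> b \<le> \<eta> / 2 * (s * n + m / s)"
  shows "b \<le> \<eta>\<^sup>2 / c * m"
proof (cases "\<eta> = 0")
  case False
  then have "\<eta> > 0" using assms by simp
  have "\<eta> / 2 * (c / \<eta> * n + m / (c / \<eta>)) = c * n / 2 + \<eta>\<^sup>2 / c * m / 2"
    using \<open>\<eta> > 0\<close> \<open>c > 0\<close> by (simp add: power2_eq_square field_simps)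
  then show ?thesis using le[of "c / \<eta>"] coercive \<open>\<eta> > 0\<close> \<open>c > 0\<close> by simp
qed (use le[of 1] in simp)

text \<open>The form \<beta> of the overview, which is \<open>bform\<close> without its boundary
  term. As \<open>bform\<close> is affine in the coefficients, this is its exact increment in the
  direction \<open>(u, v)\<close>.\<close>

definition coefficient_form :: "'a::euclidean_space set \<Rightarrow> ('a \<Rightarrow> real) \<Rightarrow> ('a \<Rightarrow> real) \<Rightarrow>
    ('a \<Rightarrow> real) \<Rightarrow> ('a \<Rightarrow> real) \<Rightarrow> real" where
  "coefficient_form \<Omega> u v y z =
     (LINT x|lebesgue_on \<Omega>. u x * (weak_grad \<Omega> y x \<bullet> weak_grad \<Omega> z x)) +
     (LINT x|lebesgue_on \<Omega>. v x * (y x * z x))"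

abbreviation sq_H1 :: "'a::euclidean_space set \<Rightarrow> ('a \<Rightarrow> real) \<Rightarrow> real" where
  "sq_H1 \<Omega> y \<equiv> (LINT x|lebesgue_on \<Omega>. weak_grad \<Omega> y x \<bullet> weak_grad \<Omega> y x) + (LINT x|lebesgue_on \<Omega>. y x * y x)"

text \<open>Perturbed coefficients leave \<open>P1\<close> and the boxes; what persists near
  \<open>(q, a)\<close> is boundedness and a positive lower bound, here one constant for
  both.\<close>

definition coercive_coefficients :: "'a::euclidean_space set \<Rightarrow> real \<Rightarrow> ('a \<Rightarrow> real) \<Rightarrow> ('a \<Rightarrow> real) \<Rightarrow> bool" where
  "coercive_coefficients \<Omega> c q a \<longleftrightarrow> c > 0 \<and> q \<in> Linf (lebesgue_on \<Omega>) \<and> a \<in> Linf (lebesgue_on \<Omega>) \<and>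
     (AE x in lebesgue_on \<Omega>. c \<le> q x) \<and> (AE x in lebesgue_on \<Omega>. c \<le> a x)"

locale robin_mesh = lipschitz_mesh +
  fixes \<sigma> :: "'a \<Rightarrow> real"
  assumes sigma_Linf: "\<sigma> \<in> Linf (surf \<Omega>)" and sigma_nonneg: "AE x in surf \<Omega>. \<sigma> x \<ge> 0"
begin

lemma sq_H1_nonneg: "sq_H1 \<Omega> y \<ge> 0"
  by (intro add_nonneg_nonneg integral_nonneg_AE) auto

lemma coefficient_form_Linf:
  assumes "y \<in> P1 \<Omega> \<T>" "z \<in> P1 \<Omega> \<T>" "u \<in> Linf (lebesgue_on \<Omega>)"
  shows "(\<lambda>x. u x * (weak_grad \<Omega> y x \<bullet> weak_grad \<Omega> z x)) \<in> Linf (lebesgue_on \<Omega>)"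
    and "(\<lambda>x. u x * (y x * z x)) \<in> Linf (lebesgue_on \<Omega>)"
  using assms by (simp_all add: Linf_mult weak_grad_inner_Linf P1_Linf)

lemma bform_eq_coefficient_form:
  "bform \<Omega> \<sigma> q a y z = coefficient_form \<Omega> q a y z + (LINT x|surf \<Omega>. \<sigma> x * (y x * z x))"
  by (simp add: bform_def coefficient_form_def mult.assoc)

text \<open>\<open>weak_grad\<close> is linear only almost everywhere, so the integrands are
  exchanged up to a null set, which requires their measurability.\<close>

lemma coefficient_form_linear:
  assumes y: "y \<in> P1 \<Omega> \<T>" and y': "y' \<in> P1 \<Omega> \<T>" and z: "z \<in> P1 \<Omega> \<T>"
    and u: "u \<in> Linf (lebesgue_on \<Omega>)" and v: "v \<in> Linf (lebesgue_on \<Omega>)"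
  shows "coefficient_form \<Omega> u v (\<lambda>x. c * y x + d * y' x) z
    = c * coefficient_form \<Omega> u v y z + d * coefficient_form \<Omega> u v y' z"
proof -
  note lin = Linf_integral_linear_combination[OF finite_measure_dom]
  have "(LINT x|lebesgue_on \<Omega>. u x * (weak_grad \<Omega> (\<lambda>x. c * y x + d * y' x) x \<bullet> weak_grad \<Omega> z x))
      = (LINT x|lebesgue_on \<Omega>. c * (u x * (weak_grad \<Omega> y x \<bullet> weak_grad \<Omega> z x)) + d * (u x * (weak_grad \<Omega> y' x \<bullet> weak_grad \<Omega> z x)))"
  proof (rule integral_cong_AE)
    show "(\<lambda>x. u x * (weak_grad \<Omega> (\<lambda>x. c * y x + d * y' x) x \<bullet> weak_grad \<Omega> z x)) \<in> borel_measurable (lebesgue_on \<Omega>)"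
      using coefficient_form_Linf(1)[OF P1_linear_combination[OF y y', of c d] z u] by (simp add: Linf_def)
    show "(\<lambda>x. c * (u x * (weak_grad \<Omega> y x \<bullet> weak_grad \<Omega> z x)) + d * (u x * (weak_grad \<Omega> y' x \<bullet> weak_grad \<Omega> z x)))
        \<in> borel_measurable (lebesgue_on \<Omega>)"
      using Linf_linear_combination[OF coefficient_form_Linf(1)[OF y z u] coefficient_form_Linf(1)[OF y' z u], of c d]
      by (simp add: Linf_def)
    show "AE x in lebesgue_on \<Omega>. u x * (weak_grad \<Omega> (\<lambda>x. c * y x + d * y' x) x \<bullet> weak_grad \<Omega> z x)
        = c * (u x * (weak_grad \<Omega> y x \<bullet> weak_grad \<Omega> z x)) + d * (u x * (weak_grad \<Omega> y' x \<bullet> weak_grad \<Omega> z x))"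
      using weak_grad_linear_combination[OF y y', of c d]
      by eventually_elim (simp add: inner_add_left algebra_simps)
  qed
  also have "\<dots> = c * (LINT x|lebesgue_on \<Omega>. u x * (weak_grad \<Omega> y x \<bullet> weak_grad \<Omega> z x)) + d * (LINT x|lebesgue_on \<Omega>. u x * (weak_grad \<Omega> y' x \<bullet> weak_grad \<Omega> z x))"
    by (intro lin coefficient_form_Linf y y' z u)
  finally have 1: "(LINT x|lebesgue_on \<Omega>. u x * (weak_grad \<Omega> (\<lambda>x. c * y x + d * y' x) x \<bullet> weak_grad \<Omega> z x)) = \<dots>" .
  have 2: "(LINT x|lebesgue_on \<Omega>. v x * ((c * y x + d * y' x) * z x))
      = c * (LINT x|lebesgue_on \<Omega>. v x * (y x * z x)) + d * (LINT x|lebesgue_on \<Omega>. v x * (y' x * z x))"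
    using lin[OF coefficient_form_Linf(2)[OF y z v] coefficient_form_Linf(2)[OF y' z v], of c d]
    by (simp add: algebra_simps)
  show ?thesis unfolding coefficient_form_def 1 2 by (simp add: algebra_simps)
qed

lemma coefficient_form_commute: "coefficient_form \<Omega> u v y z = coefficient_form \<Omega> u v z y"
  by (simp add: coefficient_form_def inner_commute mult.commute)

lemma coefficient_form_coefficients:
  assumes "y \<in> P1 \<Omega> \<T>" "z \<in> P1 \<Omega> \<T>" "u \<in> Linf (lebesgue_on \<Omega>)" "v \<in> Linf (lebesgue_on \<Omega>)"
    "u' \<in> Linf (lebesgue_on \<Omega>)" "v' \<in> Linf (lebesgue_on \<Omega>)"
  shows "coefficient_form \<Omega> (\<lambda>x. c * u x + d * u' x) (\<lambda>x. c * v x + d * v' x) y z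
    = c * coefficient_form \<Omega> u v y z + d * coefficient_form \<Omega> u' v' y z"
proof -
  note lin = Linf_integral_linear_combination[OF finite_measure_dom]
  have "(LINT x|lebesgue_on \<Omega>. (c * u x + d * u' x) * (weak_grad \<Omega> y x \<bullet> weak_grad \<Omega> z x))
      = c * (LINT x|lebesgue_on \<Omega>. u x * (weak_grad \<Omega> y x \<bullet> weak_grad \<Omega> z x)) + d * (LINT x|lebesgue_on \<Omega>. u' x * (weak_grad \<Omega> y x \<bullet> weak_grad \<Omega> z x))"
    using lin[OF coefficient_form_Linf(1)[OF assms(1,2,3)] coefficient_form_Linf(1)[OF assms(1,2,5)], of c d]
    by (simp add: algebra_simps)
  moreover have "(LINT x|lebesgue_on \<Omega>. (c * v x + d * v' x) * (y x * z x))
      = c * (LINT x|lebesgue_on \<Omega>. v x * (y x * z x)) + d * (LINT x|lebesgue_on \<Omega>. v' x * (y x * z x))"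
    using lin[OF coefficient_form_Linf(2)[OF assms(1,2,4)] coefficient_form_Linf(2)[OF assms(1,2,6)], of c d]
    by (simp add: algebra_simps)
  ultimately show ?thesis by (simp add: coefficient_form_def algebra_simps)
qed

lemma coefficient_form_bound:
  assumes y: "y \<in> P1 \<Omega> \<T>" and z: "z \<in> P1 \<Omega> \<T>"
    and u: "u \<in> Linf (lebesgue_on \<Omega>)" and v: "v \<in> Linf (lebesgue_on \<Omega>)" and s: "s > 0"
  shows "\<bar>coefficient_form \<Omega> u v y z\<bar> \<le>
    (Linf_norm (lebesgue_on \<Omega>) u + Linf_norm (lebesgue_on \<Omega>) v) / 2 * (s * sq_H1 \<Omega> y + sq_H1 \<Omega> z / s)"
proof -
  let ?M = "lebesgue_on \<Omega>"
  let ?yy = "LINT x|?M. weak_grad \<Omega> y x \<bullet> weak_grad \<Omega> y x" and ?zz = "LINT x|?M. weak_grad \<Omega> z x \<bullet> weak_grad \<Omega> z x"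
  let ?y = "LINT x|?M. y x * y x" and ?z = "LINT x|?M. z x * z x"
  have nonneg: "?yy \<ge> 0" "?zz \<ge> 0" "?y \<ge> 0" "?z \<ge> 0" by (auto intro!: integral_nonneg_AE)
  have "\<bar>LINT x|?M. u x * (weak_grad \<Omega> y x \<bullet> weak_grad \<Omega> z x)\<bar> \<le> Linf_norm ?M u / 2 * (s * ?yy + ?zz / s)"
  proof (rule integral_product_bound[OF finite_measure_dom u _ _ _ s])
    fix x
    have "\<bar>weak_grad \<Omega> y x \<bullet> weak_grad \<Omega> z x\<bar> \<le> norm (weak_grad \<Omega> y x) * norm (weak_grad \<Omega> z x)"
      by (rule Cauchy_Schwarz_ineq2)
    also have "\<dots> \<le> (s * (norm (weak_grad \<Omega> y x))\<^sup>2 + (norm (weak_grad \<Omega> z x))\<^sup>2 / s) / 2"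
      using s by (rule weighted_young)
    finally show "\<bar>weak_grad \<Omega> y x \<bullet> weak_grad \<Omega> z x\<bar> \<le> (s * (weak_grad \<Omega> y x \<bullet> weak_grad \<Omega> y x) + (weak_grad \<Omega> z x \<bullet> weak_grad \<Omega> z x) / s) / 2"
      by (simp add: power2_norm_eq_inner)
  qed (intro weak_grad_inner_Linf y z)+
  also have "\<dots> \<le> Linf_norm ?M u / 2 * (s * sq_H1 \<Omega> y + sq_H1 \<Omega> z / s)"
    using nonneg s by (intro mult_left_mono add_mono divide_right_mono) (auto simp: Linf_norm_nonneg)
  finally have 1: "\<bar>LINT x|?M. u x * (weak_grad \<Omega> y x \<bullet> weak_grad \<Omega> z x)\<bar> \<le> \<dots>" .
  have "\<bar>LINT x|?M. v x * (y x * z x)\<bar> \<le> Linf_norm ?M v / 2 * (s * ?y + ?z / s)"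
  proof (rule integral_product_bound[OF finite_measure_dom v _ _ _ s])
    fix x
    show "\<bar>y x * z x\<bar> \<le> (s * (y x * y x) + z x * z x / s) / 2"
      using weighted_young[OF s, of "\<bar>y x\<bar>" "\<bar>z x\<bar>"] by (simp add: abs_mult power2_eq_square)
  qed (intro Linf_mult P1_Linf y z)+
  also have "\<dots> \<le> Linf_norm ?M v / 2 * (s * sq_H1 \<Omega> y + sq_H1 \<Omega> z / s)"
    using nonneg s by (intro mult_left_mono add_mono divide_right_mono) (auto simp: Linf_norm_nonneg)
  finally have 2: "\<bar>LINT x|?M. v x * (y x * z x)\<bar> \<le> \<dots>" .
  have "\<bar>coefficient_form \<Omega> u v y z\<bar> \<le> Linf_norm ?M u / 2 * (s * sq_H1 \<Omega> y + sq_H1 \<Omega> z / s)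
      + Linf_norm ?M v / 2 * (s * sq_H1 \<Omega> y + sq_H1 \<Omega> z / s)"
    unfolding coefficient_form_def by (rule order.trans[OF abs_triangle_ineq add_mono[OF 1 2]])
  also have "\<dots> = (Linf_norm ?M u + Linf_norm ?M v) / 2 * (s * sq_H1 \<Omega> y + sq_H1 \<Omega> z / s)"
    by (simp only: add_divide_distrib distrib_right)
  finally show ?thesis .
qed

lemma bform_linear:
  assumes y: "y \<in> P1 \<Omega> \<T>" and y': "y' \<in> P1 \<Omega> \<T>" and z: "z \<in> P1 \<Omega> \<T>"
    and q: "q \<in> Linf (lebesgue_on \<Omega>)" and a: "a \<in> Linf (lebesgue_on \<Omega>)"
  shows "bform \<Omega> \<sigma> q a (\<lambda>x. c * y x + d * y' x) z = c * bform \<Omega> \<sigma> q a y z + d * bform \<Omega> \<sigma> q a y' z"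
proof -
  have L: "(\<lambda>x. \<sigma> x * (y x * z x)) \<in> Linf (surf \<Omega>)" "(\<lambda>x. \<sigma> x * (y' x * z x)) \<in> Linf (surf \<Omega>)"
    by (intro Linf_mult sigma_Linf P1_Linf_surf y y' z)+
  have "(LINT x|surf \<Omega>. \<sigma> x * ((c * y x + d * y' x) * z x))
      = c * (LINT x|surf \<Omega>. \<sigma> x * (y x * z x)) + d * (LINT x|surf \<Omega>. \<sigma> x * (y' x * z x))"
    using Linf_integral_linear_combination[OF finite_measure_surf L, of c d] by (simp add: algebra_simps)
  then show ?thesis
    by (simp add: bform_eq_coefficient_form coefficient_form_linear[OF y y' z q a] algebra_simps)
qed

lemma bform_commute: "bform \<Omega> \<sigma> q a y z = bform \<Omega> \<sigma> q a z y"
  by (simp add: bform_eq_coefficient_form coefficient_form_commute[of _ _ y z] mult.commute)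

lemma bform_perturbed:
  assumes "y \<in> P1 \<Omega> \<T>" "z \<in> P1 \<Omega> \<T>" "q \<in> Linf (lebesgue_on \<Omega>)" "a \<in> Linf (lebesgue_on \<Omega>)"
    "u \<in> Linf (lebesgue_on \<Omega>)" "v \<in> Linf (lebesgue_on \<Omega>)"
  shows "bform \<Omega> \<sigma> (\<lambda>x. q x + u x) (\<lambda>x. a x + v x) y z = bform \<Omega> \<sigma> q a y z + coefficient_form \<Omega> u v y z"
  using coefficient_form_coefficients[OF assms, of 1 1] by (simp add: bform_eq_coefficient_form)

lemma bform_coercive:
  assumes y: "y \<in> P1 \<Omega> \<T>" and qa: "coercive_coefficients \<Omega> c q a"
  shows "c * sq_H1 \<Omega> y \<le> bform \<Omega> \<sigma> q a y y"
proof -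
  have c: "c > 0" and q: "q \<in> Linf (lebesgue_on \<Omega>)" "AE x in lebesgue_on \<Omega>. c \<le> q x"
    and a: "a \<in> Linf (lebesgue_on \<Omega>)" "AE x in lebesgue_on \<Omega>. c \<le> a x"
    using qa by (auto simp: coercive_coefficients_def)
  note int = Linf_integrable[OF finite_measure_dom]
  have "(LINT x|lebesgue_on \<Omega>. c * (weak_grad \<Omega> y x \<bullet> weak_grad \<Omega> y x)) \<le> (LINT x|lebesgue_on \<Omega>. q x * (weak_grad \<Omega> y x \<bullet> weak_grad \<Omega> y x))"
    using q(2) by (intro integral_mono_AE integrable_mult_right int coefficient_form_Linf weak_grad_inner_Linf y q(1))
      (auto elim!: eventually_mono intro: mult_right_mono)
  moreover have "(LINT x|lebesgue_on \<Omega>. c * (y x * y x)) \<le> (LINT x|lebesgue_on \<Omega>. a x * (y x * y x))"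
    using a(2) by (intro integral_mono_AE integrable_mult_right int coefficient_form_Linf Linf_mult P1_Linf y a(1))
      (auto elim!: eventually_mono intro: mult_right_mono)
  moreover have "(LINT x|surf \<Omega>. \<sigma> x * (y x * y x)) \<ge> 0"
    using sigma_nonneg by (intro integral_nonneg_AE) (auto elim!: eventually_mono)
  ultimately show ?thesis
    by (simp add: bform_eq_coefficient_form coefficient_form_def distrib_left)
qed

text \<open>If the integral of \<open>y * y\<close> is 0, then \<open>y\<close> vanishes almost
  everywhere; an open null set is empty, so \<open>y\<close> is 0 on \<Omega>, by continuity on its
  closure, and by the convention in \<open>P1\<close> everywhere.\<close>

lemma sq_H1_pos:
  assumes y: "y \<in> P1 \<Omega> \<T>" and nz: "y \<noteq> (\<lambda>x. 0)"
  shows "sq_H1 \<Omega> y > 0"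
proof (rule ccontr)
  assume "\<not> sq_H1 \<Omega> y > 0"
  moreover have "(LINT x|lebesgue_on \<Omega>. weak_grad \<Omega> y x \<bullet> weak_grad \<Omega> y x) \<ge> 0" "(LINT x|lebesgue_on \<Omega>. y x * y x) \<ge> 0"
    by (auto intro!: integral_nonneg_AE)
  ultimately have "(LINT x|lebesgue_on \<Omega>. y x * y x) = 0" by linarith
  then have "AE x in lebesgue_on \<Omega>. y x * y x = 0"
    using Linf_integrable[OF finite_measure_dom Linf_mult[OF P1_Linf[OF y] P1_Linf[OF y]]]
    by (subst (asm) integral_nonneg_eq_0_iff_AE) auto
  then have "AE x in lebesgue. x \<in> \<Omega> \<longrightarrow> y x = 0" by (simp add: AE_restrict_space_iff)
  then have "{x. \<not> (x \<in> \<Omega> \<longrightarrow> y x = 0)} \<in> null_sets lebesgue"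
    by (subst (asm) completion.AE_iff_null_sets) auto
  moreover have "{x. \<not> (x \<in> \<Omega> \<longrightarrow> y x = 0)} = {x \<in> \<Omega>. y x \<noteq> 0}" by auto
  ultimately have "negligible {x \<in> \<Omega>. y x \<noteq> 0}" by (simp add: negligible_iff_null_sets)
  moreover have cont: "continuous_on (closure \<Omega>) y" using y by (simp add: P1_def)
  then have "open {x \<in> \<Omega>. y x \<noteq> 0}"
    using continuous_open_preimage[OF continuous_on_subset[OF cont closure_subset] open_dom, of "- {0}"]
    by (auto simp: vimage_def Int_def)
  ultimately have "{x \<in> \<Omega>. y x \<noteq> 0} = {}" using open_not_negligible by blast
  then have "y x = 0" if "x \<in> closure \<Omega>" for x
    using continuous_constant_on_closure[OF cont, of 0 x] that by blast
  then have "y x = 0" for x using P1_outside[OF y, of x] by blast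
  then show False using nz by auto
qed

lemma bform_pos:
  assumes "y \<in> P1 \<Omega> \<T>" "y \<noteq> (\<lambda>x. 0)" "coercive_coefficients \<Omega> c q a"
  shows "bform \<Omega> \<sigma> q a y y > 0"
proof -
  have "0 < c * sq_H1 \<Omega> y"
    using assms sq_H1_pos by (intro mult_pos_pos) (auto simp: coercive_coefficients_def)
  then show ?thesis using bform_coercive[OF assms(1,3)] by linarith
qed

text \<open>Here \<open>y\<close> and \<open>y + d\<close> solve the problem for \<open>(q, a)\<close> and \<open>(q + u, a + v)\<close>.\<close>

lemma perturbation_estimate:
  assumes y: "y \<in> P1 \<Omega> \<T>" and d: "d \<in> P1 \<Omega> \<T>"
    and u: "u \<in> Linf (lebesgue_on \<Omega>)" and v: "v \<in> Linf (lebesgue_on \<Omega>)"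
    and qa': "coercive_coefficients \<Omega> c q' a'"
    and eq: "bform \<Omega> \<sigma> q' a' d d = - coefficient_form \<Omega> u v y d"
  shows "\<bar>coefficient_form \<Omega> u v d y\<bar> \<le>
    (Linf_norm (lebesgue_on \<Omega>) u + Linf_norm (lebesgue_on \<Omega>) v)\<^sup>2 / c * sq_H1 \<Omega> y"
proof (rule young_absorption)
  show "Linf_norm (lebesgue_on \<Omega>) u + Linf_norm (lebesgue_on \<Omega>) v \<ge> 0" by (simp add: Linf_norm_nonneg)
  show "c > 0" using qa' by (simp add: coercive_coefficients_def)
  show "sq_H1 \<Omega> d \<ge> 0" by (rule sq_H1_nonneg)
  \<comment> \<open>Coercivity of the perturbed form bounds the size of \<open>d\<close> by the very
    quantity to be estimated.\<close>
  show "c * sq_H1 \<Omega> d \<le> \<bar>coefficient_form \<Omega> u v d y\<bar>"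
    using bform_coercive[OF d qa'] eq coefficient_form_commute[of u v y d] by linarith
qed (rule coefficient_form_bound[OF d y u v])

end

section \<open>Solvability of the discrete Neumann and mixed problems\<close>

locale neumann_mixed_problem = robin_mesh +
  fixes \<Gamma> :: "'a set" and f j0 j\<delta> :: "('a \<Rightarrow> real) \<Rightarrow> real" and g\<delta> :: "'a \<Rightarrow> real"
  assumes Gamma_sets: "\<Gamma> \<in> sets (surf \<Omega>)" and f_dual: "f \<in> H_minus1 \<Omega>"
    and j0_dual: "j0 \<in> H_minus12 \<Omega> (frontier \<Omega> - \<Gamma>)" and j\<delta>_dual: "j\<delta> \<in> H_minus12 \<Omega> \<Gamma>"
    and g\<delta>_discrete: "\<exists>v\<in>P1 \<Omega> \<T>. trace_eq \<Omega> \<Gamma> v g\<delta>"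
begin

lemma P1_scale: "u \<in> P1 \<Omega> \<T> \<Longrightarrow> (\<lambda>x. c * u x) \<in> P1 \<Omega> \<T>"
  using P1_linear_combination[of u u c 0] by simp

lemma functional_linear:
  assumes u: "u \<in> P1 \<Omega> \<T>" and v: "v \<in> P1 \<Omega> \<T>"
  shows "f (\<lambda>x. c * u x + d * v x) = c * f u + d * f v"
    and "j0 (\<lambda>x. c * u x + d * v x) = c * j0 u + d * j0 v"
    and "j\<delta> (\<lambda>x. c * u x + d * v x) = c * j\<delta> u + d * j\<delta> v"
proof -
  have compl: "frontier \<Omega> - \<Gamma> \<in> sets (surf \<Omega>)"
    using sets.compl_sets[OF Gamma_sets] by simp
  note P1s = u v P1_scale[OF u, of c] P1_scale[OF v, of d]
  show "f (\<lambda>x. c * u x + d * v x) = c * f u + d * f v"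
    by (rule dual_linear_combination[OF f_dual[unfolded H_minus1_def]]) (intro P1_H1 P1s)+
  show "j0 (\<lambda>x. c * u x + d * v x) = c * j0 u + d * j0 v"
    by (rule dual_linear_combination[OF j0_dual[unfolded H_minus12_def]]) (intro P1_H12 P1s compl)+
  show "j\<delta> (\<lambda>x. c * u x + d * v x) = c * j\<delta> u + d * j\<delta> v"
    by (rule dual_linear_combination[OF j\<delta>_dual[unfolded H_minus12_def]]) (intro P1_H12 P1s Gamma_sets)+
qed

lemma P1_0_P1: "\<phi> \<in> P1_0 \<Omega> \<T> \<Gamma> \<Longrightarrow> \<phi> \<in> P1 \<Omega> \<T>"
  by (simp add: P1_0_def)

lemma P1_0_linear_combination:
  assumes "u \<in> P1_0 \<Omega> \<T> \<Gamma>" "v \<in> P1_0 \<Omega> \<T> \<Gamma>"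
  shows "(\<lambda>x. c * u x + d * v x) \<in> P1_0 \<Omega> \<T> \<Gamma>"
proof -
  have "AE x in surf \<Omega>. x \<in> \<Gamma> \<longrightarrow> u x = 0" "AE x in surf \<Omega>. x \<in> \<Gamma> \<longrightarrow> v x = 0"
    using assms by (auto simp: P1_0_def trace_eq_def)
  then have "AE x in surf \<Omega>. x \<in> \<Gamma> \<longrightarrow> c * u x + d * v x = 0"
    by eventually_elim simp
  then show ?thesis using assms P1_linear_combination by (auto simp: P1_0_def trace_eq_def)
qed

text \<open>The seminorm bounding \<open>j\<delta>\<close> ignores null traces. By linearity,
  \<open>j\<delta>\<close> takes the same value on all discrete functions with trace
  \<open>g\<delta>\<close>.\<close>

lemma j\<delta>_P1_0:
  assumes "\<phi> \<in> P1_0 \<Omega> \<T> \<Gamma>"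
  shows "j\<delta> \<phi> = 0"
proof -
  obtain C where "\<bar>j\<delta> \<phi>\<bar> \<le> C * H12_norm \<Omega> \<Gamma> \<phi>"
    using j\<delta>_dual P1_H12[OF P1_0_P1[OF assms] Gamma_sets] by (auto simp: H_minus12_def dual_def)
  moreover have "H12_norm \<Omega> \<Gamma> \<phi> = 0"
    using assms by (intro H12_norm_trace_zero Gamma_sets) (simp add: P1_0_def)
  ultimately show ?thesis by simp
qed

text \<open>Positive definiteness and separation by the nodes pass to subspaces, so one argument
  serves both test spaces.\<close>

lemma galerkin_solution:
  assumes qa: "coercive_coefficients \<Omega> c q a" and V: "V = P1 \<Omega> \<T> \<or> V = P1_0 \<Omega> \<T> \<Gamma>"
    and lin: "\<And>u v c d. u \<in> V \<Longrightarrow> v \<in> V \<Longrightarrow> F (\<lambda>x. c * u x + d * v x) = c * F u + d * F v"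
  obtains u where "u \<in> V" "\<And>\<phi>. \<phi> \<in> V \<Longrightarrow> bform \<Omega> \<sigma> q a u \<phi> = F \<phi>"
proof -
  have VP1: "u \<in> P1 \<Omega> \<T>" if "u \<in> V" for u using V that P1_0_P1 by blast
  have coeff: "q \<in> Linf (lebesgue_on \<Omega>)" "a \<in> Linf (lebesgue_on \<Omega>)"
    using qa by (auto simp: coercive_coefficients_def)
  obtain X where X: "finite X" "\<And>u. u \<in> P1 \<Omega> \<T> \<Longrightarrow> (\<And>x. x \<in> X \<Longrightarrow> u x = 0) \<Longrightarrow> u = (\<lambda>x. 0)"
    by (rule mesh_nodes) blast
  have "\<exists>u\<in>V. \<forall>\<phi>\<in>V. bform \<Omega> \<sigma> q a u \<phi> = F \<phi>"
  proof (rule riesz_finitely_separated[OF X(1)])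
    show "(\<lambda>x. 0) \<in> V" using V zero_in_P1 by (auto simp: P1_0_def trace_eq_def)
    show "(\<lambda>x. c * u x + d * v x) \<in> V" if "u \<in> V" "v \<in> V" for u v c d
      using V that P1_linear_combination P1_0_linear_combination by auto
    show "u = (\<lambda>x. 0)" if "u \<in> V" "\<And>x. x \<in> X \<Longrightarrow> u x = 0" for u
      using X(2)[OF VP1] that by blast
    show "bform \<Omega> \<sigma> q a (\<lambda>x. c * u x + d * v x) w = c * bform \<Omega> \<sigma> q a u w + d * bform \<Omega> \<sigma> q a v w"
      if "u \<in> V" "v \<in> V" "w \<in> V" for u v w c d
      using that by (intro bform_linear VP1 coeff)
    show "bform \<Omega> \<sigma> q a u v = bform \<Omega> \<sigma> q a v u" for u v by (rule bform_commute)
    show "bform \<Omega> \<sigma> q a u u > 0" if "u \<in> V" "u \<noteq> (\<lambda>x. 0)" for u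
      using that by (intro bform_pos[OF _ _ qa] VP1)
  qed (rule lin)
  then show thesis using that by blast
qed

text \<open>The difference of two solutions is an admissible test function in both problems: two
  functions with the same trace differ by an element of \<open>P1_0\<close>.\<close>

lemma difference_eq_0:
  assumes qa: "coercive_coefficients \<Omega> c q a" and u: "u \<in> P1 \<Omega> \<T>" "v \<in> P1 \<Omega> \<T>"
    and eq: "bform \<Omega> \<sigma> q a u (\<lambda>x. 1 * u x + - 1 * v x) = bform \<Omega> \<sigma> q a v (\<lambda>x. 1 * u x + - 1 * v x)"
  shows "u = v"
proof (rule ccontr)
  assume "u \<noteq> v"
  let ?d = "\<lambda>x. 1 * u x + - 1 * v x"
  have d: "?d \<in> P1 \<Omega> \<T>" by (rule P1_linear_combination[OF u])
  have "?d \<noteq> (\<lambda>x. 0)" using \<open>u \<noteq> v\<close> by (auto simp: fun_eq_iff)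
  from bform_pos[OF d this qa] have "bform \<Omega> \<sigma> q a ?d ?d > 0" .
  moreover have "bform \<Omega> \<sigma> q a ?d ?d = 1 * bform \<Omega> \<sigma> q a u ?d + - 1 * bform \<Omega> \<sigma> q a v ?d"
    using qa by (intro bform_linear u d) (auto simp: coercive_coefficients_def)
  ultimately show False using eq by simp
qed

text \<open>\<open>THE\<close> asks for uniqueness among total functions, which the zero extension
  in \<open>P1\<close> provides.\<close>

lemma N_h_solves:
  assumes qa: "coercive_coefficients \<Omega> c q a"
  shows "N_h \<Omega> \<T> \<sigma> f j0 j\<delta> q a \<in> P1 \<Omega> \<T>"
    and "\<phi> \<in> P1 \<Omega> \<T> \<Longrightarrow> bform \<Omega> \<sigma> q a (N_h \<Omega> \<T> \<sigma> f j0 j\<delta> q a) \<phi> = f \<phi> + j\<delta> \<phi> + j0 \<phi>"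
proof -
  let ?P = "\<lambda>u. u \<in> P1 \<Omega> \<T> \<and> (\<forall>\<phi>\<in>P1 \<Omega> \<T>. bform \<Omega> \<sigma> q a u \<phi> = f \<phi> + j\<delta> \<phi> + j0 \<phi>)"
  obtain u where u: "?P u"
  proof (rule galerkin_solution[OF qa, of "P1 \<Omega> \<T>" "\<lambda>\<phi>. f \<phi> + j\<delta> \<phi> + j0 \<phi>"])
    fix u v c d assume uv: "u \<in> P1 \<Omega> \<T>" "v \<in> P1 \<Omega> \<T>"
    show "f (\<lambda>x. c * u x + d * v x) + j\<delta> (\<lambda>x. c * u x + d * v x) + j0 (\<lambda>x. c * u x + d * v x)
        = c * (f u + j\<delta> u + j0 u) + d * (f v + j\<delta> v + j0 v)"
      by (simp add: functional_linear[OF uv] algebra_simps)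
  qed auto
  have uniq: "v = u" if v: "?P v" for v
    using u v P1_linear_combination[of v u 1 "- 1"] by (intro difference_eq_0[OF qa]) auto
  have "?P (The ?P)" by (rule theI[of ?P, OF u]) (rule uniq)
  then show "N_h \<Omega> \<T> \<sigma> f j0 j\<delta> q a \<in> P1 \<Omega> \<T>"
    and "\<phi> \<in> P1 \<Omega> \<T> \<Longrightarrow> bform \<Omega> \<sigma> q a (N_h \<Omega> \<T> \<sigma> f j0 j\<delta> q a) \<phi> = f \<phi> + j\<delta> \<phi> + j0 \<phi>"
    unfolding N_h_def by auto
qed

lemma trace_eq_difference:
  assumes "u \<in> P1 \<Omega> \<T>" "v \<in> P1 \<Omega> \<T>" "trace_eq \<Omega> \<Gamma> u g" "trace_eq \<Omega> \<Gamma> v g"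
  shows "(\<lambda>x. 1 * u x + - 1 * v x) \<in> P1_0 \<Omega> \<T> \<Gamma>"
proof -
  have "AE x in surf \<Omega>. x \<in> \<Gamma> \<longrightarrow> u x = g x" "AE x in surf \<Omega>. x \<in> \<Gamma> \<longrightarrow> v x = g x"
    using assms by (auto simp: trace_eq_def)
  then have "AE x in surf \<Omega>. x \<in> \<Gamma> \<longrightarrow> 1 * u x + - 1 * v x = 0" by eventually_elim simp
  then show ?thesis
    using P1_linear_combination[OF assms(1,2), of 1 "- 1"] by (simp add: P1_0_def trace_eq_def)
qed

text \<open>Lifting: a discrete function with the prescribed trace moves the boundary data into the
  load, and the correction is sought in \<open>P1_0\<close>.\<close>

lemma M_h_solves:
  assumes qa: "coercive_coefficients \<Omega> c q a"
  shows "M_h \<Omega> \<T> \<Gamma> \<sigma> f j0 g\<delta> q a \<in> P1 \<Omega> \<T>"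
    and "trace_eq \<Omega> \<Gamma> (M_h \<Omega> \<T> \<Gamma> \<sigma> f j0 g\<delta> q a) g\<delta>"
    and "\<phi> \<in> P1_0 \<Omega> \<T> \<Gamma> \<Longrightarrow> bform \<Omega> \<sigma> q a (M_h \<Omega> \<T> \<Gamma> \<sigma> f j0 g\<delta> q a) \<phi> = f \<phi> + j0 \<phi>"
proof -
  let ?P = "\<lambda>u. u \<in> P1 \<Omega> \<T> \<and> trace_eq \<Omega> \<Gamma> u g\<delta> \<and> (\<forall>\<phi>\<in>P1_0 \<Omega> \<T> \<Gamma>. bform \<Omega> \<sigma> q a u \<phi> = f \<phi> + j0 \<phi>)"
  have coeff: "q \<in> Linf (lebesgue_on \<Omega>)" "a \<in> Linf (lebesgue_on \<Omega>)"
    using qa by (auto simp: coercive_coefficients_def)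
  obtain v where v: "v \<in> P1 \<Omega> \<T>" "trace_eq \<Omega> \<Gamma> v g\<delta>" using g\<delta>_discrete by blast
  obtain d where d: "d \<in> P1_0 \<Omega> \<T> \<Gamma>" "\<And>\<phi>. \<phi> \<in> P1_0 \<Omega> \<T> \<Gamma> \<Longrightarrow> bform \<Omega> \<sigma> q a d \<phi> = f \<phi> + j0 \<phi> - bform \<Omega> \<sigma> q a \<phi> v"
  proof (rule galerkin_solution[OF qa, of "P1_0 \<Omega> \<T> \<Gamma>" "\<lambda>\<phi>. f \<phi> + j0 \<phi> - bform \<Omega> \<sigma> q a \<phi> v"])
    fix u w c d assume "u \<in> P1_0 \<Omega> \<T> \<Gamma>" "w \<in> P1_0 \<Omega> \<T> \<Gamma>"
    then have uw: "u \<in> P1 \<Omega> \<T>" "w \<in> P1 \<Omega> \<T>" by (auto intro: P1_0_P1)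
    show "f (\<lambda>x. c * u x + d * w x) + j0 (\<lambda>x. c * u x + d * w x) - bform \<Omega> \<sigma> q a (\<lambda>x. c * u x + d * w x) v
        = c * (f u + j0 u - bform \<Omega> \<sigma> q a u v) + d * (f w + j0 w - bform \<Omega> \<sigma> q a w v)"
      by (simp add: functional_linear[OF uw] bform_linear[OF uw v(1) coeff] algebra_simps)
  qed auto
  define u where "u = (\<lambda>x. 1 * v x + 1 * d x)"
  have "u \<in> P1 \<Omega> \<T>" unfolding u_def using P1_linear_combination[OF v(1) P1_0_P1[OF d(1)]] .
  moreover have "trace_eq \<Omega> \<Gamma> u g\<delta>"
  proof -
    have "AE x in surf \<Omega>. x \<in> \<Gamma> \<longrightarrow> v x = g\<delta> x" "AE x in surf \<Omega>. x \<in> \<Gamma> \<longrightarrow> d x = 0"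
      using v d by (auto simp: P1_0_def trace_eq_def)
    then have "AE x in surf \<Omega>. x \<in> \<Gamma> \<longrightarrow> u x = g\<delta> x" by eventually_elim (simp add: u_def)
    then show ?thesis by (simp add: trace_eq_def)
  qed
  moreover have "bform \<Omega> \<sigma> q a u \<phi> = f \<phi> + j0 \<phi>" if "\<phi> \<in> P1_0 \<Omega> \<T> \<Gamma>" for \<phi>
    unfolding u_def bform_linear[OF v(1) P1_0_P1[OF d(1)] P1_0_P1[OF that] coeff]
    using d(2)[OF that] bform_commute[of q a v \<phi>] by simp
  ultimately have u: "?P u" by blast
  have uniq: "w = u" if w: "?P w" for w
    using u w trace_eq_difference[of w u g\<delta>] by (intro difference_eq_0[OF qa]) auto
  have "?P (The ?P)" by (rule theI[of ?P, OF u]) (rule uniq)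
  then show "M_h \<Omega> \<T> \<Gamma> \<sigma> f j0 g\<delta> q a \<in> P1 \<Omega> \<T>"
    and "trace_eq \<Omega> \<Gamma> (M_h \<Omega> \<T> \<Gamma> \<sigma> f j0 g\<delta> q a) g\<delta>"
    and "\<phi> \<in> P1_0 \<Omega> \<T> \<Gamma> \<Longrightarrow> bform \<Omega> \<sigma> q a (M_h \<Omega> \<T> \<Gamma> \<sigma> f j0 g\<delta> q a) \<phi> = f \<phi> + j0 \<phi>"
    unfolding M_h_def by auto
qed

text \<open>\<open>J_h\<close> is the energy of \<open>N - M\<close>. The Neumann equation is tested
  with \<open>N\<close> and \<open>M\<close>; the term \<open>bform\<close> of \<open>M\<close> with
  itself stays, since \<open>M\<close> is in general not a test function of the mixed
  problem.\<close>

lemma J_h_eq: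
  assumes qa: "coercive_coefficients \<Omega> c q a"
  defines "N \<equiv> N_h \<Omega> \<T> \<sigma> f j0 j\<delta> q a" and "M \<equiv> M_h \<Omega> \<T> \<Gamma> \<sigma> f j0 g\<delta> q a"
  shows "J_h \<Omega> \<T> \<Gamma> \<sigma> f j0 j\<delta> g\<delta> q a =
    (f N + j\<delta> N + j0 N) - 2 * (f M + j\<delta> M + j0 M) + bform \<Omega> \<sigma> q a M M"
proof -
  have coeff: "q \<in> Linf (lebesgue_on \<Omega>)" "a \<in> Linf (lebesgue_on \<Omega>)"
    using qa by (auto simp: coercive_coefficients_def)
  have N: "N \<in> P1 \<Omega> \<T>" "\<And>\<phi>. \<phi> \<in> P1 \<Omega> \<T> \<Longrightarrow> bform \<Omega> \<sigma> q a N \<phi> = f \<phi> + j\<delta> \<phi> + j0 \<phi>"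
    unfolding N_def using N_h_solves[OF qa] by auto
  have M: "M \<in> P1 \<Omega> \<T>" unfolding M_def using M_h_solves[OF qa] by auto
  let ?w = "\<lambda>x. 1 * N x + - 1 * M x"
  have w: "?w \<in> P1 \<Omega> \<T>" by (rule P1_linear_combination[OF N(1) M])
  have "J_h \<Omega> \<T> \<Gamma> \<sigma> f j0 j\<delta> g\<delta> q a = bform \<Omega> \<sigma> q a ?w ?w"
    unfolding J_h_def bform_def N_def M_def Let_def power2_norm_eq_inner
    by (simp add: power2_eq_square mult.assoc)
  also have "\<dots> = bform \<Omega> \<sigma> q a N ?w - bform \<Omega> \<sigma> q a M ?w"
    using bform_linear[OF N(1) M w coeff, of 1 "- 1"] by simp
  also have "bform \<Omega> \<sigma> q a N ?w = bform \<Omega> \<sigma> q a N N - bform \<Omega> \<sigma> q a N M"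
    using bform_linear[OF N(1) M N(1) coeff, of 1 "- 1"] bform_commute[of q a N ?w] bform_commute[of q a N M] by simp
  also have "bform \<Omega> \<sigma> q a M ?w = bform \<Omega> \<sigma> q a N M - bform \<Omega> \<sigma> q a M M"
    using bform_linear[OF N(1) M M coeff, of 1 "- 1"] bform_commute[of q a M ?w] by simp
  finally show ?thesis using N(2)[OF N(1)] N(2)[OF M] by simp
qed

text \<open>By symmetry \<open>\<langle>f + j\<delta> + j0, N\<rangle>\<close> is minus twice the minimal Neumann energy and
  \<open>B(M, M) - 2 \<langle>f + j0, M\<rangle>\<close> twice the minimal mixed energy, so only the explicit dependence of
  the forms on the coefficients contributes to first order.\<close>

lemma J_h_increment:
  assumes qa: "coercive_coefficients \<Omega> c q a"
    and u: "u \<in> Linf (lebesgue_on \<Omega>)" and v: "v \<in> Linf (lebesgue_on \<Omega>)"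
    and qa': "coercive_coefficients \<Omega> c' (\<lambda>x. q x + u x) (\<lambda>x. a x + v x)"
  defines "N \<equiv> N_h \<Omega> \<T> \<sigma> f j0 j\<delta> q a" and "M \<equiv> M_h \<Omega> \<T> \<Gamma> \<sigma> f j0 g\<delta> q a"
  shows "\<bar>J_h \<Omega> \<T> \<Gamma> \<sigma> f j0 j\<delta> g\<delta> (\<lambda>x. q x + u x) (\<lambda>x. a x + v x) - J_h \<Omega> \<T> \<Gamma> \<sigma> f j0 j\<delta> g\<delta> q a
      - (coefficient_form \<Omega> u v M M - coefficient_form \<Omega> u v N N)\<bar>
    \<le> (Linf_norm (lebesgue_on \<Omega>) u + Linf_norm (lebesgue_on \<Omega>) v)\<^sup>2 / c' * (sq_H1 \<Omega> M + sq_H1 \<Omega> N)"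
proof -
  let ?q = "\<lambda>x. q x + u x" and ?a = "\<lambda>x. a x + v x"
  let ?B = "bform \<Omega> \<sigma> q a" and ?B' = "bform \<Omega> \<sigma> ?q ?a" and ?\<beta> = "coefficient_form \<Omega> u v"
  have coeff: "q \<in> Linf (lebesgue_on \<Omega>)" "a \<in> Linf (lebesgue_on \<Omega>)"
    "?q \<in> Linf (lebesgue_on \<Omega>)" "?a \<in> Linf (lebesgue_on \<Omega>)"
    using qa qa' by (auto simp: coercive_coefficients_def)
  define N' where "N' = N_h \<Omega> \<T> \<sigma> f j0 j\<delta> ?q ?a"
  define M' where "M' = M_h \<Omega> \<T> \<Gamma> \<sigma> f j0 g\<delta> ?q ?a"
  have N: "N \<in> P1 \<Omega> \<T>" "\<And>\<phi>. \<phi> \<in> P1 \<Omega> \<T> \<Longrightarrow> ?B N \<phi> = f \<phi> + j\<delta> \<phi> + j0 \<phi>"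
    unfolding N_def using N_h_solves[OF qa] by auto
  have N': "N' \<in> P1 \<Omega> \<T>" "\<And>\<phi>. \<phi> \<in> P1 \<Omega> \<T> \<Longrightarrow> ?B' N' \<phi> = f \<phi> + j\<delta> \<phi> + j0 \<phi>"
    unfolding N'_def using N_h_solves[OF qa'] by auto
  have M: "M \<in> P1 \<Omega> \<T>" "trace_eq \<Omega> \<Gamma> M g\<delta>" "\<And>\<phi>. \<phi> \<in> P1_0 \<Omega> \<T> \<Gamma> \<Longrightarrow> ?B M \<phi> = f \<phi> + j0 \<phi>"
    unfolding M_def using M_h_solves[OF qa] by auto
  have M': "M' \<in> P1 \<Omega> \<T>" "trace_eq \<Omega> \<Gamma> M' g\<delta>" "\<And>\<phi>. \<phi> \<in> P1_0 \<Omega> \<T> \<Gamma> \<Longrightarrow> ?B' M' \<phi> = f \<phi> + j0 \<phi>"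
    unfolding M'_def using M_h_solves[OF qa'] by auto
  define dN where "dN = (\<lambda>x. 1 * N' x + - 1 * N x)"
  define dM where "dM = (\<lambda>x. 1 * M' x + - 1 * M x)"
  have dN: "dN \<in> P1 \<Omega> \<T>" unfolding dN_def by (rule P1_linear_combination[OF N'(1) N(1)])
  have dM0: "dM \<in> P1_0 \<Omega> \<T> \<Gamma>" unfolding dM_def by (rule trace_eq_difference[OF M'(1) M(1) M'(2) M(2)])
  then have dM: "dM \<in> P1 \<Omega> \<T>" by (rule P1_0_P1)
  note pert = bform_perturbed[OF _ _ coeff(1,2) u v]

  \<comment> \<open>\<open>?B N dN\<close> and \<open>?B' N' dN\<close> equal the same load, so only
    the change of the form remains.\<close>
  have "?B' dN dN = ?B' N' dN - ?B' N dN"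
    unfolding dN_def using bform_linear[OF N'(1) N(1) dN[unfolded dN_def] coeff(3,4), of 1 "- 1"] by simp
  also have "\<dots> = - ?\<beta> N dN"
    using N'(2)[OF dN] N(2)[OF dN] pert[OF N(1) dN] by simp
  finally have estN: "\<bar>?\<beta> dN N\<bar> \<le> (Linf_norm (lebesgue_on \<Omega>) u + Linf_norm (lebesgue_on \<Omega>) v)\<^sup>2 / c' * sq_H1 \<Omega> N"
    by (rule perturbation_estimate[OF N(1) dN u v qa'])
  \<comment> \<open>The same argument applies to the mixed solutions, as \<open>dM\<close> has zero
    trace on \<Gamma>.\<close>
  have "?B' dM dM = ?B' M' dM - ?B' M dM"
    unfolding dM_def using bform_linear[OF M'(1) M(1) dM[unfolded dM_def] coeff(3,4), of 1 "- 1"] by simp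
  also have "\<dots> = - ?\<beta> M dM"
    using M'(3)[OF dM0] M(3)[OF dM0] pert[OF M(1) dM] by simp
  finally have estM: "\<bar>?\<beta> dM M\<bar> \<le> (Linf_norm (lebesgue_on \<Omega>) u + Linf_norm (lebesgue_on \<Omega>) v)\<^sup>2 / c' * sq_H1 \<Omega> M"
    by (rule perturbation_estimate[OF M(1) dM u v qa'])

  have \<beta>N: "?\<beta> N' N = ?\<beta> N N + ?\<beta> dN N"
    unfolding dN_def using coefficient_form_linear[OF N'(1) N(1) N(1) u v, of 1 "- 1"] by simp
  have \<beta>M: "?\<beta> M' M = ?\<beta> M M + ?\<beta> dM M"
    unfolding dM_def using coefficient_form_linear[OF M'(1) M(1) M(1) u v, of 1 "- 1"] by simp

  \<comment> \<open>Each Neumann solution is tested with the other: the load of \<open>N'\<close> is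
    \<open>?B N N'\<close>, that of \<open>N\<close> is \<open>?B' N' N\<close>.\<close>
  have neumann: "(f N' + j\<delta> N' + j0 N') - (f N + j\<delta> N + j0 N) = - ?\<beta> N' N"
    using N(2)[OF N'(1)] N'(2)[OF N(1)] pert[OF N'(1) N(1)] bform_commute[of q a N N'] by simp
  have "f dM = f M' - f M" "j0 dM = j0 M' - j0 M" "j\<delta> M' - j\<delta> M = j\<delta> dM"
    unfolding dM_def using functional_linear[OF M'(1) M(1), of 1 "- 1"] by simp_all
  then have load: "(f M' + j\<delta> M' + j0 M') - (f M + j\<delta> M + j0 M) = f dM + j0 dM"
    using j\<delta>_P1_0[OF dM0] by simp
  have "?B' M' dM = ?B' M' M' - ?B' M' M"
    using bform_linear[OF M'(1) M(1) M'(1) coeff(3,4), of 1 "- 1"] bform_commute[of ?q ?a M' dM] bform_commute[of ?q ?a M' M]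
    unfolding dM_def by simp
  moreover have "?B M dM = ?B M' M - ?B M M"
    using bform_linear[OF M'(1) M(1) M(1) coeff(1,2), of 1 "- 1"] bform_commute[of q a M dM]
    unfolding dM_def by simp
  \<comment> \<open>The two mixed equations tested with \<open>dM\<close> add up to twice the load
    of \<open>dM\<close>; what is left over is \<open>?B' M' M - ?B M' M\<close>.\<close>
  ultimately have mixed: "?B' M' M' - ?B M M - 2 * (f dM + j0 dM) = ?\<beta> M' M"
    using M(3)[OF dM0] M'(3)[OF dM0] pert[OF M'(1) M(1)] by simp

  have J: "J_h \<Omega> \<T> \<Gamma> \<sigma> f j0 j\<delta> g\<delta> q a = (f N + j\<delta> N + j0 N) - 2 * (f M + j\<delta> M + j0 M) + ?B M M"
    unfolding N_def M_def by (rule J_h_eq[OF qa])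
  have J': "J_h \<Omega> \<T> \<Gamma> \<sigma> f j0 j\<delta> g\<delta> ?q ?a = (f N' + j\<delta> N' + j0 N') - 2 * (f M' + j\<delta> M' + j0 M') + ?B' M' M'"
    unfolding N'_def M'_def by (rule J_h_eq[OF qa'])
  let ?J = "J_h \<Omega> \<T> \<Gamma> \<sigma> f j0 j\<delta> g\<delta>"
  have "?J ?q ?a - ?J q a = ((f N' + j\<delta> N' + j0 N') - (f N + j\<delta> N + j0 N))
      - 2 * ((f M' + j\<delta> M' + j0 M') - (f M + j\<delta> M + j0 M)) + (?B' M' M' - ?B M M)"
    unfolding J J' by (simp add: algebra_simps)
  also have "\<dots> = - ?\<beta> N' N + (?B' M' M' - ?B M M - 2 * (f dM + j0 dM))"
    unfolding neumann load by simp
  finally have "?J ?q ?a - ?J q a - (?\<beta> M M - ?\<beta> N N) = ?\<beta> dM M - ?\<beta> dN N"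
    unfolding mixed \<beta>N \<beta>M by simp
  then have "\<bar>?J ?q ?a - ?J q a - (?\<beta> M M - ?\<beta> N N)\<bar> \<le> \<bar>?\<beta> dM M\<bar> + \<bar>?\<beta> dN N\<bar>" by simp
  also note add_mono[OF estM estN]
  finally show ?thesis by (simp only: distrib_left)
qed


text \<open>The remainder in \<open>J_h_increment\<close> is quadratic in the sum \<eta> of the
  norms, with a constant that is uniform as long as the perturbed coefficients keep a common lower
  bound.\<close>

lemma has_frechet_differential_J_h:
  assumes qa: "coercive_coefficients \<Omega> c q a"
  defines "N \<equiv> N_h \<Omega> \<T> \<sigma> f j0 j\<delta> q a" and "M \<equiv> M_h \<Omega> \<T> \<Gamma> \<sigma> f j0 g\<delta> q a"
  shows "has_frechet_differential (lebesgue_on \<Omega>) (J_h \<Omega> \<T> \<Gamma> \<sigma> f j0 j\<delta> g\<delta>)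
    (\<lambda>u v. coefficient_form \<Omega> u v M M - coefficient_form \<Omega> u v N N) q a"
proof -
  let ?L = "lebesgue_on \<Omega>"
  have N: "N \<in> P1 \<Omega> \<T>" unfolding N_def using N_h_solves[OF qa] by auto
  have M: "M \<in> P1 \<Omega> \<T>" unfolding M_def using M_h_solves[OF qa] by auto
  have c: "c > 0" and coeff: "q \<in> Linf ?L" "a \<in> Linf ?L"
    and lower: "AE x in ?L. c \<le> q x" "AE x in ?L. c \<le> a x"
    using qa by (auto simp: coercive_coefficients_def)
  let ?D = "\<lambda>u v. coefficient_form \<Omega> u v M M - coefficient_form \<Omega> u v N N"
  let ?J = "J_h \<Omega> \<T> \<Gamma> \<sigma> f j0 j\<delta> g\<delta>"
  define S where "S = sq_H1 \<Omega> M + sq_H1 \<Omega> N"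
  have S: "S \<ge> 0" unfolding S_def by (intro add_nonneg_nonneg sq_H1_nonneg)
  have comb: "coefficient_form \<Omega> (\<lambda>x. b * u x + d * u' x) (\<lambda>x. b * v x + d * v' x) y y
      = b * coefficient_form \<Omega> u v y y + d * coefficient_form \<Omega> u' v' y y"
    if "y \<in> P1 \<Omega> \<T>" "u \<in> Linf ?L" "v \<in> Linf ?L" "u' \<in> Linf ?L" "v' \<in> Linf ?L" for y u v u' v' b d
    using that by (intro coefficient_form_coefficients)
  have additive: "?D (\<lambda>x. u x + u' x) (\<lambda>x. v x + v' x) = ?D u v + ?D u' v'"
    if "u \<in> Linf ?L" "v \<in> Linf ?L" "u' \<in> Linf ?L" "v' \<in> Linf ?L" for u v u' v'
    using comb[OF M that, of 1 1] comb[OF N that, of 1 1] by simp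
  have homogeneous: "?D (\<lambda>x. b * u x) (\<lambda>x. b * v x) = b * ?D u v"
    if "u \<in> Linf ?L" "v \<in> Linf ?L" for u v b
    using comb[OF M that that, of b 0] comb[OF N that that, of b 0] by (simp add: right_diff_distrib)
  have bounded: "\<bar>?D u v\<bar> \<le> S * (Linf_norm ?L u + Linf_norm ?L v)"
    if "u \<in> Linf ?L" "v \<in> Linf ?L" for u v
  proof -
    have double: "K / 2 * (1 * n + n / 1) = K * n" for K n :: real by simp
    have "\<bar>coefficient_form \<Omega> u v y y\<bar> \<le> (Linf_norm ?L u + Linf_norm ?L v) * sq_H1 \<Omega> y" if "y \<in> P1 \<Omega> \<T>" for y
      using coefficient_form_bound[OF that that \<open>u \<in> Linf ?L\<close> \<open>v \<in> Linf ?L\<close> zero_less_one]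
      unfolding double .
    from add_mono[OF this[OF M] this[OF N]]
    have "\<bar>?D u v\<bar> \<le> (Linf_norm ?L u + Linf_norm ?L v) * sq_H1 \<Omega> M + (Linf_norm ?L u + Linf_norm ?L v) * sq_H1 \<Omega> N"
      by (rule order.trans[OF abs_triangle_ineq4])
    then show ?thesis by (simp only: S_def distrib_left[symmetric] mult.commute)
  qed
  have small: "\<exists>r>0. \<forall>u\<in>Linf ?L. \<forall>v\<in>Linf ?L. Linf_norm ?L u + Linf_norm ?L v < r \<longrightarrow>
      \<bar>?J (\<lambda>x. q x + u x) (\<lambda>x. a x + v x) - ?J q a - ?D u v\<bar> \<le> \<epsilon> * (Linf_norm ?L u + Linf_norm ?L v)"
    if \<epsilon>: "\<epsilon> > 0" for \<epsilon>
  \<comment> \<open>The radius \<open>c / 2\<close> keeps the perturbed coefficients above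
    \<open>c / 2\<close>; the second entry makes \<eta> S / (c / 2) at most \<epsilon>, with S + 1
    in the denominator because S may be 0.\<close>
  proof (intro exI[of _ "min (c / 2) (\<epsilon> * (c / 2) / (S + 1))"] conjI ballI impI)
    show "0 < min (c / 2) (\<epsilon> * (c / 2) / (S + 1))"
      using c \<epsilon> S by (auto intro!: divide_pos_pos mult_pos_pos)
  next
    fix u v assume u: "u \<in> Linf ?L" and v: "v \<in> Linf ?L"
      and less: "Linf_norm ?L u + Linf_norm ?L v < min (c / 2) (\<epsilon> * (c / 2) / (S + 1))"
    define \<eta> where "\<eta> = Linf_norm ?L u + Linf_norm ?L v"
    have \<eta>: "\<eta> \<ge> 0" "\<eta> < c / 2" "\<eta> \<le> \<epsilon> * (c / 2) / (S + 1)"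
      using less by (auto simp: \<eta>_def Linf_norm_nonneg)
    have half: "AE x in ?L. c / 2 \<le> p x + w x" if "AE x in ?L. c \<le> p x" "w \<in> Linf ?L" "Linf_norm ?L w \<le> \<eta>" for p w
      using that(1) Linf_AE_norm[OF that(2)]
    proof eventually_elim
      case (elim x)
      then show ?case using that(3) \<eta>(2) by linarith
    qed
    have "coercive_coefficients \<Omega> (c / 2) (\<lambda>x. q x + u x) (\<lambda>x. a x + v x)"
      unfolding coercive_coefficients_def
      using c coeff u v half[OF lower(1) u] half[OF lower(2) v] Linf_norm_nonneg[of ?L]
      by (simp add: Linf_add \<eta>_def)
    from J_h_increment[OF qa u v this]
    have "\<bar>?J (\<lambda>x. q x + u x) (\<lambda>x. a x + v x) - ?J q a - ?D u v\<bar> \<le> \<eta>\<^sup>2 / (c / 2) * S"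
      unfolding N_def M_def S_def \<eta>_def .
    also have "\<dots> = \<eta> * (\<eta> * (S / (c / 2)))" by (simp add: power2_eq_square)
    also have "\<dots> \<le> \<eta> * \<epsilon>"
    proof (rule mult_left_mono[OF _ \<eta>(1)])
      have "S + 1 > 0" using S by simp
      then have "\<eta> * (S + 1) \<le> \<epsilon> * (c / 2)" using \<eta>(3) by (simp only: pos_le_divide_eq)
      then have "\<eta> * S \<le> \<epsilon> * (c / 2)" using \<eta>(1) by (simp add: distrib_left)
      then show "\<eta> * (S / (c / 2)) \<le> \<epsilon>" using c by (simp add: field_simps)
    qed
    finally show "\<bar>?J (\<lambda>x. q x + u x) (\<lambda>x. a x + v x) - ?J q a - ?D u v\<bar> \<le> \<epsilon> * (Linf_norm ?L u + Linf_norm ?L v)"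
      by (simp add: \<eta>_def mult.commute)
  qed
  show ?thesis
    unfolding has_frechet_differential_def
    using additive homogeneous bounded small by blast
qed

text \<open>Boundedness of the separate integrands justifies splitting the integrals; this brings
  the derivative into the form asserted in the theorem.\<close>

lemma coefficient_form_difference:
  assumes y: "y \<in> P1 \<Omega> \<T>" and z: "z \<in> P1 \<Omega> \<T>" and u: "u \<in> Linf (lebesgue_on \<Omega>)" and v: "v \<in> Linf (lebesgue_on \<Omega>)"
  shows "coefficient_form \<Omega> u v y y - coefficient_form \<Omega> u v z z =
    (LINT x|lebesgue_on \<Omega>. u x * ((norm (weak_grad \<Omega> y x))\<^sup>2 - (norm (weak_grad \<Omega> z x))\<^sup>2)) +
    (LINT x|lebesgue_on \<Omega>. v x * (\<bar>y x\<bar>\<^sup>2 - \<bar>z x\<bar>\<^sup>2))"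
proof -
  note lin = Linf_integral_linear_combination[OF finite_measure_dom]
  have "(LINT x|lebesgue_on \<Omega>. u x * ((norm (weak_grad \<Omega> y x))\<^sup>2 - (norm (weak_grad \<Omega> z x))\<^sup>2))
      = (LINT x|lebesgue_on \<Omega>. u x * (weak_grad \<Omega> y x \<bullet> weak_grad \<Omega> y x)) - (LINT x|lebesgue_on \<Omega>. u x * (weak_grad \<Omega> z x \<bullet> weak_grad \<Omega> z x))"
    using lin[OF coefficient_form_Linf(1)[OF y y u] coefficient_form_Linf(1)[OF z z u], of 1 "- 1"]
    by (simp add: power2_norm_eq_inner right_diff_distrib)
  moreover have "(LINT x|lebesgue_on \<Omega>. v x * (\<bar>y x\<bar>\<^sup>2 - \<bar>z x\<bar>\<^sup>2))
      = (LINT x|lebesgue_on \<Omega>. v x * (y x * y x)) - (LINT x|lebesgue_on \<Omega>. v x * (z x * z x))"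
    using lin[OF coefficient_form_Linf(2)[OF y y v] coefficient_form_Linf(2)[OF z z v], of 1 "- 1"]
    by (simp add: power2_eq_square right_diff_distrib)
  ultimately show ?thesis by (simp add: coefficient_form_def)
qed

end

theorem lemma5p2:
  fixes \<Omega> \<Gamma> :: "'a::euclidean_space set"
    and \<T> :: "real \<Rightarrow> 'a set set" and H :: "real set" and h :: real
    and f j0 j\<delta> :: "('a \<Rightarrow> real) \<Rightarrow> real"
    and \<sigma> g\<delta> q a :: "'a \<Rightarrow> real"
    and q_lo q_hi a_lo a_hi :: real
  assumes dim: "DIM('a) \<ge> 2"
    and domain: "lipschitz_polygonal_domain \<Omega>"
    and Gamma: "\<Gamma> \<in> sets (surf \<Omega>)" "emeasure (surf \<Omega>) \<Gamma> > 0"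
    and f: "f \<in> H_minus1 \<Omega>"
    and j0: "j0 \<in> H_minus12 \<Omega> (frontier \<Omega> - \<Gamma>)"
    and sigma: "\<sigma> \<in> Linf (surf \<Omega>)" "AE x in surf \<Omega>. \<sigma> x \<ge> 0"
    and jdelta: "j\<delta> \<in> H_minus12 \<Omega> \<Gamma>"
    and gdelta: "g\<delta> \<in> H12 \<Omega> \<Gamma>"
    and q_bounds: "0 < q_lo" "q_lo \<le> q_hi"
    and a_bounds: "0 < a_lo" "a_lo \<le> a_hi"
    and mesh: "quasi_uniform_family \<Omega> H \<T>" "h \<in> H"
    and gdelta_discrete: "\<exists>v\<in>P1 \<Omega> (\<T> h). trace_eq \<Omega> \<Gamma> v g\<delta>"
    and q: "q \<in> box_Linf (lebesgue_on \<Omega>) q_lo q_hi \<inter> P1 \<Omega> (\<T> h)"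
    and a: "a \<in> box_Linf (lebesgue_on \<Omega>) a_lo a_hi \<inter> P1 \<Omega> (\<T> h)"
  shows "\<exists>D. has_frechet_differential (lebesgue_on \<Omega>)
               (J_h \<Omega> (\<T> h) \<Gamma> \<sigma> f j0 j\<delta> g\<delta>) D q a \<and>
             (\<forall>\<eta>q\<in>P1 \<Omega> (\<T> h). \<forall>\<eta>a\<in>P1 \<Omega> (\<T> h).
                D \<eta>q \<eta>a =
                  (LINT x|lebesgue_on \<Omega>. \<eta>q x *
                     ((norm (weak_grad \<Omega> (M_h \<Omega> (\<T> h) \<Gamma> \<sigma> f j0 g\<delta> q a) x))\<^sup>2 -
                      (norm (weak_grad \<Omega> (N_h \<Omega> (\<T> h) \<sigma> f j0 j\<delta> q a) x))\<^sup>2)) +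
                  (LINT x|lebesgue_on \<Omega>. \<eta>a x *
                     (\<bar>M_h \<Omega> (\<T> h) \<Gamma> \<sigma> f j0 g\<delta> q a x\<bar>\<^sup>2 -
                      \<bar>N_h \<Omega> (\<T> h) \<sigma> f j0 j\<delta> q a x\<bar>\<^sup>2)))"
proof -
  \<comment> \<open>\<open>coercive_coefficients\<close> wants one lower bound for both
    coefficients.\<close>
  let ?c = "min q_lo a_lo" and ?T = "\<T> h"
  have tri: "regular_triangulation \<Omega> h ?T" using mesh by (auto simp: quasi_uniform_family_def)
  interpret neumann_mixed_problem \<Omega> ?T \<sigma> \<Gamma> f j0 j\<delta> g\<delta>
  proof
    show "open \<Omega>" "bounded \<Omega>" "lipschitz_domain \<Omega>"
      using domain by (auto simp: lipschitz_polygonal_domain_def)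
    show "finite ?T" "\<Union>?T = closure \<Omega>" "\<And>T. T \<in> ?T \<Longrightarrow> int DIM('a) simplex T"
      using tri by (auto simp: regular_triangulation_def triangulation_def)
  qed (use dim sigma Gamma f j0 jdelta gdelta_discrete in auto)
  have "AE x in lebesgue_on \<Omega>. ?c \<le> q x"
    using q by (auto simp: box_Linf_def elim!: eventually_mono)
  moreover have "AE x in lebesgue_on \<Omega>. ?c \<le> a x"
    using a by (auto simp: box_Linf_def elim!: eventually_mono)
  ultimately have qa: "coercive_coefficients \<Omega> ?c q a"
    using q a q_bounds a_bounds by (simp add: coercive_coefficients_def box_Linf_def)
  \<comment> \<open>Directions in \<open>P1\<close> are essentially bounded, so the explicit formula
    applies to them.\<close>
  show ?thesis
    using has_frechet_differential_J_h[OF qa]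
      coefficient_form_difference[OF M_h_solves(1)[OF qa] N_h_solves(1)[OF qa] P1_Linf P1_Linf]
    by blast
qed

end
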